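(* Let $N\geq 3$ and let $u$ be a (not necessarily radially symmetric) solution of $|x|^{-2}\partial_t u=\Delta u$ in $\mathbb{R}^N\times(0,\infty)$ with initial data $u_0\in L^1_2(\mathbb{R}^N)$, $u_0\geq 0$, and $u_0(0)=K>0$. If there exist $\delta,\varepsilon>0$ such that $$|K-u_0(x)|\leq |x|^{\delta}\ \text{ as } |x|\to 0,\qquad u_0(x)\leq |x|^{-\varepsilon}\ \text{ as } |x|\to\infty$$ (that is, the inequalities hold for all $x$ with $|x|$ sufficiently small, respectively sufficiently large), then $$\left\|u(\cdot,t)-\frac{K}{2}E(\cdot,t)\right\|_{\infty}=O(t^{-1/2})\quad\text{as } t\to\infty,$$ where $$E(x,t):=\operatorname{erfc}\left(\frac{\log|x|+(N-2)t}{2\sqrt{t}}\right)\ \text{ for } x\neq 0,\qquad \operatorname{erfc}(\xi)=\frac{2}{\sqrt{\pi}}\int_{\xi}^{\infty}e^{-\theta^2}\,d\theta,\qquad E(0,t):=2.$$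
   Context: $L^1_2(\mathbb{R}^N)$ is the space of measurable $h:\mathbb{R}^N\to\mathbb{R}$ with $\int_{\mathbb{R}^N}|x|^{-2}|h(x)|\,dx<\infty$. A weak solution of $|x|^{-2}u_t=\Delta u$ in $\mathbb{R}^N\times(0,\infty)$ with initial data $u_0$ is a function $u\geq 0$ such that $u\in C([0,\infty);L^1_2(\mathbb{R}^N))\cap L^\infty(\mathbb{R}^N\times(\tau,\infty))$ for every $\tau>0$, $u(0)=u_0$, and $\iint u(\Delta\varphi+|x|^{-2}\varphi_t)\,dx\,dt=0$ for all $\varphi\in C_0^\infty(\mathbb{R}^N\times(0,\infty))$. A strong solution is a weak solution with $|x|^{-2}u_t,\ \Delta u\in L^1_{\rm loc}(Q_* )$ and $|x|^{-2}u_t=\Delta u$ a.e. in $Q_*$, where $Q_*=(\mathbb{R}^N\times(0,\infty))\setminus\{(0,t):t>0\}$. "Solution" means strong solution. $\|\cdot\|_\infty$ is the norm of $L^\infty(\mathbb{R}^N)$ in the variable $x$. *)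

theory Defs
  imports "HOL-Probability.Essential_Supremum" "HOL-Library.Landau_Symbols"
begin

text \<open>Space-time is the product type \<open>'a \<times> real\<close>, a point being a pair \<open>(x, t)\<close>. A function
  \<open>u :: real \<Rightarrow> 'a \<Rightarrow> real\<close> is read as the curve \<open>t \<mapsto> u(t)\<close> of functions of \<open>x\<close>.
  The value of \<open>1 / |x|\<^sup>2\<close> at the (Lebesgue null) point \<open>x = 0\<close> is 0.\<close>

definition spacetime :: "(real \<Rightarrow> 'a \<Rightarrow> real) \<Rightarrow> 'a \<times> real \<Rightarrow> real" where
  "spacetime u = (\<lambda>(x, t). u t x)"

definition L12 :: "('a::euclidean_space \<Rightarrow> real) set" where
  "L12 = {h. h \<in> borel_measurable lebesgue \<and> integrable lebesgue (\<lambda>x. \<bar>h x\<bar> / (norm x)\<^sup>2)}"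

definition L12_norm :: "('a::euclidean_space \<Rightarrow> real) \<Rightarrow> real" where
  "L12_norm h = (LINT x|lebesgue. \<bar>h x\<bar> / (norm x)\<^sup>2)"

definition continuous_in_L12 :: "(real \<Rightarrow> 'a::euclidean_space \<Rightarrow> real) \<Rightarrow> bool" where
  "continuous_in_L12 u \<longleftrightarrow>
     (\<forall>t\<ge>0. u t \<in> L12) \<and>
     (\<forall>s\<ge>0. ((\<lambda>t. L12_norm (\<lambda>x. u t x - u s x)) \<longlongrightarrow> 0) (at s within {0..}))"

definition Linf_norm :: "'a::euclidean_space set \<Rightarrow> ('a \<Rightarrow> real) \<Rightarrow> ereal" where
  "Linf_norm S f = esssup (lebesgue_on S) (\<lambda>x. ereal \<bar>f x\<bar>)"

definition Linf :: "'a::euclidean_space set \<Rightarrow> ('a \<Rightarrow> real) set" where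
  "Linf S = {f. f \<in> borel_measurable (lebesgue_on S) \<and> Linf_norm S f < \<infinity>}"

definition L1_loc :: "'a::euclidean_space set \<Rightarrow> ('a \<Rightarrow> real) set" where
  "L1_loc S = {f. f \<in> borel_measurable (lebesgue_on S) \<and>
                  (\<forall>K. compact K \<and> K \<subseteq> S \<longrightarrow> integrable (lebesgue_on K) f)}"

definition dir_deriv :: "'a::euclidean_space \<Rightarrow> ('a \<Rightarrow> real) \<Rightarrow> 'a \<Rightarrow> real" where
  "dir_deriv v f = (\<lambda>p. frechet_derivative f (at p) v)"

fun Ck :: "nat \<Rightarrow> ('a::euclidean_space \<Rightarrow> real) \<Rightarrow> bool" where
  "Ck 0 f \<longleftrightarrow> continuous_on UNIV f"
| "Ck (Suc k) f \<longleftrightarrow> (\<forall>p. f differentiable (at p)) \<and> (\<forall>b\<in>Basis. Ck k (dir_deriv b f))"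

text \<open>\<open>C\<^sub>0\<^sup>\<infinity>(S)\<close> for open \<open>S\<close>, its elements being extended by 0 to the whole space.\<close>

definition test_functions :: "'a::euclidean_space set \<Rightarrow> ('a \<Rightarrow> real) set" where
  "test_functions S = {\<phi>. (\<forall>k. Ck k \<phi>) \<and> compact (closure {p. \<phi> p \<noteq> 0}) \<and>
                          closure {p. \<phi> p \<noteq> 0} \<subseteq> S}"

definition time_deriv :: "('a::euclidean_space \<times> real \<Rightarrow> real) \<Rightarrow> 'a \<times> real \<Rightarrow> real" where
  "time_deriv \<phi> = dir_deriv (0, 1) \<phi>"

text \<open>The Laplacian in the spatial variable only.\<close>

definition space_laplacian :: "('a::euclidean_space \<times> real \<Rightarrow> real) \<Rightarrow> 'a \<times> real \<Rightarrow> real" where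
  "space_laplacian \<phi> = (\<lambda>p. \<Sum>b\<in>Basis. dir_deriv (b, 0) (dir_deriv (b, 0) \<phi>) p)"

text \<open>\<open>v\<close>, respectively \<open>w\<close>, is a locally integrable function representing the distribution
  \<open>\<partial>\<^sub>t f\<close>, respectively \<open>\<Delta> f\<close>, on \<open>S\<close>.\<close>

definition distr_time_deriv ::
    "('a::euclidean_space \<times> real) set \<Rightarrow> ('a \<times> real \<Rightarrow> real) \<Rightarrow> ('a \<times> real \<Rightarrow> real) \<Rightarrow> bool" where
  "distr_time_deriv S f v \<longleftrightarrow> f \<in> L1_loc S \<and> v \<in> L1_loc S \<and>
     (\<forall>\<phi>\<in>test_functions S.
        (LINT p|lebesgue_on S. f p * time_deriv \<phi> p) = - (LINT p|lebesgue_on S. v p * \<phi> p))"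

definition distr_laplacian ::
    "('a::euclidean_space \<times> real) set \<Rightarrow> ('a \<times> real \<Rightarrow> real) \<Rightarrow> ('a \<times> real \<Rightarrow> real) \<Rightarrow> bool" where
  "distr_laplacian S f w \<longleftrightarrow> f \<in> L1_loc S \<and> w \<in> L1_loc S \<and>
     (\<forall>\<phi>\<in>test_functions S.
        (LINT p|lebesgue_on S. f p * space_laplacian \<phi> p) = (LINT p|lebesgue_on S. w p * \<phi> p))"

text \<open>Elements of \<open>L\<^sup>1\<close> and \<open>L\<^sup>\<infinity>\<close> are represented by functions, so \<open>u \<ge> 0\<close> and \<open>u(0) = u\<^sub>0\<close>
  are almost everywhere statements. \<^const>\<open>has_bochner_integral\<close> includes integrability.\<close>

definition weak_solution ::
    "('a::euclidean_space \<Rightarrow> real) \<Rightarrow> (real \<Rightarrow> 'a \<Rightarrow> real) \<Rightarrow> bool" where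
  "weak_solution u0 u \<longleftrightarrow>
     (\<forall>t\<ge>0. AE x in lebesgue. 0 \<le> u t x) \<and>
     continuous_in_L12 u \<and>
     (\<forall>\<tau>>0. spacetime u \<in> Linf (UNIV \<times> {\<tau><..})) \<and>
     (AE x in lebesgue. u 0 x = u0 x) \<and>
     (\<forall>\<phi>\<in>test_functions (UNIV \<times> {0<..}).
        has_bochner_integral (lebesgue_on (UNIV \<times> {0<..}))
          (\<lambda>p. spacetime u p * (space_laplacian \<phi> p + time_deriv \<phi> p / (norm (fst p))\<^sup>2)) 0)"

definition Qstar :: "('a::euclidean_space \<times> real) set" where
  "Qstar = (UNIV \<times> {0<..}) - {0} \<times> {0<..}"

text \<open>The weight \<open>1 / |x|\<^sup>2\<close> is smooth on \<^const>\<open>Qstar\<close>, so the distribution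
  \<open>|x|\<^sup>-\<^sup>2 u\<^sub>t\<close> is locally integrable exactly if it is given by
  \<open>|x|\<^sup>-\<^sup>2 v\<close> with \<open>v\<close> a locally integrable representative of \<open>u\<^sub>t\<close>.\<close>

definition strong_solution ::
    "('a::euclidean_space \<Rightarrow> real) \<Rightarrow> (real \<Rightarrow> 'a \<Rightarrow> real) \<Rightarrow> bool" where
  "strong_solution u0 u \<longleftrightarrow> weak_solution u0 u \<and>
     (\<exists>v w. distr_time_deriv Qstar (spacetime u) v \<and>
            distr_laplacian Qstar (spacetime u) w \<and>
            (\<lambda>p. v p / (norm (fst p))\<^sup>2) \<in> L1_loc Qstar \<and> w \<in> L1_loc Qstar \<and>
            (AE p in lebesgue_on Qstar. v p / (norm (fst p))\<^sup>2 = w p))"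

definition erfc :: "real \<Rightarrow> real" where
  "erfc \<xi> = 2 / sqrt pi * (LINT \<theta>:{\<xi>..}|lebesgue. exp (- \<theta>\<^sup>2))"

definition E :: "'a::euclidean_space \<Rightarrow> real \<Rightarrow> real" where
  "E x t = (if x = 0 then 2
            else erfc ((ln (norm x) + (real DIM('a) - 2) * t) / (2 * sqrt t)))"

end

theory Submission
  imports Defs "HOL-Probability.Distributions"
begin

text \<open>With \<open>y = ln |x|\<close> the equation becomes a heat equation with drift on the cylinder
  \<open>\<real> \<times> S\<^sup>N\<^sup>-\<^sup>1\<close>, for which \<open>K / 2 * E\<close> is the exact radial solution whose initial value is \<open>K\<close>
  on the unit ball and 0 outside. The deviation \<open>w = u - K / 2 * E\<close> is again a solution. Since
  \<open>|x|\<^sup>-\<^sup>2 u\<^sub>t\<close> and \<open>\<Delta> u\<close> are locally integrable functions, Kato's inequality makes \<open>|w|\<close> a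
  subsolution away from \<open>x = 0\<close>, so \<open>\<integral> |w(t)| \<psi>(t) |x|\<^sup>-\<^sup>2 dx\<close> is nonincreasing in \<open>t\<close> for every positive
  supersolution \<open>\<psi>\<close> of the adjoint equation that is bounded in the logarithmic variable.

  Two explicit \<open>\<psi>\<close> suffice: the radial Gaussian kernel, whose size \<open>t\<^sup>-\<^sup>1\<^sup>/\<^sup>2\<close> gives the rate, and,
  on the last unit of time, its product with a supersolution of the heat equation on the sphere that
  concentrates at a point. The latter replaces the spherical heat kernel and turns the integral
  inequality into a bound for the averages of \<open>|w(t)|\<close> over small balls. The hypotheses on
  \<open>u\<^sub>0\<close> enter only through the finiteness of \<open>\<integral> |w(0)| |x|\<^sup>-\<^sup>N dx\<close>.\<close>

section \<open>Smooth bump functions\<close>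

text \<open>The measure \<open>|x|^(-N) dx\<close> is \<open>dy d\<omega>\<close> on the cylinder,
  so the claim is the \<open>t^(-1/2)\<close> smoothing from L^1 to L^\<infinity> on a space that is
  one-dimensional at large scales; the sphere costs only a constant, paid during one unit of time.
  Uniformity in \<open>x\<close> reflects dilation invariance: for a ball of radius \<open>r\<close>
  at \<open>x\<close> only the ratio \<open>r / |x|\<close> enters. The factor \<open>K / 2\<close>
  is forced: as \<open>t\<close> tends to 0, \<open>E\<close> tends to 2 inside the unit ball and to
  0 outside, so \<open>|w(0)|\<close> is at most \<open>|x|^\<delta>\<close> near the origin and
  \<open>|x|^(-\<epsilon>)\<close> near infinity. The obstacle is low regularity: the solution is a
  locally integrable function with distributional derivatives, controlled only away from
  \<open>x = 0\<close>. Convexity is therefore applied to mollifications, whose defect in the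
  equation tends to 0 in L^1. The singular line and infinity are the two ends of the cylinder, and
  one cutoff in \<open>y\<close> removes both at a cost of order \<open>1 / R\<close>. Pointwise
  bounds come from ball averages by a covering theorem, so no parabolic regularity theory is
  invoked.\<close>

definition bump_profile :: "nat \<Rightarrow> real \<Rightarrow> real" where
  "bump_profile n s = (if s < 1 then exp (- 1 / (1 - s)) / (1 - s) ^ n else 0)"

lemma bump_profile_nonneg: "0 \<le> bump_profile n s"
  by (simp add: bump_profile_def)

text \<open>A single term of the exponential series, with exponent \<open>n + 2\<close>, is at most
  \<open>exp (1 / h)\<close>. The spare power 2 gives differentiability at the edge
  \<open>s = 1\<close>, where the two branches meet.\<close>

lemma bump_profile_le_square: "\<bar>bump_profile n s\<bar> \<le> fact (n + 2) * (s - 1)\<^sup>2"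
proof (cases "s < 1")
  case True
  define h where "h = 1 - s"
  have h: "h > 0" using True by (simp add: h_def)
  have "(1 / h) ^ (n + 2) /\<^sub>R fact (n + 2) \<le> (\<Sum>k. (1 / h) ^ k /\<^sub>R fact k)"
    using sum_le_suminf[OF summable_exp_generic[of "1 / h"], of "{n + 2}"] h by simp
  hence "(1 / h) ^ (n + 2) / fact (n + 2) \<le> exp (1 / h)"
    by (simp add: exp_def divide_inverse mult.commute)
  hence "exp (- 1 / h) * ((1 / h) ^ (n + 2) / fact (n + 2)) \<le> exp (- 1 / h) * exp (1 / h)"
    by (intro mult_left_mono) auto
  hence "exp (- 1 / h) * ((1 / h) ^ (n + 2) / D) \<le> 1" if "D = fact (n + 2)" for D
    using that by (simp add: exp_minus)
  hence "exp (- 1 / h) / h ^ n \<le> D * h ^ 2" if "D = fact (n + 2)" for D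
    using h that fact_gt_zero[of "n + 2", where 'a=real]
    by (simp add: field_simps power_add power2_eq_square del: fact_gt_zero fact_Suc)
  hence "exp (- 1 / h) / h ^ n \<le> fact (n + 2) * h ^ 2" by blast
  moreover have "bump_profile n s = exp (- 1 / h) / h ^ n"
    using True by (simp add: bump_profile_def h_def)
  moreover have "h ^ 2 = (s - 1)\<^sup>2"
    by (simp add: h_def power2_commute)
  ultimately show ?thesis
    using bump_profile_nonneg[of n s] by simp
qed (simp add: bump_profile_def)

lemma has_real_derivative_0_if_quadratic:
  fixes f :: "real \<Rightarrow> real"
  assumes "\<And>x. \<bar>f x\<bar> \<le> C * (x - a)\<^sup>2"
  shows "(f has_real_derivative 0) (at a)"
proof -
  have fa: "f a = 0" using assms[of a] by simp
  have "((\<lambda>x. (f x - f a) / (x - a)) \<longlongrightarrow> 0) (at a)"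
  proof (rule Lim_null_comparison)
    show "\<forall>\<^sub>F x in at a. norm ((f x - f a) / (x - a)) \<le> C * \<bar>x - a\<bar>"
    proof -
      have "norm ((f x - f a) / (x - a)) \<le> C * \<bar>x - a\<bar>" if x: "x \<noteq> a" for x
      proof -
      have "\<bar>f x\<bar> / \<bar>x - a\<bar> \<le> C * \<bar>x - a\<bar>"
        using assms[of x] x
        by (subst pos_divide_le_eq) (auto simp: power2_eq_square abs_mult[symmetric])
      thus "norm ((f x - f a) / (x - a)) \<le> C * \<bar>x - a\<bar>" by (simp add: fa)
      qed
      thus ?thesis by (simp add: eventually_at_filter)
    qed
    show "((\<lambda>x. C * \<bar>x - a\<bar>) \<longlongrightarrow> 0) (at a)"
      by (auto intro!: tendsto_eq_intros)
  qed
  thus ?thesis by (simp add: has_field_derivative_iff)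
qed

lemma bump_profile_deriv:
  "(bump_profile n has_real_derivative
     (real n * bump_profile (n + 1) s - bump_profile (n + 2) s)) (at s)"
proof (cases "s < 1")
  case True
  have "((\<lambda>s. exp (- 1 / (1 - s)) / (1 - s) ^ n) has_real_derivative
     (real n * bump_profile (n + 1) s - bump_profile (n + 2) s)) (at s)"
  proof -
    define h where "h = 1 - s"
    have h: "h > 0" using True by (simp add: h_def)
    have A: "((\<lambda>s. exp (- 1 / (1 - s))) has_real_derivative exp (- 1 / h) * (- 1 / h\<^sup>2)) (at s)"
      using h by (auto intro!: derivative_eq_intros simp: h_def power2_eq_square)
    have B: "((\<lambda>s. (1 - s) ^ n) has_real_derivative - (real n * h ^ (n - 1))) (at s)"
      by (auto intro!: derivative_eq_intros simp: h_def)
    have "(exp (- 1 / h) * (- 1 / h\<^sup>2) * h ^ n - exp (- 1 / h) * (- (real n * h ^ (n - 1)))) / (h ^ n * h ^ n)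
        = real n * (exp (- 1 / h) / h ^ (n + 1)) - exp (- 1 / h) / h ^ (n + 2)"
      using h by (cases n) (simp_all add: field_simps power2_eq_square)
    thus ?thesis using DERIV_divide[OF A B] h True
      by (simp add: bump_profile_def h_def)
  qed
  thus ?thesis
    by (rule has_field_derivative_transform_within_open[where S="{..<1}"])
       (use True in \<open>auto simp: bump_profile_def\<close>)
next
  case False
  show ?thesis
  proof (cases "s = 1")
    case True
    have "real n * bump_profile (n + 1) s - bump_profile (n + 2) s = 0"
      using True by (simp add: bump_profile_def)
    thus ?thesis using True has_real_derivative_0_if_quadratic[OF bump_profile_le_square[of n]] by simp
  next
    case False2: False
    have "((\<lambda>s. 0) has_real_derivative 0) (at s)" by simp
    hence "(bump_profile n has_real_derivative 0) (at s)"
      by (rule has_field_derivative_transform_within_open[where S="{1<..}"])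
         (use False False2 in \<open>auto simp: bump_profile_def\<close>)
    thus ?thesis using False by (simp add: bump_profile_def)
  qed
qed

text \<open>Smoothness is obtained from closure: directional derivatives stay in the class, so
  \<open>Ck k\<close> follows for every \<open>k\<close> by induction. The polynomial factor absorbs
  the inner derivative of \<open>(norm (p - q))\<^sup>2\<close>.\<close>

inductive bump_class :: "'c::euclidean_space \<Rightarrow> real \<Rightarrow> ('c \<Rightarrow> real) \<Rightarrow> bool"
  for q :: 'c and \<epsilon> :: real where
  base: "real_polynomial_function P \<Longrightarrow>
           bump_class q \<epsilon> (\<lambda>p. P p * bump_profile n ((norm (p - q))\<^sup>2 / \<epsilon>\<^sup>2))"
| add: "bump_class q \<epsilon> f \<Longrightarrow> bump_class q \<epsilon> g \<Longrightarrow> bump_class q \<epsilon> (\<lambda>p. f p + g p)"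

lemma real_polynomial_function_has_derivative:
  fixes P :: "'c::euclidean_space \<Rightarrow> real"
  assumes "real_polynomial_function P"
  shows "\<exists>P'. (\<forall>p. (P has_derivative P' p) (at p)) \<and> (\<forall>b. real_polynomial_function (\<lambda>p. P' p b))"
  using assms
proof induction
  case (linear f)
  thus ?case by (intro exI[of _ "\<lambda>_. f"]) (auto intro: bounded_linear_imp_has_derivative)
next
  case (const c)
  show ?case by (intro exI[of _ "\<lambda>_ _. 0"]) auto
next
  case (add f g)
  then obtain f' g' where "\<forall>p. (f has_derivative f' p) (at p)" "\<forall>p. (g has_derivative g' p) (at p)"
    "\<forall>b. real_polynomial_function (\<lambda>p. f' p b)" "\<forall>b. real_polynomial_function (\<lambda>p. g' p b)" by blast
  thus ?case by (intro exI[of _ "\<lambda>p b. f' p b + g' p b"]) (auto intro!: derivative_intros)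
next
  case (mult f g)
  then obtain f' g' where *: "\<forall>p. (f has_derivative f' p) (at p)" "\<forall>p. (g has_derivative g' p) (at p)"
    "\<forall>b. real_polynomial_function (\<lambda>p. f' p b)" "\<forall>b. real_polynomial_function (\<lambda>p. g' p b)" by blast
  show ?case using * mult(1,2)
    by (intro exI[of _ "\<lambda>p b. f p * g' p b + f' p b * g p"])
       (auto intro!: derivative_intros real_polynomial_function.intros(3,4))
qed

lemma bump_class_has_derivative:
  assumes "bump_class q \<epsilon> f"
  shows "\<exists>f'. (\<forall>p. (f has_derivative f' p) (at p)) \<and> (\<forall>b. bump_class q \<epsilon> (\<lambda>p. f' p b))"
  using assms
proof induction
  case (base P n)
  obtain P' where P': "\<forall>p. (P has_derivative P' p) (at p)"
    "\<forall>b. real_polynomial_function (\<lambda>p. P' p b)"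
    using real_polynomial_function_has_derivative[OF base] by blast
  define B where "B = (\<lambda>n p. bump_profile n ((norm (p - q))\<^sup>2 / \<epsilon>\<^sup>2))"
  define f' where "f' = (\<lambda>p b. P p * ((real n * B (n + 1) p - B (n + 2) p) * (2 * ((p - q) \<bullet> b) / \<epsilon>\<^sup>2))
        + P' p b * B n p)"
  have B': "(B n has_derivative (\<lambda>b. (real n * B (n + 1) p - B (n + 2) p) * (2 * ((p - q) \<bullet> b) / \<epsilon>\<^sup>2))) (at p)" for p
  proof -
    have "((\<lambda>p. inverse (\<epsilon>\<^sup>2) * ((p - q) \<bullet> (p - q))) has_derivative
        (\<lambda>b. inverse (\<epsilon>\<^sup>2) * (2 * ((p - q) \<bullet> b)))) (at p)"
      by (auto intro!: derivative_eq_intros simp: inner_commute)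
    hence "((\<lambda>p. (p - q) \<bullet> (p - q) / \<epsilon>\<^sup>2) has_derivative (\<lambda>b. 2 * ((p - q) \<bullet> b) / \<epsilon>\<^sup>2)) (at p)"
      by (simp add: divide_inverse mult.commute)
    from has_derivative_compose[OF this
        bump_profile_deriv[of n "(p - q) \<bullet> (p - q) / \<epsilon>\<^sup>2", unfolded has_field_derivative_def]]
    show ?thesis by (simp add: B_def power2_norm_eq_inner)
  qed
  have "((\<lambda>p. P p * B n p) has_derivative f' p) (at p)" for p
    unfolding f'_def by (rule has_derivative_mult[OF P'(1)[rule_format] B'])
  moreover have "bump_class q \<epsilon> (\<lambda>p. f' p b)" for b
  proof -
    have lin: "real_polynomial_function (\<lambda>p. (p - q) \<bullet> b)"
      unfolding inner_diff_left
      by (intro real_polynomial_function_diff real_polynomial_function.intros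
          bounded_linear_inner_left)
    have 1: "real_polynomial_function (\<lambda>p. P p * (real n * 2 / \<epsilon>\<^sup>2) * ((p - q) \<bullet> b))"
         and 2: "real_polynomial_function (\<lambda>p. P p * (- 2 / \<epsilon>\<^sup>2) * ((p - q) \<bullet> b))"
      by (intro real_polynomial_function.intros(2,4) base lin)+
    \<comment> \<open>Product rule and profile recursion split \<open>f'\<close> into three base
      functions, with profile indices \<open>n + 1\<close>, \<open>n + 2\<close> and
      \<open>n\<close>.\<close>
    have "bump_class q \<epsilon> (\<lambda>p. ((P p * (real n * 2 / \<epsilon>\<^sup>2) * ((p - q) \<bullet> b)) * B (n+1) p
         + (P p * (- 2 / \<epsilon>\<^sup>2) * ((p - q) \<bullet> b)) * B (n+2) p) + P' p b * B n p)"
      unfolding B_def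
      by (rule bump_class.add[OF bump_class.add[OF bump_class.base[OF 1] bump_class.base[OF 2]]
            bump_class.base[OF P'(2)[rule_format]]])
    also have "(\<lambda>p. ((P p * (real n * 2 / \<epsilon>\<^sup>2) * ((p - q) \<bullet> b)) * B (n+1) p
         + (P p * (- 2 / \<epsilon>\<^sup>2) * ((p - q) \<bullet> b)) * B (n+2) p) + P' p b * B n p) = (\<lambda>p. f' p b)"
      by (simp add: f'_def fun_eq_iff divide_inverse left_diff_distrib right_diff_distrib mult_ac)
    finally show ?thesis .
  qed
  ultimately show ?case unfolding B_def by blast
next
  case (add f g)
  then obtain f' g' where "\<forall>p. (f has_derivative f' p) (at p)" "\<forall>p. (g has_derivative g' p) (at p)"
    "\<forall>b. bump_class q \<epsilon> (\<lambda>p. f' p b)" "\<forall>b. bump_class q \<epsilon> (\<lambda>p. g' p b)" by blast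
  thus ?case by (intro exI[of _ "\<lambda>p b. f' p b + g' p b"]) (auto intro!: derivative_intros intro: bump_class.add)
qed

lemma dir_deriv_eq: "(f has_derivative f') (at p) \<Longrightarrow> dir_deriv b f p = f' b"
  unfolding dir_deriv_def using frechet_derivative_at by metis

lemma bump_class_differentiable: "bump_class q \<epsilon> f \<Longrightarrow> f differentiable (at p)"
  using bump_class_has_derivative unfolding differentiable_def by blast

lemma bump_class_dir_deriv:
  assumes "bump_class q \<epsilon> f" shows "bump_class q \<epsilon> (dir_deriv b f)"
proof -
  obtain f' where f': "\<forall>p. (f has_derivative f' p) (at p)" "\<forall>b. bump_class q \<epsilon> (\<lambda>p. f' p b)"
    using bump_class_has_derivative[OF assms] by blast
  have "dir_deriv b f = (\<lambda>p. f' p b)" using f'(1) dir_deriv_eq by blast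
  thus ?thesis using f'(2) by simp
qed

lemma bump_class_continuous: "bump_class q \<epsilon> f \<Longrightarrow> continuous_on UNIV f"
  by (meson bump_class_differentiable differentiable_imp_continuous_within
      continuous_at_imp_continuous_on)

lemma bump_class_Ck: "bump_class q \<epsilon> f \<Longrightarrow> Ck k f"
  by (induction k arbitrary: f)
     (auto simp: bump_class_continuous bump_class_differentiable bump_class_dir_deriv)

lemma bump_class_support:
  assumes "bump_class q \<epsilon> f" "norm (p - q) \<ge> \<epsilon>" "\<epsilon> > 0" shows "f p = 0"
  using assms(1)
proof induction
  case (base P n)
  have "(norm (p - q))\<^sup>2 / \<epsilon>\<^sup>2 \<ge> 1"
    using assms(2,3) power_mono[of \<epsilon> "norm (p - q)" 2] by (simp add: divide_simps)
  thus ?case by (simp add: bump_profile_def)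
qed simp

lemma bump_class_test_function:
  assumes "bump_class q \<epsilon> f" "\<epsilon> > 0" "cball q \<epsilon> \<subseteq> S" shows "f \<in> test_functions S"
proof -
  have "{p. f p \<noteq> 0} \<subseteq> cball q \<epsilon>"
    using bump_class_support[OF assms(1) _ assms(2)]
    by (auto simp: dist_norm norm_minus_commute) (meson linorder_le_cases)
  hence sub: "closure {p. f p \<noteq> 0} \<subseteq> cball q \<epsilon>"
    by (simp add: closure_minimal)
  hence "compact (closure {p. f p \<noteq> 0})"
    by (meson bounded_cball bounded_subset closed_closure compact_eq_bounded_closed)
  thus ?thesis using sub assms bump_class_Ck unfolding test_functions_def by blast
qed

text \<open>Derivative along one line, with its value as an argument: product, quotient and chain
  rules compose without separate differentiability conditions, and convolutions need nothing
  stronger.\<close>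

definition DD :: "'c::euclidean_space \<Rightarrow> ('c \<Rightarrow> real) \<Rightarrow> real \<Rightarrow> 'c \<Rightarrow> bool" where
  "DD b f f' p \<longleftrightarrow> ((\<lambda>s. f (p + s *\<^sub>R b)) has_real_derivative f') (at 0)"

lemma DD_line:
  assumes "DD b f f' (p + s *\<^sub>R b)"
  shows "((\<lambda>s. f (p + s *\<^sub>R b)) has_real_derivative f') (at s)"
proof -
  have "((\<lambda>r. f (p + s *\<^sub>R b + r *\<^sub>R b)) has_real_derivative f') (at (s - s))"
    using assms by (simp add: DD_def)
  hence "((\<lambda>r. f (p + s *\<^sub>R b + (r - s) *\<^sub>R b)) has_real_derivative f' * 1) (at s)"
    by (intro DERIV_chain2[where g="\<lambda>r. r - s"]) (auto intro!: derivative_eq_intros)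
  thus ?thesis by (simp add: algebra_simps)
qed

lemma DD_has_derivative: "(f has_derivative f') (at p) \<Longrightarrow> DD b f (f' b) p"
proof -
  assume f: "(f has_derivative f') (at p)"
  have "((\<lambda>s. p + s *\<^sub>R b) has_derivative (\<lambda>s. s *\<^sub>R b)) (at (0::real))"
    by (auto intro!: derivative_eq_intros)
  from has_derivative_compose[OF this, of f f'] f
  have "((\<lambda>s. f (p + s *\<^sub>R b)) has_derivative (\<lambda>s. f' (s *\<^sub>R b))) (at 0)" by simp
  moreover have "(\<lambda>s. f' (s *\<^sub>R b)) = (*) (f' b)"
    using has_derivative_linear[OF f] by (auto simp: linear_cmul)
  ultimately show "DD b f (f' b) p" by (simp add: DD_def has_field_derivative_def)
qed

lemma bump_class_DD: "bump_class q \<epsilon> f \<Longrightarrow> DD b f (dir_deriv b f p) p"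
  using bump_class_has_derivative DD_has_derivative dir_deriv_eq by metis

text \<open>Mollifiers are tested in the form \<open>\<psi> (q - p)\<close> as functions of
  \<open>p\<close>. The sign found here is the one that appears when derivatives move from the test
  function to the convolution.\<close>

lemma dir_deriv_reflect:
  assumes "\<And>p. f differentiable (at p)"
  shows "dir_deriv b (\<lambda>p. f (q - p)) p = - dir_deriv b f (q - p)"
proof -
  obtain f' where f': "(f has_derivative f') (at (q - p))"
    using assms unfolding differentiable_def by blast
  have "((\<lambda>p. q - p) has_derivative (\<lambda>h. - h)) (at p)"
    by (auto intro!: derivative_eq_intros)
  from has_derivative_compose[OF this f']
  have "((\<lambda>p. f (q - p)) has_derivative (\<lambda>h. f' (- h))) (at p)" .
  moreover have "f' (- b) = - f' b" using has_derivative_linear[OF f'] by (rule linear_neg)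
  ultimately show ?thesis using dir_deriv_eq[OF f'] by (simp add: dir_deriv_eq)
qed

section \<open>Mollification in \<open>L\<^sup>1\<close>\<close>

lemma integrable_compact_support:
  fixes f :: "'c::euclidean_space \<Rightarrow> real"
  assumes "continuous_on UNIV f" "\<And>x. norm x > r \<Longrightarrow> f x = 0"
  shows "integrable lborel f"
proof -
  have "integrable lborel (\<lambda>x. indicator (cball 0 r) x *\<^sub>R f x)"
    by (rule borel_integrable_compact) (auto intro: continuous_on_subset[OF assms(1)])
  also have "(\<lambda>x. indicator (cball 0 r) x *\<^sub>R f x) = f"
    using assms(2) by (auto simp: indicator_def fun_eq_iff not_le)
  finally show ?thesis .
qed

lemma bounded_compact_support:
  fixes f :: "'c::euclidean_space \<Rightarrow> real"
  assumes "continuous_on UNIV f" "\<And>x. norm x > r \<Longrightarrow> f x = 0"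
  obtains M where "\<And>x. \<bar>f x\<bar> \<le> M" "M \<ge> 0"
proof -
  have "compact (f ` cball 0 r)"
    by (intro compact_continuous_image continuous_on_subset[OF assms(1)]) auto
  then obtain M where M: "\<And>y. y \<in> f ` cball 0 r \<Longrightarrow> \<bar>y\<bar> \<le> M"
    using compact_imp_bounded bounded_iff by (metis real_norm_def)
  have "\<bar>f x\<bar> \<le> max M 0" for x
    using M[of "f x"] assms(2)[of x] by (cases "norm x \<le> r") (auto simp: max_def)
  thus ?thesis using that by (metis max.cobounded2)
qed

text \<open>Density of continuous compactly supported functions in L^1, stated for one function at a
  time so that \<open>integrable_induct\<close> can establish it.\<close>

definition L1_approx :: "('c::euclidean_space \<Rightarrow> real) \<Rightarrow> bool" where
  "L1_approx f \<longleftrightarrow> (\<forall>\<eta>>0. \<exists>g r. continuous_on UNIV g \<and> (\<forall>x. norm x > r \<longrightarrow> g x = 0) \<and>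
       (LINT x|lborel. \<bar>f x - g x\<bar>) < \<eta>)"

lemma L1_approx_limit:
  fixes f :: "'c::euclidean_space \<Rightarrow> real"
  assumes "\<And>i. integrable lborel (s i)" "\<And>i. L1_approx (s i)"
    "\<And>x. (\<lambda>i. s i x) \<longlonglongrightarrow> f x" "\<And>i x. norm (s i x) \<le> w x"
    "integrable lborel f" "integrable lborel w"
  shows "L1_approx f"
  unfolding L1_approx_def
proof (intro allI impI)
  fix \<eta> :: real assume \<eta>: "\<eta> > 0"
  have "(\<lambda>i. LINT x|lborel. \<bar>f x - s i x\<bar>) \<longlonglongrightarrow> (LINT x|(lborel::'c measure). 0)"
  proof (rule integral_dominated_convergence[where w="\<lambda>x. \<bar>f x\<bar> + w x"])
    show "AE x in lborel. (\<lambda>i. \<bar>f x - s i x\<bar>) \<longlonglongrightarrow> 0"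
    proof (rule AE_I2)
      fix x
      have "(\<lambda>i. \<bar>f x - s i x\<bar>) \<longlonglongrightarrow> \<bar>f x - f x\<bar>"
        by (intro tendsto_intros assms(3))
      thus "(\<lambda>i. \<bar>f x - s i x\<bar>) \<longlonglongrightarrow> 0" by simp
    qed
    show "AE x in lborel. norm \<bar>f x - s i x\<bar> \<le> \<bar>f x\<bar> + w x" for i
      using assms(4)[of i] by (intro AE_I2) (smt (verit) real_norm_def)
  qed (use assms in \<open>auto\<close>)
  hence "\<forall>\<^sub>F i in sequentially. (LINT x|lborel. \<bar>f x - s i x\<bar>) < \<eta> / 2"
    using \<eta> by (intro order_tendstoD(2)) auto
  then obtain i where i: "(LINT x|lborel. \<bar>f x - s i x\<bar>) < \<eta> / 2"
    by (auto simp: eventually_sequentially)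
  obtain g r where g: "continuous_on UNIV g" "\<forall>x. norm x > r \<longrightarrow> g x = 0"
      "(LINT x|lborel. \<bar>s i x - g x\<bar>) < \<eta> / 2"
    using assms(2)[of i] \<eta> unfolding L1_approx_def by (meson half_gt_zero)
  have gi: "integrable lborel g" using g by (intro integrable_compact_support) auto
  have "(LINT x|lborel. \<bar>f x - g x\<bar>) \<le> (LINT x|lborel. \<bar>f x - s i x\<bar> + \<bar>s i x - g x\<bar>)"
    using assms gi by (intro integral_mono) auto
  also have "\<dots> = (LINT x|lborel. \<bar>f x - s i x\<bar>) + (LINT x|lborel. \<bar>s i x - g x\<bar>)"
    using assms gi by (intro Bochner_Integration.integral_add) auto
  finally show "\<exists>g r. continuous_on UNIV g \<and> (\<forall>x. norm x > r \<longrightarrow> g x = 0) \<and>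
       (LINT x|lborel. \<bar>f x - g x\<bar>) < \<eta>" using i g by (intro exI[of _ g] exI[of _ r]) auto
qed

lemma L1_approx_add:
  fixes f :: "'c::euclidean_space \<Rightarrow> real"
  assumes f: "integrable lborel f" "L1_approx f" and g: "integrable lborel g" "L1_approx g"
  shows "L1_approx (\<lambda>x. f x + g x)"
  unfolding L1_approx_def
proof (intro allI impI)
  fix \<eta> :: real assume \<eta>: "\<eta> > 0"
  obtain h r where h: "continuous_on UNIV h" "\<forall>x. norm x > r \<longrightarrow> h x = 0"
      "(LINT x|lborel. \<bar>f x - h x\<bar>) < \<eta> / 2"
    using f(2) \<eta> unfolding L1_approx_def by (meson half_gt_zero)
  obtain k r' where k: "continuous_on UNIV k" "\<forall>x. norm x > r' \<longrightarrow> k x = 0"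
      "(LINT x|lborel. \<bar>g x - k x\<bar>) < \<eta> / 2"
    using g(2) \<eta> unfolding L1_approx_def by (meson half_gt_zero)
  have i: "integrable lborel h" "integrable lborel k"
    using h k by (auto intro: integrable_compact_support)
  have "(LINT x|lborel. \<bar>f x + g x - (h x + k x)\<bar>) \<le> (LINT x|lborel. \<bar>f x - h x\<bar> + \<bar>g x - k x\<bar>)"
    using f g i by (intro integral_mono) auto
  also have "\<dots> = (LINT x|lborel. \<bar>f x - h x\<bar>) + (LINT x|lborel. \<bar>g x - k x\<bar>)"
    using f g i by (intro Bochner_Integration.integral_add) auto
  finally show "\<exists>g' r. continuous_on UNIV g' \<and> (\<forall>x. norm x > r \<longrightarrow> g' x = 0) \<and>
       (LINT x|lborel. \<bar>f x + g x - g' x\<bar>) < \<eta>" using h k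
    by (intro exI[of _ "\<lambda>x. h x + k x"] exI[of _ "max r r'"]) (auto intro!: continuous_intros)
qed

text \<open>Up to the factor \<open>c\<close>, the indicator is the limit of the tents
  \<open>max 0 (1 - i * infdist x K)\<close>, which are continuous and, for \<open>i > 0\<close>,
  supported within distance 1 of \<open>K\<close>.\<close>

lemma L1_approx_compact:
  assumes K: "compact (K :: 'c::euclidean_space set)"
  shows "L1_approx (\<lambda>x. indicator K x * c)"
proof (cases "K = {}")
  case False
  then obtain r where r: "\<And>x. x \<in> K \<Longrightarrow> norm x \<le> r"
    using compact_imp_bounded[OF K] bounded_iff by metis
  define s where "s = (\<lambda>i x. max 0 (1 - real i * infdist x K) * c)"
  have cont: "continuous_on UNIV (s i)" for i
    unfolding s_def by (intro continuous_intros)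
  have supp: "s i x = 0" if "norm x > r + 1" "i > 0" for i x
  proof -
    obtain y where y: "y \<in> K" "infdist x K = dist x y"
      using infdist_attains_inf[OF compact_imp_closed[OF K] False] by blast
    have "dist x y \<ge> 1" using r[OF y(1)] that(1) norm_triangle_ineq2[of x y] by (simp add: dist_norm)
    hence "real i * infdist x K \<ge> 1" using that(2) y(2) mult_mono[of 1 "real i" 1 "dist x y"] by simp
    thus ?thesis by (simp add: s_def)
  qed
  \<comment> \<open>The index is shifted because the tent with \<open>i = 0\<close> is constant and
    not compactly supported.\<close>
  have int: "integrable lborel (s (Suc i))" for i
    using cont supp by (intro integrable_compact_support) auto
  have fin: "emeasure lborel K < \<infinity>" using emeasure_compact_finite[OF K] .
  show ?thesis
  proof (rule L1_approx_limit[where s="\<lambda>i. s (Suc i)" and w="\<lambda>x. indicator (cball 0 (r+1)) x * \<bar>c\<bar>"])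
    show "L1_approx (s (Suc i))" for i
      unfolding L1_approx_def using cont[of "Suc i"] supp[of _ "Suc i"]
      by (intro allI impI exI[of _ "s (Suc i)"] exI[of _ "r + 1"]) auto
    show "(\<lambda>i. s (Suc i) x) \<longlonglongrightarrow> indicator K x * c" for x
    proof (cases "x \<in> K")
      case True
      thus ?thesis by (simp add: s_def)
    next
      case False2: False
      have d: "infdist x K > 0"
        using infdist_pos_not_in_closed[OF compact_imp_closed[OF K] False False2] .
      then obtain n where n: "real n * infdist x K > 1" using reals_Archimedean3 by blast
      have "s (Suc i) x = 0" if "i \<ge> n" for i
      proof -
        have "real n * infdist x K \<le> real (Suc i) * infdist x K"
          using that d by (intro mult_right_mono) auto
        thus ?thesis using n by (simp add: s_def)
      qed
      hence "\<forall>\<^sub>F i in sequentially. s (Suc i) x = 0" by (auto simp: eventually_sequentially)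
      thus ?thesis using False2 by (simp add: tendsto_eventually)
    qed
    show "norm (s (Suc i) x) \<le> indicator (cball 0 (r + 1)) x * \<bar>c\<bar>" for i x
    proof (cases "norm x > r + 1")
      case True thus ?thesis using supp[of x "Suc i"] by simp
    next
      case False
      have "\<bar>max 0 (1 - real (Suc i) * infdist x K)\<bar> \<le> 1"
        using infdist_nonneg[of x K] by (simp add: max_def)
      from mult_right_mono[OF this abs_ge_zero[of c]] show ?thesis using False
        by (simp add: s_def indicator_def abs_mult)
    qed
    show "integrable lborel (\<lambda>x. indicator K x * c)"
      using fin K by (intro integrable_mult_left integrable_real_indicator) (auto intro: borel_compact)
    show "integrable lborel (\<lambda>x::'c. indicator (cball 0 (r+1)) x * \<bar>c\<bar>)"
      using emeasure_compact_finite[of "cball (0::'c) (r+1)"]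
      by (intro integrable_mult_left) (auto intro: borel_compact)
  qed (rule int)
qed (auto simp: L1_approx_def intro!: exI[of _ "\<lambda>_. 0"])

lemma integrable_L1_approx:
  fixes f :: "'c::euclidean_space \<Rightarrow> real"
  assumes "integrable lborel f" shows "L1_approx f"
  using assms
proof (induction rule: integrable_induct)
  case (base A c)
  have bdd: "L1_approx (\<lambda>x. indicator B x * c)" if B: "B \<in> sets borel" "bounded B" for B :: "'c set"
    unfolding L1_approx_def
  proof (intro allI impI)
    fix \<eta> :: real assume \<eta>: "\<eta> > 0"
    \<comment> \<open>Gives \<open>\<theta> * \<bar>c\<bar> \<le> \<eta> / 2\<close>; the added 1
      covers \<open>c = 0\<close>.\<close>
    define \<theta> where "\<theta> = \<eta> / (2 * (\<bar>c\<bar> + 1))"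
    have \<theta>: "\<theta> > 0" using \<eta> by (simp add: \<theta>_def)
    have "B \<in> sets lebesgue" using B(1) by simp
    then obtain T where T: "closed T" "T \<subseteq> B" "B - T \<in> lmeasurable" "emeasure lebesgue (B - T) < ennreal \<theta>"
      using sets_lebesgue_inner_closed \<theta> by blast
    have K: "compact T" using T B(2) by (meson bounded_subset compact_eq_bounded_closed)
    have mT: "T \<in> sets borel" using T(1) by simp
    have "measure lborel (B - T) \<le> \<theta>"
      using T(4) B(1) mT \<theta> by (simp add: measure_def enn2real_leI)
    obtain g r where g: "continuous_on UNIV g" "\<forall>x. norm x > r \<longrightarrow> g x = 0"
      "(LINT x|lborel. \<bar>indicator T x * c - g x\<bar>) < \<eta> / 2"
      using L1_approx_compact[OF K, of c] \<eta> unfolding L1_approx_def by (meson half_gt_zero)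
    have gi: "integrable lborel g" using g by (intro integrable_compact_support) auto
    have Ti: "integrable lborel (\<lambda>x. indicator T x * c)"
      using K mT emeasure_compact_finite[OF K] by (intro integrable_mult_left) auto
    have Bi: "integrable lborel (\<lambda>x. indicator B x * c)"
      using B emeasure_bounded_finite[OF B(2)] by (intro integrable_mult_left) auto
    have BTi: "integrable lborel (\<lambda>x. indicator (B - T) x * \<bar>c\<bar>)"
      using B mT emeasure_bounded_finite[of "B - T"] bounded_subset[OF B(2), of "B - T"]
      by (intro integrable_mult_left) auto
    have "(LINT x|lborel. \<bar>indicator B x * c - g x\<bar>)
        \<le> (LINT x|lborel. indicator (B - T) x * \<bar>c\<bar> + \<bar>indicator T x * c - g x\<bar>)"
      using Bi Ti BTi gi T(2) by (intro integral_mono) (auto split: split_indicator)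
    also have "\<dots> = (LINT x|lborel. indicator (B - T) x * \<bar>c\<bar>) + (LINT x|lborel. \<bar>indicator T x * c - g x\<bar>)"
      using Ti BTi gi by (intro Bochner_Integration.integral_add) auto
    also have "(LINT x|lborel. indicator (B - T) x * \<bar>c\<bar>) = measure lborel (B - T) * \<bar>c\<bar>"
      by simp
    also have "\<dots> \<le> \<theta> * \<bar>c\<bar>" using \<open>measure lborel (B - T) \<le> \<theta>\<close> by (intro mult_right_mono) auto
    also have "\<dots> \<le> \<eta> / 2" using \<eta> by (simp add: \<theta>_def field_simps)
    finally show "\<exists>g r. continuous_on UNIV g \<and> (\<forall>x. norm x > r \<longrightarrow> g x = 0) \<and>
       (LINT x|lborel. \<bar>indicator B x * c - g x\<bar>) < \<eta>" using g by (intro exI[of _ g] exI[of _ r]) auto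
  qed
  have A: "A \<in> sets borel" using base by simp
  have Ai: "integrable lborel (\<lambda>x. indicator A x * c)"
    using base by (intro integrable_mult_left) auto
  \<comment> \<open>A set of finite measure need not be bounded, so it is exhausted by its
    intersections with balls.\<close>
  have "L1_approx (\<lambda>x. indicator A x * c)"
  proof (rule L1_approx_limit[where s="\<lambda>i x. indicator (A \<inter> cball 0 (real i)) x * c" and w="\<lambda>x. indicator A x * \<bar>c\<bar>"])
    show "L1_approx (\<lambda>x. indicator (A \<inter> cball 0 (real i)) x * c)" for i
      using A by (intro bdd) (auto intro: bounded_Int)
    show "integrable lborel (\<lambda>x. indicator (A \<inter> cball 0 (real i)) x * c)" for i
      using A emeasure_bounded_finite[of "A \<inter> cball 0 (real i)"] bounded_Int[of A "cball 0 (real i)"]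
      by (intro integrable_mult_left integrable_real_indicator) auto
    show "(\<lambda>i. indicator (A \<inter> cball 0 (real i)) x * c) \<longlonglongrightarrow> indicator A x * c" for x
    proof -
      have "\<forall>\<^sub>F i in sequentially. norm x \<le> real i"
        using real_arch_simple by (meson eventually_sequentiallyI le_trans of_nat_le_iff order_trans)
      hence "\<forall>\<^sub>F i in sequentially. indicator (A \<inter> cball 0 (real i)) x * c = indicator A x * c"
        by eventually_elim (auto simp: indicator_def)
      thus ?thesis by (rule tendsto_eventually)
    qed
    show "integrable lborel (\<lambda>x. indicator A x * \<bar>c\<bar>)"
      using base by (intro integrable_mult_left) auto
  qed (use Ai in \<open>auto split: split_indicator\<close>)
  thus ?case by simp
next
  case (add f g)
  thus ?case by (intro L1_approx_add) auto
next
  case (lim f s)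
  show ?case
    by (rule L1_approx_limit[where s=s and w="\<lambda>x. 2 * norm (f x)"]) (use lim in auto)
qed


section \<open>Translation invariance and convolution with compactly supported kernels\<close>

lemma lborel_nn_integral_shift:
  fixes f :: "'c::euclidean_space \<Rightarrow> ennreal"
  assumes [measurable]: "f \<in> borel_measurable borel"
  shows "(\<integral>\<^sup>+x. f (x - a) \<partial>lborel) = (\<integral>\<^sup>+x. f x \<partial>lborel)"
proof -
  have "(\<integral>\<^sup>+x. f x \<partial>lborel) = (\<integral>\<^sup>+x. f x \<partial>distr lborel borel ((+) (- a)))"
    by (simp add: lborel_distr_plus)
  also have "\<dots> = (\<integral>\<^sup>+x. f (x - a) \<partial>lborel)"
    by (subst nn_integral_distr) auto
  finally show ?thesis ..
qed

lemma lborel_integral_shift: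
  fixes f :: "'c::euclidean_space \<Rightarrow> real"
  assumes [measurable]: "f \<in> borel_measurable borel"
  shows "(LINT x|lborel. f (a + x)) = (LINT x|lborel. f x)"
proof -
  have "(LINT x|lborel. f x) = (LINT x|distr lborel borel ((+) a). f x)"
    by (simp add: lborel_distr_plus)
  also have "\<dots> = (LINT x|lborel. f (a + x))"
    by (subst integral_distr) auto
  finally show ?thesis ..
qed

lemma lborel_integral_reflect_shift:
  fixes f :: "'c::euclidean_space \<Rightarrow> real"
  assumes [measurable]: "f \<in> borel_measurable borel"
  shows "(LINT x|lborel. f (a - x)) = (LINT x|lborel. f x)"
proof -
  have "lborel = density (distr lborel borel (\<lambda>x. a + (-1::real) *\<^sub>R x)) (\<lambda>_. ennreal (\<bar>-1::real\<bar> ^ DIM('c)))"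
    by (rule lborel_affine) simp
  hence "(lborel :: 'c measure) = distr lborel borel (\<lambda>x. a - x)"
    by (simp add: density_1)
  hence "(LINT x|lborel. f x) = (LINT x|distr lborel borel (\<lambda>x. a - x). f x)" by simp
  also have "\<dots> = (LINT x|lborel. f (a - x))" by (subst integral_distr) auto
  finally show ?thesis ..
qed

definition conv :: "('c::euclidean_space \<Rightarrow> real) \<Rightarrow> ('c \<Rightarrow> real) \<Rightarrow> 'c \<Rightarrow> real" where
  "conv f \<psi> q = (LINT p|lborel. f p * \<psi> (q - p))"

text \<open>Neither sign nor mass is assumed, so that the derivatives of a mollifier are kernels as
  well.\<close>

locale kernel =
  fixes \<psi> :: "'c::euclidean_space \<Rightarrow> real" and r :: real
  assumes cont: "continuous_on UNIV \<psi>" and supp: "\<And>x. norm x > r \<Longrightarrow> \<psi> x = 0"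
begin

lemma borel[measurable]: "\<psi> \<in> borel_measurable borel"
  using cont by (rule borel_measurable_continuous_onI)

lemma bounded: obtains M where "\<And>x. \<bar>\<psi> x\<bar> \<le> M" "M \<ge> 0"
  using bounded_compact_support[OF cont supp] by blast

lemma conv_integrable:
  assumes f: "integrable lborel f"
  shows "integrable lborel (\<lambda>p. f p * \<psi> (q - p))"
proof -
  obtain M where M: "\<And>x. \<bar>\<psi> x\<bar> \<le> M" "M \<ge> 0" using bounded by blast
  have [measurable]: "f \<in> borel_measurable borel" using f by auto
  show ?thesis
  proof (rule Bochner_Integration.integrable_bound[of _ "\<lambda>p. f p * M"])
    show "AE p in lborel. norm (f p * \<psi> (q - p)) \<le> norm (f p * M)"
      using M by (auto simp: abs_mult intro!: mult_left_mono)
  qed (use f in auto)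
qed

lemma conv_continuous:
  assumes f: "integrable lborel f"
  shows "continuous_on UNIV (conv f \<psi>)"
  unfolding continuous_on_sequentially comp_def
proof (intro allI ballI impI, elim conjE)
  fix x :: "nat \<Rightarrow> 'c" and a assume x: "x \<longlonglongrightarrow> a"
  obtain M where M: "\<And>x. \<bar>\<psi> x\<bar> \<le> M" "M \<ge> 0" using bounded by blast
  have [measurable]: "f \<in> borel_measurable borel" using f by auto
  show "(\<lambda>n. conv f \<psi> (x n)) \<longlonglongrightarrow> conv f \<psi> a"
    unfolding conv_def
  proof (rule integral_dominated_convergence[where w="\<lambda>p. \<bar>f p\<bar> * M"])
    have "isCont \<psi> z" for z using cont by (simp add: continuous_on_eq_continuous_at)
    thus "AE p in lborel. (\<lambda>n. f p * \<psi> (x n - p)) \<longlonglongrightarrow> f p * \<psi> (a - p)"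
      by (intro AE_I2 tendsto_mult tendsto_const isCont_tendsto_compose[where g=\<psi>] tendsto_diff x)
    show "AE p in lborel. norm (f p * \<psi> (x n - p)) \<le> \<bar>f p\<bar> * M" for n
      using M by (auto simp: abs_mult intro!: mult_left_mono)
  qed (use f in auto)
qed

text \<open>Difference quotients of \<open>\<psi>\<close> are bounded by the supremum of
  \<open>\<psi>'\<close>, by the mean value theorem along the line. Dominated convergence then
  passes the limit under the integral for any integrable \<open>f\<close>.\<close>

lemma conv_DD:
  assumes f: "integrable lborel f" and k': "kernel \<psi>' r" and DD: "\<And>z. DD b \<psi> (\<psi>' z) z"
  shows "DD b (conv f \<psi>) (conv f \<psi>' q) q"
proof -
  interpret k': kernel \<psi>' r by fact
  obtain M where M: "\<And>x. \<bar>\<psi>' x\<bar> \<le> M" "M \<ge> 0" using k'.bounded by blast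
  have [measurable]: "f \<in> borel_measurable borel" using f by auto
  have quot: "\<bar>\<psi> (z + s *\<^sub>R b) - \<psi> z\<bar> \<le> M * \<bar>s\<bar>" for z s
    using field_differentiable_bound[of UNIV "\<lambda>s. \<psi> (z + s *\<^sub>R b)" "\<lambda>s. \<psi>' (z + s *\<^sub>R b)" M s 0]
      DD_line[OF DD] M by auto
  have "(\<lambda>n. (conv f \<psi> (q + h n *\<^sub>R b) - conv f \<psi> q) / h n) \<longlonglongrightarrow> conv f \<psi>' q"
    if h: "h \<longlonglongrightarrow> 0" "\<And>n. h n \<noteq> 0" for h :: "nat \<Rightarrow> real"
  proof -
    have "(conv f \<psi> (q + h n *\<^sub>R b) - conv f \<psi> q) / h n =
        (LINT p|lborel. f p * ((\<psi> (q - p + h n *\<^sub>R b) - \<psi> (q - p)) / h n))" for n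
    proof -
      have "conv f \<psi> (q + h n *\<^sub>R b) - conv f \<psi> q =
        (LINT p|lborel. f p * \<psi> (q + h n *\<^sub>R b - p) - f p * \<psi> (q - p))"
        unfolding conv_def using conv_integrable[OF f]
        by (intro Bochner_Integration.integral_diff[symmetric]) auto
      also have "\<dots> / h n = (LINT p|lborel. (f p * \<psi> (q + h n *\<^sub>R b - p) - f p * \<psi> (q - p)) / h n)"
        by simp
      finally show ?thesis by (simp add: algebra_simps)
    qed
    moreover have "(\<lambda>n. LINT p|lborel. f p * ((\<psi> (q - p + h n *\<^sub>R b) - \<psi> (q - p)) / h n)) \<longlonglongrightarrow> conv f \<psi>' q"
      unfolding conv_def
    proof (rule integral_dominated_convergence[where w="\<lambda>p. \<bar>f p\<bar> * M"])
      show "AE p in lborel. (\<lambda>n. f p * ((\<psi> (q - p + h n *\<^sub>R b) - \<psi> (q - p)) / h n)) \<longlonglongrightarrow> f p * \<psi>' (q - p)"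
      proof (intro AE_I2 tendsto_mult tendsto_const)
        fix p
        have "((\<lambda>s. (\<psi> (q - p + s *\<^sub>R b) - \<psi> (q - p)) / s) \<longlongrightarrow> \<psi>' (q - p)) (at 0)"
          using DD[of "q - p"] unfolding DD_def has_field_derivative_iff by simp
        thus "(\<lambda>n. (\<psi> (q - p + h n *\<^sub>R b) - \<psi> (q - p)) / h n) \<longlonglongrightarrow> \<psi>' (q - p)"
          using h unfolding tendsto_at_iff_sequentially comp_def by auto
      qed
      show "AE p in lborel. norm (f p * ((\<psi> (q - p + h n *\<^sub>R b) - \<psi> (q - p)) / h n)) \<le> \<bar>f p\<bar> * M" for n
      proof (rule AE_I2)
        fix p
        have "\<bar>(\<psi> (q - p + h n *\<^sub>R b) - \<psi> (q - p)) / h n\<bar> \<le> M"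
          using quot[of "q - p" "h n"] h(2)[of n] by (simp add: divide_simps)
        thus "norm (f p * ((\<psi> (q - p + h n *\<^sub>R b) - \<psi> (q - p)) / h n)) \<le> \<bar>f p\<bar> * M"
          using mult_left_mono[OF _ abs_ge_zero[of "f p"]] by (fastforce simp: abs_mult)
      qed
    qed (use f in auto)
    ultimately show ?thesis by (simp only:)
  qed
  thus ?thesis
    unfolding DD_def has_field_derivative_iff tendsto_at_iff_sequentially comp_def by auto
qed

end

locale mollifier = kernel +
  assumes nonneg: "\<psi> x \<ge> 0" and mass: "(LINT x|lborel. \<psi> x) = 1"
begin

lemma integrable: "integrable lborel \<psi>"
  using cont supp by (rule integrable_compact_support)

text \<open>Young's inequality for a kernel of mass 1. Tonelli is applied to nonnegative integrals,
  so no integrability on the product has to be shown beforehand.\<close>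

lemma conv_L1:
  assumes f: "integrable lborel f"
  shows "integrable lborel (conv f \<psi>)" "(LINT q|lborel. \<bar>conv f \<psi> q\<bar>) \<le> (LINT p|lborel. \<bar>f p\<bar>)"
proof -
  have [measurable]: "f \<in> borel_measurable borel" using f by auto
  have cm[measurable]: "conv f \<psi> \<in> borel_measurable borel"
    using conv_continuous[OF f] by (rule borel_measurable_continuous_onI)
  have nn: "(\<integral>\<^sup>+x. ennreal (\<psi> x) \<partial>lborel) = 1"
    using integrable nonneg mass by (simp add: nn_integral_eq_integral)
  have "(\<integral>\<^sup>+q. ennreal (norm (conv f \<psi> q)) \<partial>lborel)
      \<le> (\<integral>\<^sup>+q. (\<integral>\<^sup>+p. ennreal (norm (f p * \<psi> (q - p))) \<partial>lborel) \<partial>lborel)"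
    unfolding conv_def using conv_integrable[OF f]
    by (intro nn_integral_mono integral_norm_bound_ennreal) auto
  also have "\<dots> = (\<integral>\<^sup>+p. (\<integral>\<^sup>+q. ennreal (norm (f p * \<psi> (q - p))) \<partial>lborel) \<partial>lborel)"
    by (rule lborel_pair.Fubini') (simp add: lborel_prod[symmetric])
  also have "\<dots> = (\<integral>\<^sup>+p. ennreal \<bar>f p\<bar> * (\<integral>\<^sup>+q. ennreal (\<psi> (q - p)) \<partial>lborel) \<partial>lborel)"
    using nonneg by (intro nn_integral_cong)
      (simp add: abs_mult ennreal_mult nn_integral_cmult)
  also have "\<dots> = (\<integral>\<^sup>+p. ennreal \<bar>f p\<bar> \<partial>lborel)"
    using lborel_nn_integral_shift[of "\<lambda>x. ennreal (\<psi> x)"] by (simp add: nn)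
  also have "\<dots> = ennreal (LINT p|lborel. \<bar>f p\<bar>)"
    using f by (simp add: nn_integral_eq_integral)
  finally have le: "(\<integral>\<^sup>+q. ennreal (norm (conv f \<psi> q)) \<partial>lborel) \<le> ennreal (LINT p|lborel. \<bar>f p\<bar>)" .
  show i: "integrable lborel (conv f \<psi>)"
    unfolding integrable_iff_bounded using cm le by (auto intro: le_less_trans)
  have "(\<integral>\<^sup>+q. ennreal (norm (conv f \<psi> q)) \<partial>lborel) = ennreal (LINT q|lborel. \<bar>conv f \<psi> q\<bar>)"
    using i by (simp add: nn_integral_eq_integral)
  thus "(LINT q|lborel. \<bar>conv f \<psi> q\<bar>) \<le> (LINT p|lborel. \<bar>f p\<bar>)"
    using le by simp
qed

lemma conv_minus_self:
  assumes f: "integrable lborel f"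
    and close: "\<And>p. norm (q - p) \<le> r \<Longrightarrow> \<bar>f p - f q\<bar> \<le> \<omega>"
  shows "\<bar>conv f \<psi> q - f q\<bar> \<le> \<omega>"
proof -
  have [measurable]: "f \<in> borel_measurable borel" using f by auto
  have i: "integrable lborel (\<lambda>p. \<psi> (q - p))"
    using conv_integrable[of "\<lambda>_. 1"] integrable
  proof -
    have "kernel (\<lambda>p. \<psi> (q - p)) (r + norm q)"
    proof
      show "continuous_on UNIV (\<lambda>p. \<psi> (q - p))"
        by (intro continuous_on_compose2[OF cont] continuous_intros) auto
      show "\<psi> (q - x) = 0" if "norm x > r + norm q" for x
        using that norm_triangle_ineq2[of x q] by (intro supp) (simp add: norm_minus_commute)
    qed
    thus ?thesis using integrable_compact_support kernel.cont kernel.supp by blast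
  qed
  have one: "(LINT p|lborel. \<psi> (q - p)) = 1"
    using lborel_integral_reflect_shift[of \<psi> q] mass by simp
  have "conv f \<psi> q - f q = (LINT p|lborel. f p * \<psi> (q - p)) - (LINT p|lborel. f q * \<psi> (q - p))"
    using one by (simp add: conv_def)
  also have "\<dots> = (LINT p|lborel. f p * \<psi> (q - p) - f q * \<psi> (q - p))"
    using i conv_integrable[OF f] by (intro Bochner_Integration.integral_diff[symmetric]) auto
  finally have "\<bar>conv f \<psi> q - f q\<bar> \<le> (LINT p|lborel. \<bar>f p * \<psi> (q - p) - f q * \<psi> (q - p)\<bar>)"
    by simp
  also have "\<dots> \<le> (LINT p|lborel. \<omega> * \<psi> (q - p))"
  proof (intro integral_mono)
    show "\<bar>f p * \<psi> (q - p) - f q * \<psi> (q - p)\<bar> \<le> \<omega> * \<psi> (q - p)" for p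
    proof (cases "norm (q - p) \<le> r")
      case True
      thus ?thesis using close[OF True] nonneg[of "q - p"]
        by (simp add: left_diff_distrib[symmetric] abs_mult mult_right_mono)
    qed (simp add: supp)
  qed (use i conv_integrable[OF f] in auto)
  also have "\<dots> = \<omega>" using one by simp
  finally show ?thesis .
qed

end

text \<open>Replace \<open>f\<close> by a continuous compactly supported \<open>g\<close>.
  Convolution contracts the difference \<open>f - g\<close>, and for \<open>g\<close> the error is
  uniformly small on a bounded set; the total splits into three parts of size at most
  \<open>\<eta> / 4\<close>.\<close>

lemma mollification_tendsto_L1:
  fixes f :: "'c::euclidean_space \<Rightarrow> real"
  assumes moll: "\<And>n. mollifier (\<psi> n) (\<epsilon> n)" and \<epsilon>: "\<epsilon> \<longlonglongrightarrow> 0" and f: "integrable lborel f"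
  shows "(\<lambda>n. LINT q|lborel. \<bar>conv f (\<psi> n) q - f q\<bar>) \<longlonglongrightarrow> 0"
proof (rule LIMSEQ_I)
  fix \<eta> :: real assume \<eta>: "\<eta> > 0"
  obtain g r where g: "continuous_on UNIV g" "\<And>x. norm x > r \<Longrightarrow> g x = 0"
      "(LINT x|lborel. \<bar>f x - g x\<bar>) < \<eta> / 4"
    using integrable_L1_approx[OF f] \<eta> unfolding L1_approx_def
    by (metis zero_less_divide_iff zero_less_numeral)
  have gi: "integrable lborel g" using g by (intro integrable_compact_support)
  have unif: "uniformly_continuous_on (cball 0 (r + 2)) g"
    by (intro compact_uniformly_continuous continuous_on_subset[OF g(1)]) auto
  define V where "V = measure lborel (cball 0 (r + 1) :: 'c set)"
  have V: "V \<ge> 0" by (simp add: V_def)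
  define \<omega> where "\<omega> = \<eta> / (4 * (V + 1))"
  have \<omega>: "\<omega> > 0" using \<eta> V by (simp add: \<omega>_def)
  obtain d where d: "d > 0" "\<And>x y. x \<in> cball 0 (r+2) \<Longrightarrow> y \<in> cball 0 (r+2) \<Longrightarrow> dist y x < d \<Longrightarrow> dist (g y) (g x) < \<omega>"
    using unif \<omega> unfolding uniformly_continuous_on_def by metis
  have "\<forall>\<^sub>F n in sequentially. \<epsilon> n < min d 1"
    using \<epsilon> d by (intro order_tendstoD(2)) auto
  then obtain N where N: "\<And>n. n \<ge> N \<Longrightarrow> \<epsilon> n < min d 1" by (auto simp: eventually_sequentially)
  have "(LINT q|lborel. \<bar>conv f (\<psi> n) q - f q\<bar>) < \<eta>" if n: "n \<ge> N" for n
  proof -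
    interpret mollifier "\<psi> n" "\<epsilon> n" by (rule moll)
    have e: "\<epsilon> n < d" "\<epsilon> n < 1" using N[OF n] by auto
    \<comment> \<open>Since \<open>\<epsilon> n < 1\<close>, the error lives on the ball of radius
      \<open>r + 1\<close>, and points within \<open>\<epsilon> n\<close> of it stay in the ball of
      radius \<open>r + 2\<close>, where \<open>g\<close> is uniformly continuous.\<close>
    have le: "\<bar>conv g (\<psi> n) q - g q\<bar> \<le> indicator (cball 0 (r+1)) q * \<omega>" for q
    proof (cases "norm q \<le> r + 1")
      case True
      have "\<bar>conv g (\<psi> n) q - g q\<bar> \<le> \<omega>"
      proof (rule conv_minus_self[OF gi])
        fix p assume p: "norm (q - p) \<le> \<epsilon> n"
        have "norm p \<le> r + 2" using True p e norm_triangle_ineq2[of p q] by (simp add: norm_minus_commute)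
        thus "\<bar>g p - g q\<bar> \<le> \<omega>" using d(2)[of q p] True p e
          by (simp add: dist_norm norm_minus_commute)
      qed
      thus ?thesis using True by simp
    next
      case False
      have "\<bar>conv g (\<psi> n) q - g q\<bar> \<le> 0"
      proof (rule conv_minus_self[OF gi])
        fix p assume p: "norm (q - p) \<le> \<epsilon> n"
        have "norm p > r" using False p e norm_triangle_ineq2[of q p] by simp
        thus "\<bar>g p - g q\<bar> \<le> 0" using g(2)[of p] g(2)[of q] False by simp
      qed
      thus ?thesis using False by simp
    qed
    have fg: "integrable lborel (\<lambda>q. f q - g q)" using f gi by auto
    have cfg: "conv (\<lambda>q. f q - g q) (\<psi> n) q = conv f (\<psi> n) q - conv g (\<psi> n) q" for q
      unfolding conv_def using conv_integrable[OF f] conv_integrable[OF gi]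
      by (subst Bochner_Integration.integral_diff[symmetric]) (auto simp: algebra_simps)
    have iind: "integrable lborel (\<lambda>q::'c. indicator (cball 0 (r+1)) q * \<omega>)"
      using emeasure_bounded_finite[of "cball (0::'c) (r+1)"]
      by (intro integrable_mult_left integrable_real_indicator) auto
    have "(LINT q|lborel. \<bar>conv f (\<psi> n) q - f q\<bar>) \<le>
       (LINT q|lborel. \<bar>conv (\<lambda>q. f q - g q) (\<psi> n) q\<bar> + (indicator (cball 0 (r+1)) q * \<omega> + \<bar>f q - g q\<bar>))"
    proof (intro integral_mono)
      fix q
      show "\<bar>conv f (\<psi> n) q - f q\<bar> \<le> \<bar>conv (\<lambda>q. f q - g q) (\<psi> n) q\<bar> + (indicator (cball 0 (r+1)) q * \<omega> + \<bar>f q - g q\<bar>)"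
        using le[of q] cfg[of q] by linarith
    qed (use conv_L1[OF f] conv_L1[OF fg] f fg iind in auto)
    also have "\<dots> = (LINT q|lborel. \<bar>conv (\<lambda>q. f q - g q) (\<psi> n) q\<bar>) +
       ((LINT q|lborel. indicator (cball 0 (r+1)) (q::'c) * \<omega>) + (LINT q|lborel. \<bar>f q - g q\<bar>))"
    proof -
      have 1: "integrable lborel (\<lambda>q. \<bar>conv (\<lambda>q. f q - g q) (\<psi> n) q\<bar>)" using conv_L1[OF fg] by auto
      have 2: "integrable lborel (\<lambda>q. \<bar>f q - g q\<bar>)" using fg by auto
      show ?thesis by (simp only: Bochner_Integration.integral_add[OF 1 Bochner_Integration.integrable_add[OF iind 2]]
          Bochner_Integration.integral_add[OF iind 2])
    qed
    also have "(LINT q|lborel. \<bar>conv (\<lambda>q. f q - g q) (\<psi> n) q\<bar>) \<le> (LINT q|lborel. \<bar>f q - g q\<bar>)"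
      by (rule conv_L1(2)[OF fg])
    also have "(LINT q|lborel. indicator (cball 0 (r+1)) (q::'c) * \<omega>) = V * \<omega>"
      by (simp add: V_def)
    also have "V * \<omega> \<le> \<eta> / 4" using V \<eta> by (simp add: \<omega>_def field_simps)
    finally show ?thesis using g(3) \<eta> by simp
  qed
  thus "\<exists>no. \<forall>n\<ge>no. norm ((LINT q|lborel. \<bar>conv f (\<psi> n) q - f q\<bar>) - 0) < \<eta>"
    by (intro exI[of _ N]) auto
qed

section \<open>Kato's inequality\<close>

lemma Qstar_eq: "Qstar = {p. fst p \<noteq> 0 \<and> snd p > 0}"
  by (auto simp: Qstar_def)

lemma open_Qstar: "open (Qstar :: ('a::euclidean_space \<times> real) set)"
proof -
  have "open {p :: 'a \<times> real. fst p \<noteq> 0}"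
    by (intro open_Collect_neq continuous_intros)
  moreover have "open {p :: 'a \<times> real. snd p > 0}"
    by (intro open_Collect_less continuous_intros)
  ultimately show ?thesis unfolding Qstar_eq by (rule open_Collect_conj)
qed

lemma DD_unique: "DD b f d p \<Longrightarrow> DD b f d' p \<Longrightarrow> d = d'"
  unfolding DD_def by (rule DERIV_unique)

lemma DD_cong_open:
  assumes "DD b f d p" "open S" "p \<in> S" "\<And>q. q \<in> S \<Longrightarrow> f q = g q"
  shows "DD b g d p"
proof -
  have "open ((\<lambda>s. p + s *\<^sub>R b) -` S)"
    by (intro open_vimage assms continuous_intros)
  from has_field_derivative_transform_within_open[OF assms(1)[unfolded DD_def] this,
      of "\<lambda>s. g (p + s *\<^sub>R b)"] assms(3,4)
  show ?thesis by (simp add: DD_def)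
qed

lemma DD_const: "DD b (\<lambda>_. c) 0 p"
  by (simp add: DD_def)

lemma DD_mult: "DD b f f' p \<Longrightarrow> DD b g g' p \<Longrightarrow> DD b (\<lambda>p. f p * g p) (f' * g p + g' * f p) p"
  unfolding DD_def using DERIV_mult by fastforce

lemma DD_add: "DD b f f' p \<Longrightarrow> DD b g g' p \<Longrightarrow> DD b (\<lambda>p. f p + g p) (f' + g') p"
  unfolding DD_def by (rule DERIV_add)

lemma DD_diff: "DD b f f' p \<Longrightarrow> DD b g g' p \<Longrightarrow> DD b (\<lambda>p. f p - g p) (f' - g') p"
  unfolding DD_def by (rule DERIV_diff)

lemma DD_chain:
  assumes "(h has_real_derivative h') (at (f p))" "DD b f f' p"
  shows "DD b (\<lambda>p. h (f p)) (h' * f') p"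
  using assms unfolding DD_def by (intro DERIV_chain2[where g="\<lambda>s. f (p + s *\<^sub>R b)"]) auto

lemma DD_divide: "DD b f f' p \<Longrightarrow> DD b g g' p \<Longrightarrow> g p \<noteq> 0 \<Longrightarrow>
    DD b (\<lambda>p. f p / g p) ((f' * g p - f p * g') / (g p * g p)) p"
  unfolding DD_def using DERIV_divide by fastforce

lemma DD_zero_off:
  assumes "DD b f d p" "open S" "p \<in> S" "\<And>q. q \<in> S \<Longrightarrow> f q = 0"
  shows "d = 0"
  using DD_unique[OF DD_cong_open[OF assms(1-3), of "\<lambda>_. 0"] DD_const] assms(4) by auto

text \<open>By translation invariance every difference quotient of \<open>F\<close> has integral 0,
  and dominated convergence passes to the derivative. No slicing along \<open>b\<close> is needed;
  all integration by parts in space-time rests on this.\<close>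

lemma integral_DD_eq_0:
  fixes F F' :: "'c::euclidean_space \<Rightarrow> real"
  assumes F: "continuous_on UNIV F" "\<And>x. norm x > r \<Longrightarrow> F x = 0"
    and F': "continuous_on UNIV F'" "\<And>x. norm x > r \<Longrightarrow> F' x = 0"
    and DD: "\<And>x. DD b F (F' x) x"
  shows "(LINT x|lborel. F' x) = 0"
proof -
  interpret k': kernel F' r by standard (use F' in auto)
  interpret k: kernel F r by standard (use F in auto)
  obtain M where M: "\<And>x. \<bar>F' x\<bar> \<le> M" "M \<ge> 0" using k'.bounded by blast
  define R where "R = r + norm b"
  have quot: "\<bar>F (z + s *\<^sub>R b) - F z\<bar> \<le> M * \<bar>s\<bar>" for z s
    using field_differentiable_bound[of UNIV "\<lambda>s. F (z + s *\<^sub>R b)" "\<lambda>s. F' (z + s *\<^sub>R b)" M s 0]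
      DD_line[OF DD] M by auto
  \<comment> \<open>Steps of size at most 1 keep the shifted supports inside the ball of radius
    \<open>R\<close>.\<close>
  define h where "h n = 1 / real (Suc n)" for n
  have h: "h \<longlonglongrightarrow> 0" "h n > 0" "h n \<le> 1" for n
    unfolding h_def by (rule LIMSEQ_Suc[OF lim_1_over_n]) auto
  have Fi: "integrable lborel F" using F by (rule integrable_compact_support)
  have "(LINT x|lborel. (F (x + h n *\<^sub>R b) - F x) / h n) = 0" for n
  proof -
    have "integrable lborel (\<lambda>x. F (x + h n *\<^sub>R b))"
    proof (rule integrable_compact_support)
      show "continuous_on UNIV (\<lambda>x. F (x + h n *\<^sub>R b))"
        by (intro continuous_on_compose2[OF F(1)] continuous_intros) auto
      show "F (x + h n *\<^sub>R b) = 0" if "norm x > r + norm (h n *\<^sub>R b)" for x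
        using that norm_triangle_ineq2[of x "- h n *\<^sub>R b"] by (intro F(2)) simp
    qed
    thus ?thesis using Fi lborel_integral_shift[of F "h n *\<^sub>R b"] by (simp add: add.commute)
  qed
  moreover have "(\<lambda>n. LINT x|lborel. (F (x + h n *\<^sub>R b) - F x) / h n) \<longlonglongrightarrow> (LINT x|lborel. F' x)"
  proof (rule integral_dominated_convergence[where w="\<lambda>x. indicator (cball 0 R) x * M"])
    show "AE x in lborel. (\<lambda>n. (F (x + h n *\<^sub>R b) - F x) / h n) \<longlonglongrightarrow> F' x"
    proof (rule AE_I2)
      fix x
      have "((\<lambda>s. (F (x + s *\<^sub>R b) - F x) / s) \<longlongrightarrow> F' x) (at 0)"
        using DD[of x] unfolding DD_def has_field_derivative_iff by simp
      thus "(\<lambda>n. (F (x + h n *\<^sub>R b) - F x) / h n) \<longlonglongrightarrow> F' x"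
        using h(1) less_imp_neq[OF h(2)] unfolding tendsto_at_iff_sequentially comp_def by auto
    qed
    show "AE x in lborel. norm ((F (x + h n *\<^sub>R b) - F x) / h n) \<le> indicator (cball 0 R) x * M" for n
    proof (rule AE_I2)
      fix x
      show "norm ((F (x + h n *\<^sub>R b) - F x) / h n) \<le> indicator (cball 0 R) x * M"
      proof (cases "norm x \<le> R")
        case True
        thus ?thesis using quot[of x "h n"] h(2)[of n] by (simp add: divide_simps)
      next
        case False
        have "norm (h n *\<^sub>R b) \<le> norm b" using h(2,3)[of n] by (simp add: mult_left_le_one_le)
        moreover have "norm x \<le> norm (x + h n *\<^sub>R b) + norm (h n *\<^sub>R b)"
          using norm_triangle_ineq4[of "x + h n *\<^sub>R b" "h n *\<^sub>R b"] by (simp only: add_diff_cancel_right')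
        ultimately have "norm (x + h n *\<^sub>R b) > r" "norm x > r"
          using False norm_ge_zero[of b] unfolding R_def by linarith+
        thus ?thesis using F(2) False by simp
      qed
    qed
    show "integrable lborel (\<lambda>x::'c. indicator (cball 0 R) x * M)"
      using emeasure_bounded_finite[of "cball (0::'c) R"]
      by (intro integrable_mult_left integrable_real_indicator) auto
  qed (measurable)
  ultimately have "(\<lambda>n::nat. 0::real) \<longlonglongrightarrow> (LINT x|lborel. F' x)" by (simp only:)
  thus ?thesis by (simp only: LIMSEQ_const_iff)
qed

lemma compact_norm_bound:
  assumes "compact K" obtains r where "\<And>x. norm x > r \<Longrightarrow> x \<notin> K"
proof -
  obtain r where "\<And>x. x \<in> K \<Longrightarrow> norm x \<le> r"
    using compact_imp_bounded[OF assms] bounded_iff by metis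
  thus ?thesis using that by (metis not_le)
qed

text \<open>\<open>indicator K\<close> serves as extension by 0: nothing is known about
  \<open>F\<close> outside \<open>S\<close>, so every integrand below is truncated at the compact
  set carrying its support.\<close>

lemma continuous_on_extend_0:
  fixes F :: "'c::euclidean_space \<Rightarrow> real"
  assumes "open S" "compact K" "K \<subseteq> S" "continuous_on S F" "\<And>p. p \<in> S - K \<Longrightarrow> F p = 0"
  shows "continuous_on UNIV (\<lambda>p. indicator K p * F p)"
proof -
  have "continuous_on S (\<lambda>p. indicator K p * F p)"
    using assms(4) by (rule continuous_on_eq) (use assms(5) in \<open>auto simp: indicator_def\<close>)
  moreover have "continuous_on (- K) (\<lambda>p. indicator K p * F p)"
    by (rule continuous_on_eq[where f="\<lambda>_. 0"]) auto
  moreover have "S \<union> - K = UNIV" using assms(3) by auto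
  ultimately show ?thesis
    using continuous_on_open_Un[of S "- K"] assms(1,2) by (simp add: compact_imp_closed open_Compl)
qed

lemma integral_DD_eq_0_on:
  fixes F F' :: "'c::euclidean_space \<Rightarrow> real"
  assumes O: "open S" "compact K" "K \<subseteq> S"
    and F: "continuous_on S F" "continuous_on S F'" "\<And>p. p \<in> S \<Longrightarrow> DD b F (F' p) p"
      "\<And>p. p \<in> S - K \<Longrightarrow> F p = 0"
  shows "(LINT p|lborel. indicator K p * F' p) = 0"
proof -
  obtain r where r: "\<And>x. norm x > r \<Longrightarrow> x \<notin> K" using compact_norm_bound[OF O(2)] by blast
  have op: "open (S - K)" "open (- K)" using O by (auto simp: compact_imp_closed open_Diff)
  have F'0: "F' p = 0" if "p \<in> S - K" for p
    using DD_zero_off[OF F(3) op(1) that] F(4) that by auto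
  show ?thesis
  proof (rule integral_DD_eq_0[where F="\<lambda>p. indicator K p * F p" and r=r and b=b])
    show "DD b (\<lambda>p. indicator K p * F p) (indicator K x * F' x) x" for x
    proof (cases "x \<in> S")
      case True
      have "DD b (\<lambda>p. indicator K p * F p) (F' x) x"
        by (rule DD_cong_open[OF F(3)[OF True] O(1) True]) (use F(4) in \<open>auto simp: indicator_def\<close>)
      thus ?thesis using F'0[of x] True by (auto simp: indicator_def)
    next
      case False
      hence x: "x \<in> - K" using O by auto
      show ?thesis using x DD_cong_open[OF DD_const[of b 0 x] op(2) x, of "\<lambda>p. indicator K p * F p"]
        by (auto simp: indicator_def)
    qed
    show "continuous_on UNIV (\<lambda>p. indicator K p * F p)"
      by (rule continuous_on_extend_0[OF O F(1) F(4)])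
    show "continuous_on UNIV (\<lambda>p. indicator K p * F' p)"
      by (rule continuous_on_extend_0[OF O F(2) F'0])
  qed (use r in auto)
qed

lemma integrable_indicator_compact:
  fixes F :: "'c::euclidean_space \<Rightarrow> real"
  assumes "compact K" "continuous_on K F"
  shows "integrable lborel (\<lambda>p. indicator K p * F p)"
  using borel_integrable_compact[OF assms] by simp

text \<open>Only derivatives along the coordinate axes are required, two in space and one in time: no
  more is needed to integrate by parts, and the test functions below need not be smooth.\<close>

definition C21 :: "('a::euclidean_space \<times> real) set \<Rightarrow> ('a \<times> real \<Rightarrow> real) \<Rightarrow> ('a \<Rightarrow> 'a \<times> real \<Rightarrow> real)
    \<Rightarrow> ('a \<Rightarrow> 'a \<times> real \<Rightarrow> real) \<Rightarrow> ('a \<times> real \<Rightarrow> real) \<Rightarrow> bool" where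
  "C21 S f fx fxx ft \<longleftrightarrow>
     (\<forall>p\<in>S. (\<forall>b\<in>Basis. DD (b, 0) f (fx b p) p \<and> DD (b, 0) (fx b) (fxx b p) p) \<and> DD (0, 1) f (ft p) p) \<and>
     continuous_on S f \<and> (\<forall>b\<in>Basis. continuous_on S (fx b) \<and> continuous_on S (fxx b)) \<and>
     continuous_on S ft"

text \<open>With this sign of \<open>ft\<close> it is the adjoint, backward operator. The equation
  \<open>|x|\<^sup>-\<^sup>2 w\<^sub>t = \<Delta> w\<close> itself is expressed by passing
  \<open>- wt\<close> for the time derivative.\<close>

definition heat_op :: "('a::euclidean_space \<Rightarrow> 'a \<times> real \<Rightarrow> real) \<Rightarrow> ('a \<times> real \<Rightarrow> real) \<Rightarrow> 'a \<times> real \<Rightarrow> real" where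
  "heat_op fxx ft p = (\<Sum>b\<in>Basis. fxx b p) + ft p / (norm (fst p))\<^sup>2"

lemma C21_diff:
  assumes "C21 S f fx fxx ft" "C21 S g gx gxx gt"
  shows "C21 S (\<lambda>p. f p - g p) (\<lambda>b p. fx b p - gx b p) (\<lambda>b p. fxx b p - gxx b p) (\<lambda>p. ft p - gt p)"
  using assms unfolding C21_def by (auto intro!: DD_diff continuous_intros)

lemma C21_subset: "C21 S f fx fxx ft \<Longrightarrow> T \<subseteq> S \<Longrightarrow> C21 T f fx fxx ft"
  unfolding C21_def by (meson continuous_on_subset subsetD)

text \<open>For \<open>f = sqrt (w\<^sup>2 + \<eta>\<^sup>2)\<close>, convexity contributes a
  nonnegative second-order term and the factor \<open>w / f\<close> has modulus at most 1. The
  defect of \<open>w\<close> is kept on the right because a mollified solution satisfies the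
  equation only approximately.\<close>

lemma kato_classical:
  fixes w \<phi> :: "'a::euclidean_space \<times> real \<Rightarrow> real"
  assumes O: "open S" "compact K" "K \<subseteq> S" "\<And>p. p \<in> S \<Longrightarrow> fst p \<noteq> 0"
    and w: "C21 S w wx wxx wt" and \<phi>: "C21 S \<phi> \<phi>x \<phi>xx \<phi>t"
    and \<phi>0: "\<And>p. p \<in> S - K \<Longrightarrow> \<phi> p = 0" "\<And>p. p \<in> K \<Longrightarrow> \<phi> p \<ge> 0" and \<eta>: "\<eta> > 0"
  shows "(LINT p|lborel. indicator K p * (sqrt ((w p)\<^sup>2 + \<eta>\<^sup>2) * heat_op \<phi>xx \<phi>t p)) \<ge>
    - (LINT p|lborel. indicator K p * (\<phi> p * \<bar>heat_op wxx (\<lambda>p. - wt p) p\<bar>))"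
proof -
  define f where "f = (\<lambda>p. sqrt ((w p)\<^sup>2 + \<eta>\<^sup>2))"
  have fpos: "f p > 0" for p using \<eta> by (simp add: f_def add_nonneg_pos)
  have fsq: "(f p)\<^sup>2 = (w p)\<^sup>2 + \<eta>\<^sup>2" for p by (simp add: f_def)
  define fx where "fx = (\<lambda>b p. w p * wx b p / f p)"
  \<comment> \<open>The second derivative after
    \<open>f\<^sup>2 - w\<^sup>2 = \<eta>\<^sup>2\<close> has been used; the second summand is the
    gain from convexity.\<close>
  define fxx where "fxx = (\<lambda>b p. w p * wxx b p / f p + \<eta>\<^sup>2 * (wx b p)\<^sup>2 / (f p) ^ 3)"
  define ft where "ft = (\<lambda>p. w p * wt p / f p)"
  note wc = w[unfolded C21_def] and \<phi>c = \<phi>[unfolded C21_def]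
  have fDD: "DD b f (w p * d / f p) p" if "DD b w d p" for b d p
  proof -
    have "((\<lambda>r. sqrt (r\<^sup>2 + \<eta>\<^sup>2)) has_real_derivative (w p / f p)) (at (w p))"
      using fpos[of p] by (auto intro!: derivative_eq_intros simp: f_def divide_simps)
    from DD_chain[OF this that] show ?thesis by (simp add: f_def)
  qed
  have f_cont: "continuous_on S f" unfolding f_def by (intro continuous_intros) (use wc in auto)
  have fne: "f p \<noteq> 0" for p using fpos[of p] by simp
  have f: "C21 S f fx fxx ft"
    unfolding C21_def
  proof (intro conjI ballI)
    fix p b assume p: "p \<in> S" and b: "b \<in> (Basis :: 'a set)"
    show "DD (b, 0) f (fx b p) p" unfolding fx_def using fDD wc p b by blast
    have 1: "DD (b, 0) (\<lambda>p. w p * wx b p) (wx b p * wx b p + wxx b p * w p) p"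
      using wc p b by (intro DD_mult) auto
    have 2: "DD (b, 0) f (w p * wx b p / f p) p" using fDD wc p b by blast
    have "DD (b, 0) (fx b) (((wx b p * wx b p + wxx b p * w p) * f p - (w p * wx b p) * (w p * wx b p / f p)) / (f p * f p)) p"
      unfolding fx_def by (rule DD_divide[OF 1 2 fne])
    also have "((wx b p * wx b p + wxx b p * w p) * f p - (w p * wx b p) * (w p * wx b p / f p)) / (f p * f p)
       = w p * wxx b p / f p + (wx b p)\<^sup>2 * ((f p)\<^sup>2 - (w p)\<^sup>2) / (f p) ^ 3"
    proof -
      have "((a * a + c * d) * F - d * a * (d * a / F)) / (F * F) = d * c / F + a\<^sup>2 * (F\<^sup>2 - d\<^sup>2) / F ^ 3"
        if "F \<noteq> 0" for a c d F :: real
        using that by (simp add: divide_simps power2_eq_square power3_eq_cube algebra_simps)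
      from this[OF fne] show ?thesis .
    qed
    also have "\<dots> = fxx b p" unfolding fsq by (simp add: fxx_def mult.commute)
    finally show "DD (b, 0) (fx b) (fxx b p) p" .
  next
    fix p assume "p \<in> S"
    thus "DD (0, 1) f (ft p) p" unfolding ft_def using fDD wc by blast
  qed (use wc f_cont fne in \<open>auto simp: fx_def fxx_def ft_def intro!: continuous_intros\<close>)
  note fc = f[unfolded C21_def]
  have op: "open (S - K)" using O by (auto simp: compact_imp_closed open_Diff)
  have \<phi>x0: "\<phi>x b p = 0" if "p \<in> S - K" "b \<in> Basis" for b p
    using DD_zero_off[OF _ op that(1), of "(b, 0)" \<phi>] \<phi>0(1) \<phi>c that by blast
  \<comment> \<open>Green's identity: in the derivative of the flux chosen below the products of
    first derivatives cancel.\<close>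
  have ibp_x: "(LINT p|lborel. indicator K p * (f p * \<phi>xx b p - fxx b p * \<phi> p)) = 0" if b: "b \<in> Basis" for b
  proof (rule integral_DD_eq_0_on[OF O(1-3), where F="\<lambda>p. \<phi>x b p * f p - fx b p * \<phi> p" and b="(b, 0)"])
    fix p assume p: "p \<in> S"
    have "DD (b, 0) (\<lambda>p. \<phi>x b p * f p - fx b p * \<phi> p)
       ((\<phi>xx b p * f p + fx b p * \<phi>x b p) - (fxx b p * \<phi> p + \<phi>x b p * fx b p)) p"
      using fc \<phi>c p b by (intro DD_diff DD_mult) auto
    thus "DD (b, 0) (\<lambda>p. \<phi>x b p * f p - fx b p * \<phi> p) (f p * \<phi>xx b p - fxx b p * \<phi> p) p"
      by (simp add: algebra_simps)
  qed (use fc \<phi>c b \<phi>0 \<phi>x0 in \<open>auto intro!: continuous_intros\<close>)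
  \<comment> \<open>The weight is constant along lines in time direction, hence commutes with the
    time derivative.\<close>
  have n_line: "fst (p + s *\<^sub>R (0, 1)) = fst p" for p :: "'a \<times> real" and s by simp
  have ibp_t: "(LINT p|lborel. indicator K p * ((ft p * \<phi> p + \<phi>t p * f p) / (norm (fst p))\<^sup>2)) = 0"
  proof (rule integral_DD_eq_0_on[OF O(1-3), where F="\<lambda>p. f p * \<phi> p / (norm (fst p))\<^sup>2" and b="(0, 1)"])
    fix p assume p: "p \<in> S"
    have "DD (0, 1) (\<lambda>p. f p * \<phi> p) (ft p * \<phi> p + \<phi>t p * f p) p"
      using fc \<phi>c p by (intro DD_mult) auto
    thus "DD (0, 1) (\<lambda>p. f p * \<phi> p / (norm (fst p))\<^sup>2) ((ft p * \<phi> p + \<phi>t p * f p) / (norm (fst p))\<^sup>2) p"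
      unfolding DD_def n_line by (rule DERIV_cdivide)
  qed (use fc \<phi>c \<phi>0 O(4) in \<open>auto intro!: continuous_intros\<close>)
  have cK: "continuous_on K g" if "continuous_on S g" for g :: "'a \<times> real \<Rightarrow> real"
    using that O(3) by (rule continuous_on_subset)
  have I1: "integrable lborel (\<lambda>p. indicator K p * (f p * \<phi>xx b p - fxx b p * \<phi> p))" if "b \<in> Basis" for b
    using that fc \<phi>c by (intro integrable_indicator_compact[OF O(2)] cK) (auto intro!: continuous_intros)
  have I2: "integrable lborel (\<lambda>p. indicator K p * ((ft p * \<phi> p + \<phi>t p * f p) / (norm (fst p))\<^sup>2))"
    using fc \<phi>c O(4) by (intro integrable_indicator_compact[OF O(2)] cK) (auto intro!: continuous_intros)
  have hc: "continuous_on S (heat_op \<phi>xx \<phi>t)" "continuous_on S (heat_op wxx (\<lambda>p. - wt p))"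
      "continuous_on S (heat_op fxx (\<lambda>p. - ft p))"
    unfolding heat_op_def using fc \<phi>c wc O(4) by (auto intro!: continuous_intros)
  have "(LINT p|lborel. indicator K p * (f p * heat_op \<phi>xx \<phi>t p - heat_op fxx (\<lambda>p. - ft p) p * \<phi> p)) =
     (LINT p|lborel. (\<Sum>b\<in>Basis. indicator K p * (f p * \<phi>xx b p - fxx b p * \<phi> p)) +
        indicator K p * ((ft p * \<phi> p + \<phi>t p * f p) / (norm (fst p))\<^sup>2))"
  proof (intro Bochner_Integration.integral_cong refl)
    fix p :: "'a \<times> real"
    have 1: "i * (u * (A + t / n) - (B + (- s) / n) * v) = i * (u * A - B * v) + i * ((s * v + t * u) / n)"
      for i u A t n B s v :: real by (simp add: algebra_simps add_divide_distrib)
    have 2: "indicator K p * (f p * (\<Sum>b\<in>Basis. \<phi>xx b p) - (\<Sum>b\<in>Basis. fxx b p) * \<phi> p) =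
        (\<Sum>b\<in>Basis. indicator K p * (f p * \<phi>xx b p - fxx b p * \<phi> p))"
      by (simp only: sum_distrib_left sum_distrib_right sum_subtractf[symmetric])
    show "indicator K p * (f p * heat_op \<phi>xx \<phi>t p - heat_op fxx (\<lambda>p. - ft p) p * \<phi> p) =
      (\<Sum>b\<in>Basis. indicator K p * (f p * \<phi>xx b p - fxx b p * \<phi> p)) +
        indicator K p * ((ft p * \<phi> p + \<phi>t p * f p) / (norm (fst p))\<^sup>2)"
      unfolding heat_op_def 1 2 ..
  qed
  also have "\<dots> = 0"
  proof -
    have S: "integrable lborel (\<lambda>p. \<Sum>b\<in>Basis. indicator K p * (f p * \<phi>xx b p - fxx b p * \<phi> p))"
      by (intro Bochner_Integration.integrable_sum I1)
    have "(LINT p|lborel. (\<Sum>b\<in>Basis. indicator K p * (f p * \<phi>xx b p - fxx b p * \<phi> p))) = 0"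
      by (subst Bochner_Integration.integral_sum[OF I1]) (simp_all only: ibp_x sum.neutral_const cong: sum.cong)
    thus ?thesis by (simp only: Bochner_Integration.integral_add[OF S I2] ibp_t)
  qed
  finally have eq: "(LINT p|lborel. indicator K p * (f p * heat_op \<phi>xx \<phi>t p - heat_op fxx (\<lambda>p. - ft p) p * \<phi> p)) = 0" .
  have J1: "integrable lborel (\<lambda>p. indicator K p * (f p * heat_op \<phi>xx \<phi>t p))"
    and J2: "integrable lborel (\<lambda>p. indicator K p * (f p * heat_op \<phi>xx \<phi>t p - heat_op fxx (\<lambda>p. - ft p) p * \<phi> p))"
    and J3: "integrable lborel (\<lambda>p. indicator K p * (\<phi> p * \<bar>heat_op wxx (\<lambda>p. - wt p) p\<bar>))"
    using fc \<phi>c hc by (auto intro!: integrable_indicator_compact[OF O(2)] cK continuous_intros)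
  have "(LINT p|lborel. indicator K p * (f p * heat_op \<phi>xx \<phi>t p - heat_op fxx (\<lambda>p. - ft p) p * \<phi> p)
       - indicator K p * (\<phi> p * \<bar>heat_op wxx (\<lambda>p. - wt p) p\<bar>)) \<le> (LINT p|lborel. indicator K p * (f p * heat_op \<phi>xx \<phi>t p))"
  proof (intro integral_mono)
    fix p :: "'a \<times> real"
    show "indicator K p * (f p * heat_op \<phi>xx \<phi>t p - heat_op fxx (\<lambda>p. - ft p) p * \<phi> p)
       - indicator K p * (\<phi> p * \<bar>heat_op wxx (\<lambda>p. - wt p) p\<bar>) \<le> indicator K p * (f p * heat_op \<phi>xx \<phi>t p)"
    proof (cases "p \<in> K")
      case True
      have "(\<Sum>b\<in>Basis. fxx b p) \<ge> (\<Sum>b\<in>Basis. w p / f p * wxx b p)"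
        using fpos[of p] by (intro sum_mono) (simp add: fxx_def)
      moreover have "heat_op fxx (\<lambda>p. - ft p) p - w p / f p * heat_op wxx (\<lambda>p. - wt p) p =
          (\<Sum>b\<in>Basis. fxx b p) - (\<Sum>b\<in>Basis. w p / f p * wxx b p)"
        unfolding sum_distrib_left[symmetric] heat_op_def ft_def
        by (simp add: right_diff_distrib)
      ultimately have "heat_op fxx (\<lambda>p. - ft p) p \<ge> w p / f p * heat_op wxx (\<lambda>p. - wt p) p"
        by linarith
      moreover have "\<bar>w p / f p * heat_op wxx (\<lambda>p. - wt p) p\<bar> \<le> 1 * \<bar>heat_op wxx (\<lambda>p. - wt p) p\<bar>"
      proof -
        have "\<bar>w p\<bar> \<le> f p" unfolding f_def by (rule real_sqrt_ge_abs1)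
        hence "\<bar>w p / f p\<bar> \<le> 1" using fpos[of p] by simp
        thus ?thesis unfolding abs_mult by (rule mult_right_mono) simp
      qed
      ultimately have "heat_op fxx (\<lambda>p. - ft p) p \<ge> - \<bar>heat_op wxx (\<lambda>p. - wt p) p\<bar>" by linarith
      from mult_right_mono[OF this \<phi>0(2)[OF True]] True show ?thesis by (simp add: mult.commute)
    qed simp
  qed (use J1 J2 J3 in auto)
  thus ?thesis using eq J2 J3 unfolding f_def by simp
qed

section \<open>Mollification of distributional solutions and the limit in Kato's inequality\<close>

definition std_mollifier :: "real \<Rightarrow> 'c::euclidean_space \<Rightarrow> real" where
  "std_mollifier \<epsilon> z = inverse (LINT z|(lborel :: 'c measure). bump_profile 0 ((norm (z - 0))\<^sup>2 / \<epsilon>\<^sup>2)) *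
      bump_profile 0 ((norm (z - 0))\<^sup>2 / \<epsilon>\<^sup>2)"

text \<open>The unsimplified \<open>z - 0\<close> in the definition makes the body an instance of
  the base case with centre 0; the normalising constant plays the part of the polynomial.\<close>

lemma bump_class_std_mollifier: "bump_class 0 \<epsilon> (std_mollifier \<epsilon>)"
  unfolding std_mollifier_def[abs_def] by (intro bump_class.base real_polynomial_function.intros)

lemma bump_class_std_mollifier_reflect: "bump_class q \<epsilon> (\<lambda>p. std_mollifier \<epsilon> (q - p))"
proof -
  have "bump_class q \<epsilon> (\<lambda>p. inverse (LINT z|(lborel :: 'a measure). bump_profile 0 ((norm (z - 0))\<^sup>2 / \<epsilon>\<^sup>2)) *
      bump_profile 0 ((norm (p - q))\<^sup>2 / \<epsilon>\<^sup>2))"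
    by (intro bump_class.base real_polynomial_function.intros)
  thus ?thesis by (simp add: std_mollifier_def norm_minus_commute)
qed

lemma bump_class_kernel:
  assumes "bump_class 0 \<epsilon> f" "\<epsilon> > 0" shows "kernel f \<epsilon>"
  using assms bump_class_support[OF assms(1), of _] by unfold_locales (auto simp: bump_class_continuous)

lemma mollifier_std:
  assumes \<epsilon>: "\<epsilon> > 0" shows "mollifier (std_mollifier \<epsilon> :: 'c::euclidean_space \<Rightarrow> real) \<epsilon>"
proof -
  interpret kernel "std_mollifier \<epsilon> :: 'c \<Rightarrow> real" \<epsilon>
    by (rule bump_class_kernel[OF bump_class_std_mollifier \<epsilon>])
  define f where "f = (\<lambda>z::'c. bump_profile 0 ((norm (z - 0))\<^sup>2 / \<epsilon>\<^sup>2))"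
  have "bump_class 0 \<epsilon> (\<lambda>z. 1 * f z)"
    unfolding f_def by (intro bump_class.base real_polynomial_function.intros)
  hence bf: "bump_class 0 \<epsilon> f" by simp
  interpret f: kernel f \<epsilon> by (rule bump_class_kernel[OF bf \<epsilon>])
  have fi: "integrable lborel f" using f.cont f.supp by (rule integrable_compact_support)
  have f0: "f z \<ge> 0" for z by (simp add: f_def bump_profile_nonneg)
  have fpos: "f z > 0" if "z \<in> ball 0 \<epsilon>" for z
  proof -
    have "(norm z)\<^sup>2 < \<epsilon>\<^sup>2" using that by (intro power_strict_mono) auto
    thus ?thesis using \<epsilon> by (simp add: f_def bump_profile_def)
  qed
  \<comment> \<open>The bump is positive on an open ball, which is not negligible, so it can be
    normalised.\<close>
  have "(LINT z|lborel. f z) \<noteq> 0"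
  proof
    assume "(LINT z|lborel. f z) = 0"
    hence "AE z in lborel. f z = 0" using integral_nonneg_eq_0_iff_AE[OF fi] f0 by auto
    hence "AE z in lborel. z \<notin> ball (0::'c) \<epsilon>" by eventually_elim (use fpos in force)
    hence "emeasure lborel (ball (0::'c) \<epsilon>) = 0"
      by (subst (asm) AE_iff_measurable[of "ball 0 \<epsilon>"]) auto
    hence "emeasure lebesgue (ball (0::'c) \<epsilon>) = 0" by simp
    thus False using open_not_negligible[of "ball (0::'c) \<epsilon>"] \<epsilon>
      by (simp add: negligible_iff_null_sets null_setsI)
  qed
  hence pos: "(LINT z|lborel. f z) > 0" using f0 by (simp add: order_less_le)
  have eq: "std_mollifier \<epsilon> z = inverse (LINT z|lborel. f z) * f z" for z :: 'c
    by (simp only: std_mollifier_def f_def)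
  show ?thesis
    by unfold_locales (use pos f0 in \<open>auto simp: eq\<close>)
qed

lemma kernel_dir_deriv_std:
  assumes "\<epsilon> > 0"
  shows "kernel (dir_deriv b (std_mollifier \<epsilon>)) \<epsilon>"
    "kernel (dir_deriv b (dir_deriv b (std_mollifier \<epsilon>))) \<epsilon>"
  using assms by (auto intro!: bump_class_kernel bump_class_dir_deriv bump_class_std_mollifier)

lemma conv_std_C21:
  fixes U :: "'a::euclidean_space \<times> real \<Rightarrow> real"
  assumes \<epsilon>: "\<epsilon> > 0" and U: "integrable lborel U"
  shows "C21 S (conv U (std_mollifier \<epsilon>)) (\<lambda>b. conv U (dir_deriv (b, 0) (std_mollifier \<epsilon>)))
     (\<lambda>b. conv U (dir_deriv (b, 0) (dir_deriv (b, 0) (std_mollifier \<epsilon>))))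
     (conv U (dir_deriv (0, 1) (std_mollifier \<epsilon>)))"
proof -
  note k = bump_class_kernel[OF bump_class_std_mollifier \<epsilon>] kernel_dir_deriv_std[OF \<epsilon>]
  have c: "continuous_on S (conv U f)" if "kernel f \<epsilon>" for f
    using kernel.conv_continuous[OF that U] by (rule continuous_on_subset) auto
  have d: "DD b (conv U f) (conv U (dir_deriv b f) p) p" if "bump_class 0 \<epsilon> f" for f b p
    by (rule kernel.conv_DD[OF bump_class_kernel[OF that \<epsilon>] U
          bump_class_kernel[OF bump_class_dir_deriv[OF that] \<epsilon>] bump_class_DD[OF that]])
  show ?thesis
    unfolding C21_def
    by (intro conjI ballI c k d bump_class_std_mollifier bump_class_dir_deriv)
qed

text \<open>The reflected mollifier at \<open>q\<close> is an admissible test function because its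
  support lies in \<open>cball q \<epsilon>\<close>. One reflection sign cancels the sign in the
  distributional time derivative; for second derivatives the two signs cancel each other.\<close>

lemma conv_std_distr:
  fixes U V G :: "'a::euclidean_space \<times> real \<Rightarrow> real"
  assumes \<epsilon>: "\<epsilon> > 0" "cball q \<epsilon> \<subseteq> S" and U: "integrable lborel U"
    and D1: "\<And>\<phi>. \<phi> \<in> test_functions S \<Longrightarrow> (LINT p|lborel. U p * time_deriv \<phi> p) = - (LINT p|lborel. V p * \<phi> p)"
    and D2: "\<And>\<phi>. \<phi> \<in> test_functions S \<Longrightarrow> (LINT p|lborel. U p * space_laplacian \<phi> p) = (LINT p|lborel. G p * \<phi> p)"
  shows "conv U (dir_deriv (0, 1) (std_mollifier \<epsilon>)) q = conv V (std_mollifier \<epsilon>) q"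
    "(\<Sum>b\<in>Basis. conv U (dir_deriv (b, 0) (dir_deriv (b, 0) (std_mollifier \<epsilon>))) q) = conv G (std_mollifier \<epsilon>) q"
proof -
  define \<psi> where "\<psi> = (std_mollifier \<epsilon> :: 'a \<times> real \<Rightarrow> real)"
  have \<psi>: "bump_class 0 \<epsilon> \<psi>" unfolding \<psi>_def by (rule bump_class_std_mollifier)
  have t: "(\<lambda>p. \<psi> (q - p)) \<in> test_functions S"
    unfolding \<psi>_def by (rule bump_class_test_function[OF bump_class_std_mollifier_reflect \<epsilon>])
  have d1: "dir_deriv b (\<lambda>p. \<psi> (q - p)) = (\<lambda>p. - dir_deriv b \<psi> (q - p))" for b
    using bump_class_differentiable[OF \<psi>] by (intro ext dir_deriv_reflect) 
  have d2: "dir_deriv b (dir_deriv b (\<lambda>p. \<psi> (q - p))) p = dir_deriv b (dir_deriv b \<psi>) (q - p)" for b p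
  proof -
    have "dir_deriv b (dir_deriv b (\<lambda>p. \<psi> (q - p))) p = dir_deriv b (\<lambda>p. (\<lambda>z. - dir_deriv b \<psi> z) (q - p)) p"
      by (simp add: d1)
    also have "\<dots> = - dir_deriv b (\<lambda>z. - dir_deriv b \<psi> z) (q - p)"
      using bump_class_differentiable[OF bump_class_dir_deriv[OF \<psi>]]
      by (intro dir_deriv_reflect) (auto intro: differentiable_minus)
    also have "dir_deriv b (\<lambda>z. - dir_deriv b \<psi> z) (q - p) = - dir_deriv b (dir_deriv b \<psi>) (q - p)"
    proof -
      obtain f' where f': "(dir_deriv b \<psi> has_derivative f') (at (q - p))"
        using bump_class_differentiable[OF bump_class_dir_deriv[OF \<psi>]] unfolding differentiable_def by blast
      show ?thesis using dir_deriv_eq[OF has_derivative_minus[OF f']] dir_deriv_eq[OF f'] by simp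
    qed
    finally show ?thesis by simp
  qed
  show "conv U (dir_deriv (0, 1) (std_mollifier \<epsilon>)) q = conv V (std_mollifier \<epsilon>) q"
    using D1[OF t] unfolding conv_def time_deriv_def d1 \<psi>_def[symmetric] by simp
  have "(\<Sum>b\<in>Basis. conv U (dir_deriv (b, 0) (dir_deriv (b, 0) \<psi>)) q) =
    (LINT p|lborel. (\<Sum>b\<in>Basis. U p * dir_deriv (b, 0) (dir_deriv (b, 0) \<psi>) (q - p)))"
    unfolding conv_def
    by (rule Bochner_Integration.integral_sum[symmetric])
       (intro kernel.conv_integrable[OF _ U], auto intro: bump_class_kernel bump_class_dir_deriv \<psi> \<epsilon>(1))
  also have "\<dots> = (LINT p|lborel. U p * space_laplacian (\<lambda>p. \<psi> (q - p)) p)"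
    by (simp add: space_laplacian_def d2 sum_distrib_left)
  finally show "(\<Sum>b\<in>Basis. conv U (dir_deriv (b, 0) (dir_deriv (b, 0) (std_mollifier \<epsilon>))) q) = conv G (std_mollifier \<epsilon>) q"
    using D2[OF t] by (simp add: conv_def \<psi>_def)
qed

lemma abs_sqrt_sum_squares_diff: "\<bar>sqrt (a\<^sup>2 + \<eta>\<^sup>2) - \<bar>b\<bar>\<bar> \<le> \<eta> + \<bar>a - b\<bar>" if "\<eta> > 0" for a b \<eta> :: real
proof -
  have "sqrt (a\<^sup>2 + \<eta>\<^sup>2) \<le> \<bar>a\<bar> + \<eta>" using sqrt_sum_squares_le_sum_abs[of a \<eta>] that by simp
  moreover have "\<bar>a\<bar> \<le> sqrt (a\<^sup>2 + \<eta>\<^sup>2)" by (rule real_sqrt_ge_abs1)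
  ultimately show ?thesis using that by linarith
qed

text \<open>On \<open>K\<close>, where \<open>V / |x|\<^sup>2 = G\<close>, the defect of the
  mollified equation is the mollification error of \<open>G\<close> minus that of \<open>V\<close>
  divided by \<open>|x|\<^sup>2\<close>. Thus L^1 convergence alone handles the variable weight,
  without a commutator estimate. The classical solution \<open>e\<close> is subtracted
  unmollified.\<close>

lemma kato:
  fixes U V G e \<phi> :: "'a::euclidean_space \<times> real \<Rightarrow> real"
  assumes O: "open S" "compact K" "K \<subseteq> S" "\<And>p. p \<in> S \<Longrightarrow> fst p \<noteq> 0"
    and UVG: "integrable lborel U" "integrable lborel V" "integrable lborel G"
    and D1: "\<And>\<phi>. \<phi> \<in> test_functions S \<Longrightarrow> (LINT p|lborel. U p * time_deriv \<phi> p) = - (LINT p|lborel. V p * \<phi> p)"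
    and D2: "\<And>\<phi>. \<phi> \<in> test_functions S \<Longrightarrow> (LINT p|lborel. U p * space_laplacian \<phi> p) = (LINT p|lborel. G p * \<phi> p)"
    and eq: "AE p in lborel. p \<in> K \<longrightarrow> V p / (norm (fst p))\<^sup>2 = G p"
    and e: "C21 S e ex exx et" "\<And>p. p \<in> S \<Longrightarrow> heat_op exx (\<lambda>p. - et p) p = 0"
    and \<phi>: "C21 S \<phi> \<phi>x \<phi>xx \<phi>t" "\<And>p. p \<in> S - K \<Longrightarrow> \<phi> p = 0" "\<And>p. p \<in> K \<Longrightarrow> \<phi> p \<ge> 0"
  shows "(LINT p|lborel. indicator K p * (\<bar>U p - e p\<bar> * heat_op \<phi>xx \<phi>t p)) \<ge> 0"
proof -
  have meas[measurable]: "U \<in> borel_measurable borel" "V \<in> borel_measurable borel" "G \<in> borel_measurable borel"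
    using UVG by auto
  have [measurable]: "K \<in> sets borel" using O by (simp add: borel_compact)
  have cK: "continuous_on K g" if "continuous_on S g" for g :: "'a \<times> real \<Rightarrow> real"
    using that O(3) by (rule continuous_on_subset)
  have hc: "continuous_on K (heat_op \<phi>xx \<phi>t)"
    using \<phi>(1) O(4) unfolding heat_op_def C21_def by (intro cK continuous_intros) auto
  have bdd: "\<exists>M\<ge>0. \<forall>p\<in>K. \<bar>g p\<bar> \<le> M" if "continuous_on K g" for g :: "'a \<times> real \<Rightarrow> real"
  proof -
    have "compact (g ` K)" by (rule compact_continuous_image[OF that O(2)])
    then obtain M where "\<And>y. y \<in> g ` K \<Longrightarrow> \<bar>y\<bar> \<le> M"
      using compact_imp_bounded bounded_iff by (metis real_norm_def)
    hence "\<forall>p\<in>K. \<bar>g p\<bar> \<le> max M 0" by fastforce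
    thus ?thesis by (metis max.cobounded2)
  qed
  obtain M where M: "M \<ge> 0" "\<And>p. p \<in> K \<Longrightarrow> \<bar>heat_op \<phi>xx \<phi>t p\<bar> \<le> M" using bdd[OF hc] by blast
  have "continuous_on K \<phi>" using \<phi>(1) cK unfolding C21_def by blast
  then obtain C where C: "C \<ge> 0" "\<And>p. p \<in> K \<Longrightarrow> \<bar>\<phi> p\<bar> \<le> C" using bdd by blast
  have "continuous_on K (\<lambda>p. 1 / (norm (fst p))\<^sup>2)"
    using O(4) by (intro cK continuous_intros) auto
  then obtain D where D: "D \<ge> 0" "\<And>p. p \<in> K \<Longrightarrow> \<bar>1 / (norm (fst p))\<^sup>2\<bar> \<le> D" using bdd by blast
  define mK where "mK = measure lborel K"
  have finK: "emeasure lborel K < \<infinity>" by (rule emeasure_compact_finite[OF O(2)])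
  have e_cont: "continuous_on K e" using e(1) cK unfolding C21_def by blast
  have eK[measurable]: "(\<lambda>p. indicator K p * e p) \<in> borel_measurable borel"
    using integrable_indicator_compact[OF O(2) e_cont] by auto
  have hK[measurable]: "(\<lambda>p. indicator K p * heat_op \<phi>xx \<phi>t p) \<in> borel_measurable borel"
    using integrable_indicator_compact[OF O(2) hc] by auto
  obtain \<epsilon>0 where \<epsilon>0: "\<epsilon>0 > 0" "(\<Union>x\<in>K. cball x \<epsilon>0) \<subseteq> S"
    using compact_subset_open_imp_cball_epsilon_subset[OF O(2,1,3)] by blast
  \<comment> \<open>One sequence serves both as mollification radius and as smoothing parameter of
    the absolute value.\<close>
  define \<epsilon> where "\<epsilon> n = \<epsilon>0 / real (Suc n)" for n
  have \<epsilon>: "\<epsilon> n > 0" "\<epsilon> n \<le> \<epsilon>0" for n using \<epsilon>0 by (auto simp: \<epsilon>_def field_simps)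
  have \<epsilon>_lim: "\<epsilon> \<longlonglongrightarrow> 0"
  proof -
    have "(\<lambda>n. \<epsilon>0 * (1 / real (Suc n))) \<longlonglongrightarrow> \<epsilon>0 * 0"
      by (intro tendsto_mult tendsto_const LIMSEQ_Suc[OF lim_1_over_n])
    thus ?thesis by (simp add: \<epsilon>_def[abs_def])
  qed
  define \<psi> where "\<psi> n = (std_mollifier (\<epsilon> n) :: 'a \<times> real \<Rightarrow> real)" for n
  have moll: "mollifier (\<psi> n) (\<epsilon> n)" for n unfolding \<psi>_def by (rule mollifier_std[OF \<epsilon>(1)])
  define err where "err f n = (LINT q|lborel. \<bar>conv f (\<psi> n) q - f q\<bar>)" for f n
  have err0: "err f \<longlonglongrightarrow> 0" if "integrable lborel f" for f
    unfolding err_def by (rule mollification_tendsto_L1[OF moll \<epsilon>_lim that])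
  have conv_int: "integrable lborel (\<lambda>q. \<bar>conv f (\<psi> n) q - f q\<bar>)" if "integrable lborel f" for f n
    using mollifier.conv_L1(1)[OF moll that] that by auto
  define J where "J = (LINT p|lborel. indicator K p * (\<bar>U p - e p\<bar> * heat_op \<phi>xx \<phi>t p))"
  \<comment> \<open>The part with factor \<open>M\<close> is the cost of replacing the smoothed
    absolute value of the mollified difference by \<open>\<bar>U - e\<bar>\<close>; the part with
    factor \<open>C\<close> is the defect of the equation. Both vanish in the limit.\<close>
  have key: "J \<ge> - (M * (\<epsilon> n * mK + err U n) + C * (err G n + D * err V n))" for n
  proof -
    interpret m: mollifier "\<psi> n" "\<epsilon> n" by (rule moll)
    have sub: "cball q (\<epsilon> n) \<subseteq> S" if "q \<in> K" for q
      using \<epsilon>0(2) \<epsilon>(2)[of n] that subset_cball[of "\<epsilon> n" \<epsilon>0 q] by blast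
    note c21 = C21_diff[OF conv_std_C21[OF \<epsilon>(1)[of n] UVG(1), of S] e(1), folded \<psi>_def]
    define w where "w = (\<lambda>p. conv U (\<psi> n) p - e p)"
    define wxx where "wxx = (\<lambda>b p. conv U (dir_deriv (b, 0) (dir_deriv (b, 0) (\<psi> n))) p - exx b p)"
    define wt where "wt = (\<lambda>p. conv U (dir_deriv (0, 1) (\<psi> n)) p - et p)"
    have kc: "(LINT p|lborel. indicator K p * (sqrt ((w p)\<^sup>2 + (\<epsilon> n)\<^sup>2) * heat_op \<phi>xx \<phi>t p)) \<ge>
       - (LINT p|lborel. indicator K p * (\<phi> p * \<bar>heat_op wxx (\<lambda>p. - wt p) p\<bar>))"
      using kato_classical[OF O c21 \<phi>(1) \<phi>(2,3) \<epsilon>(1)[of n]] unfolding w_def wxx_def wt_def by blast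
    have wc: "continuous_on S w" "\<And>b. b \<in> Basis \<Longrightarrow> continuous_on S (wxx b)" "continuous_on S wt"
      using c21 unfolding C21_def w_def wxx_def wt_def by auto
    have hw: "heat_op wxx (\<lambda>p. - wt p) p = conv G (\<psi> n) p - conv V (\<psi> n) p / (norm (fst p))\<^sup>2" if p: "p \<in> K" for p
    proof -
      have "heat_op wxx (\<lambda>p. - wt p) p =
        (\<Sum>b\<in>Basis. conv U (dir_deriv (b, 0) (dir_deriv (b, 0) (\<psi> n))) p) -
         conv U (dir_deriv (0, 1) (\<psi> n)) p / (norm (fst p))\<^sup>2 - heat_op exx (\<lambda>p. - et p) p"
        by (simp add: heat_op_def wxx_def wt_def sum_subtractf diff_divide_distrib)
      thus ?thesis using e(2)[OF subsetD[OF O(3) p]] conv_std_distr[OF \<epsilon>(1) sub[OF p] UVG(1) D1 D2]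
        unfolding \<psi>_def by simp
    qed
    have hwc: "continuous_on K (\<lambda>p. \<phi> p * \<bar>heat_op wxx (\<lambda>p. - wt p) p\<bar>)"
      using wc \<phi>(1) O(4) unfolding heat_op_def C21_def by (intro cK continuous_intros) auto
    have i1: "integrable lborel (\<lambda>p. indicator K p * (sqrt ((w p)\<^sup>2 + (\<epsilon> n)\<^sup>2) * heat_op \<phi>xx \<phi>t p))"
      by (intro integrable_indicator_compact[OF O(2)] continuous_intros cK[OF wc(1)] hc)
    have i2: "integrable lborel (\<lambda>p. indicator K p * (\<phi> p * \<bar>heat_op wxx (\<lambda>p. - wt p) p\<bar>))"
      by (rule integrable_indicator_compact[OF O(2) hwc])
    have iK: "integrable lborel (\<lambda>p::'a\<times>real. indicator K p * \<epsilon> n)"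
      using finK by (intro integrable_mult_left integrable_real_indicator) auto
    have A: "(LINT p|lborel. indicator K p * (\<phi> p * \<bar>heat_op wxx (\<lambda>p. - wt p) p\<bar>)) \<le> C * (err G n + D * err V n)"
    proof -
      have "(LINT p|lborel. indicator K p * (\<phi> p * \<bar>heat_op wxx (\<lambda>p. - wt p) p\<bar>)) \<le>
        (LINT p|lborel. C * (\<bar>conv G (\<psi> n) p - G p\<bar> + D * \<bar>conv V (\<psi> n) p - V p\<bar>))"
      proof (intro integral_mono_AE i2)
        show "AE p in lborel. indicator K p * (\<phi> p * \<bar>heat_op wxx (\<lambda>p. - wt p) p\<bar>)
            \<le> C * (\<bar>conv G (\<psi> n) p - G p\<bar> + D * \<bar>conv V (\<psi> n) p - V p\<bar>)"
          using eq
        proof eventually_elim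
          case (elim p)
          show ?case
          proof (cases "p \<in> K")
            case True
            have "heat_op wxx (\<lambda>p. - wt p) p = (conv G (\<psi> n) p - G p) - 1 / (norm (fst p))\<^sup>2 * (conv V (\<psi> n) p - V p)"
              using elim True hw[OF True] by (simp add: right_diff_distrib)
            hence "\<bar>heat_op wxx (\<lambda>p. - wt p) p\<bar> \<le> \<bar>conv G (\<psi> n) p - G p\<bar> + \<bar>1 / (norm (fst p))\<^sup>2\<bar> * \<bar>conv V (\<psi> n) p - V p\<bar>"
              using abs_triangle_ineq4 by (metis abs_mult)
            also have "\<dots> \<le> \<bar>conv G (\<psi> n) p - G p\<bar> + D * \<bar>conv V (\<psi> n) p - V p\<bar>"
              by (intro add_left_mono mult_right_mono D(2) True) simp
            finally have "\<phi> p * \<bar>heat_op wxx (\<lambda>p. - wt p) p\<bar> \<le> C * (\<bar>conv G (\<psi> n) p - G p\<bar> + D * \<bar>conv V (\<psi> n) p - V p\<bar>)"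
              using C \<phi>(3)[OF True] C(2)[OF True] by (intro mult_mono) auto
            thus ?thesis using True by simp
          qed (use C D in simp)
        qed
      qed (use conv_int[OF UVG(3)] conv_int[OF UVG(2)] in auto)
      also have "\<dots> = C * (err G n + D * err V n)"
        unfolding err_def using conv_int[OF UVG(3)] conv_int[OF UVG(2)]
        by (subst Bochner_Integration.integral_mult_right_zero, subst Bochner_Integration.integral_add) auto
      finally show ?thesis .
    qed
    have Ji: "integrable lborel (\<lambda>p. indicator K p * (\<bar>U p - e p\<bar> * heat_op \<phi>xx \<phi>t p))"
    proof (rule Bochner_Integration.integrable_bound[where f="\<lambda>p. M * (\<bar>U p\<bar> + \<bar>indicator K p * e p\<bar>)"])
      show "integrable lborel (\<lambda>p. M * (\<bar>U p\<bar> + \<bar>indicator K p * e p\<bar>))"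
        using UVG(1) integrable_indicator_compact[OF O(2) e_cont] by auto
      have "(\<lambda>p. \<bar>U p - indicator K p * e p\<bar> * (indicator K p * heat_op \<phi>xx \<phi>t p)) \<in> borel_measurable lborel"
        by measurable
      also have "(\<lambda>p. \<bar>U p - indicator K p * e p\<bar> * (indicator K p * heat_op \<phi>xx \<phi>t p)) =
         (\<lambda>p. indicator K p * (\<bar>U p - e p\<bar> * heat_op \<phi>xx \<phi>t p))"
        by (auto simp: indicator_def)
      finally show "(\<lambda>p. indicator K p * (\<bar>U p - e p\<bar> * heat_op \<phi>xx \<phi>t p)) \<in> borel_measurable lborel" .
      show "AE p in lborel. norm (indicator K p * (\<bar>U p - e p\<bar> * heat_op \<phi>xx \<phi>t p)) \<le> norm (M * (\<bar>U p\<bar> + \<bar>indicator K p * e p\<bar>))"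
      proof (rule AE_I2)
        fix p
        show "norm (indicator K p * (\<bar>U p - e p\<bar> * heat_op \<phi>xx \<phi>t p)) \<le> norm (M * (\<bar>U p\<bar> + \<bar>indicator K p * e p\<bar>))"
        proof (cases "p \<in> K")
          case True
          have "\<bar>U p - e p\<bar> * \<bar>heat_op \<phi>xx \<phi>t p\<bar> \<le> (\<bar>U p\<bar> + \<bar>e p\<bar>) * M"
            using M(2)[OF True] by (intro mult_mono) auto
          thus ?thesis using True M(1) by (simp add: abs_mult mult.commute)
        qed simp
      qed
    qed
    have B: "(LINT p|lborel. indicator K p * (sqrt ((w p)\<^sup>2 + (\<epsilon> n)\<^sup>2) * heat_op \<phi>xx \<phi>t p)) \<le> J + M * (\<epsilon> n * mK + err U n)"
    proof -
      have "(LINT p|lborel. indicator K p * (sqrt ((w p)\<^sup>2 + (\<epsilon> n)\<^sup>2) * heat_op \<phi>xx \<phi>t p)) \<le>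
        (LINT p|lborel. indicator K p * (\<bar>U p - e p\<bar> * heat_op \<phi>xx \<phi>t p) + M * (indicator K p * \<epsilon> n + \<bar>conv U (\<psi> n) p - U p\<bar>))"
      proof (intro integral_mono i1)
        fix p :: "'a \<times> real"
        show "indicator K p * (sqrt ((w p)\<^sup>2 + (\<epsilon> n)\<^sup>2) * heat_op \<phi>xx \<phi>t p) \<le>
           indicator K p * (\<bar>U p - e p\<bar> * heat_op \<phi>xx \<phi>t p) + M * (indicator K p * \<epsilon> n + \<bar>conv U (\<psi> n) p - U p\<bar>)"
        proof (cases "p \<in> K")
          case True
          have "\<bar>sqrt ((w p)\<^sup>2 + (\<epsilon> n)\<^sup>2) - \<bar>U p - e p\<bar>\<bar> \<le> \<epsilon> n + \<bar>conv U (\<psi> n) p - U p\<bar>"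
            using abs_sqrt_sum_squares_diff[OF \<epsilon>(1), of "w p" n "U p - e p"] by (simp add: w_def)
          hence "\<bar>sqrt ((w p)\<^sup>2 + (\<epsilon> n)\<^sup>2) - \<bar>U p - e p\<bar>\<bar> * \<bar>heat_op \<phi>xx \<phi>t p\<bar> \<le> (\<epsilon> n + \<bar>conv U (\<psi> n) p - U p\<bar>) * M"
            using M(2)[OF True] \<epsilon>(1)[of n] by (intro mult_mono) auto
          hence "(sqrt ((w p)\<^sup>2 + (\<epsilon> n)\<^sup>2) - \<bar>U p - e p\<bar>) * heat_op \<phi>xx \<phi>t p \<le> (\<epsilon> n + \<bar>conv U (\<psi> n) p - U p\<bar>) * M"
            unfolding abs_mult[symmetric] by linarith
          thus ?thesis using True by (simp add: algebra_simps)
        qed (use M(1) in simp)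
      qed (use Ji iK conv_int[OF UVG(1)] in auto)
      also have "\<dots> = J + M * (\<epsilon> n * mK + err U n)"
      proof -
        have 1: "integrable lborel (\<lambda>p. indicator K p * \<epsilon> n + \<bar>conv U (\<psi> n) p - U p\<bar>)"
          using iK conv_int[OF UVG(1)] by auto
        have 2: "(LINT p|lborel. indicator K p * \<epsilon> n + \<bar>conv U (\<psi> n) p - U p\<bar>) = \<epsilon> n * mK + err U n"
          by (subst Bochner_Integration.integral_add[OF iK conv_int[OF UVG(1)]]) (simp add: err_def mK_def)
        show ?thesis
          by (subst Bochner_Integration.integral_add[OF Ji integrable_mult_right[OF 1]]) (simp only: Bochner_Integration.integral_mult_right_zero 2 J_def)
      qed
      finally show ?thesis .
    qed
    show ?thesis using kc A B by linarith
  qed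
  have "(\<lambda>n. - (M * (\<epsilon> n * mK + err U n) + C * (err G n + D * err V n))) \<longlonglongrightarrow>
     - (M * (0 * mK + 0) + C * (0 + D * 0))"
    by (intro tendsto_intros \<epsilon>_lim err0 UVG)
  hence "J \<ge> - (M * (0 * mK + 0) + C * (0 + D * 0))"
    by (rule LIMSEQ_le_const2) (use key in auto)
  thus ?thesis by (simp add: J_def)
qed

section \<open>Logarithmic polar coordinates\<close>

lemma DD_x_iff: "DD (b, 0) f d (z, t) \<longleftrightarrow> DD b (\<lambda>z. f (z, t)) d z"
  by (simp add: DD_def)

lemma DD_t_iff: "DD (0, 1) f d (z, t) \<longleftrightarrow> ((\<lambda>t. f (z, t)) has_real_derivative d) (at t)"
  for t :: real
proof
  assume "DD (0, 1) f d (z, t)"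
  hence "((\<lambda>s. f (z, t + s)) has_real_derivative d) (at 0)" by (simp add: DD_def)
  thus "((\<lambda>t. f (z, t)) has_real_derivative d) (at t)"
    using DERIV_shift[of "\<lambda>t. f (z, t)" d 0 t] by (simp add: add.commute)
next
  assume "((\<lambda>t. f (z, t)) has_real_derivative d) (at t)"
  hence "((\<lambda>s. f (z, t + s)) has_real_derivative d) (at 0)"
    using DERIV_shift[of "\<lambda>t. f (z, t)" d 0 t] by (simp add: add.commute)
  thus "DD (0, 1) f d (z, t)" by (simp add: DD_def)
qed

lemma DD_norm: "z \<noteq> 0 \<Longrightarrow> DD b norm (z \<bullet> b / norm z) z"
  using DD_has_derivative[OF has_derivative_norm[of z]]
  by (simp add: sgn_div_norm inner_commute divide_inverse mult.commute)

lemma DD_inner: "DD b (\<lambda>z. z \<bullet> c) (b \<bullet> c) z"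
  unfolding DD_def by (auto intro!: derivative_eq_intros simp: inner_add_left)

lemma DD_ln_norm: "z \<noteq> 0 \<Longrightarrow> DD b (\<lambda>z. ln (norm z)) (z \<bullet> b / (norm z)\<^sup>2) z"
  using DD_chain[OF DERIV_ln[of "norm z"] DD_norm[of z b]] by (simp add: field_simps power2_eq_square)

lemma DD_norm_power: "z \<noteq> 0 \<Longrightarrow> DD b (\<lambda>z. norm z ^ n) (real n * norm z ^ (n - 1) * (z \<bullet> b / norm z)) z"
  using DD_chain[OF DERIV_pow DD_norm] by fastforce

lemma DD_grad_ln_norm:
  assumes "z \<noteq> 0" "b \<in> Basis"
  shows "DD b (\<lambda>z. z \<bullet> b / (norm z)\<^sup>2) (1 / (norm z)\<^sup>2 - 2 * (z \<bullet> b)\<^sup>2 / norm z ^ 4) z"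
proof -
  have "DD b (\<lambda>z. z \<bullet> b / (norm z)\<^sup>2)
     (((b \<bullet> b) * (norm z)\<^sup>2 - (z \<bullet> b) * (real 2 * norm z ^ (2 - 1) * (z \<bullet> b / norm z))) / ((norm z)\<^sup>2 * (norm z)\<^sup>2)) z"
    using assms(1) by (intro DD_divide DD_inner DD_norm_power) auto
  moreover have "((b \<bullet> b) * (norm z)\<^sup>2 - (z \<bullet> b) * (real 2 * norm z ^ (2 - 1) * (z \<bullet> b / norm z))) / ((norm z)\<^sup>2 * (norm z)\<^sup>2)
     = 1 / (norm z)\<^sup>2 - 2 * (z \<bullet> b)\<^sup>2 / norm z ^ 4"
  proof -
    define n where "n = norm z"
    have "n \<noteq> 0" using assms by (simp add: n_def)
    thus ?thesis using assms(2) unfolding n_def[symmetric]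
      by (simp add: divide_simps power2_eq_square power4_eq_xxxx)
  qed
  ultimately show ?thesis by simp
qed

lemma DD_cos_angle:
  assumes "z \<noteq> 0"
  shows "DD b (\<lambda>z. z \<bullet> e / norm z) (b \<bullet> e / norm z - (z \<bullet> e) * (z \<bullet> b) / norm z ^ 3) z"
proof -
  have "DD b (\<lambda>z. z \<bullet> e / norm z) (((b \<bullet> e) * norm z - (z \<bullet> e) * (z \<bullet> b / norm z)) / (norm z * norm z)) z"
    using assms by (intro DD_divide DD_inner DD_norm) auto
  moreover have "((b \<bullet> e) * norm z - (z \<bullet> e) * (z \<bullet> b / norm z)) / (norm z * norm z) =
      b \<bullet> e / norm z - (z \<bullet> e) * (z \<bullet> b) / norm z ^ 3"
  proof -
    define n where "n = norm z"
    have "n \<noteq> 0" using assms by (simp add: n_def)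
    thus ?thesis unfolding n_def[symmetric]
      by (simp add: divide_simps power3_eq_cube)
  qed
  ultimately show ?thesis by simp
qed

lemma DD_grad_cos_angle:
  assumes "z \<noteq> 0" "b \<in> Basis"
  shows "DD b (\<lambda>z. b \<bullet> e / norm z - (z \<bullet> e) * (z \<bullet> b) / norm z ^ 3)
     (- 2 * (b \<bullet> e) * (z \<bullet> b) / norm z ^ 3 - (z \<bullet> e) / norm z ^ 3 + 3 * (z \<bullet> e) * (z \<bullet> b)\<^sup>2 / norm z ^ 5) z"
proof -
  have "DD b (\<lambda>z. b \<bullet> e / norm z - (z \<bullet> e) * (z \<bullet> b) / norm z ^ 3)
     ((0 * norm z - (b \<bullet> e) * (z \<bullet> b / norm z)) / (norm z * norm z) -
      ((b \<bullet> e * (z \<bullet> b) + b \<bullet> b * (z \<bullet> e)) * norm z ^ 3 -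
        (z \<bullet> e) * (z \<bullet> b) * (real 3 * norm z ^ (3 - 1) * (z \<bullet> b / norm z))) / (norm z ^ 3 * norm z ^ 3)) z"
    using assms(1) by (intro DD_diff DD_divide DD_mult DD_inner DD_norm DD_const DD_norm_power) auto
  moreover have "(0 * norm z - (b \<bullet> e) * (z \<bullet> b / norm z)) / (norm z * norm z) -
      ((b \<bullet> e * (z \<bullet> b) + b \<bullet> b * (z \<bullet> e)) * norm z ^ 3 -
        (z \<bullet> e) * (z \<bullet> b) * (real 3 * norm z ^ (3 - 1) * (z \<bullet> b / norm z))) / (norm z ^ 3 * norm z ^ 3)
     = - 2 * (b \<bullet> e) * (z \<bullet> b) / norm z ^ 3 - (z \<bullet> e) / norm z ^ 3 + 3 * (z \<bullet> e) * (z \<bullet> b)\<^sup>2 / norm z ^ 5"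
  proof -
    have "(0 * n - c * (d / n)) / (n * n) - ((c * d + 1 * f) * n ^ 3 - f * d * (real 3 * n ^ (3 - 1) * (d / n))) / (n ^ 3 * n ^ 3)
      = - 2 * c * d / n ^ 3 - f / n ^ 3 + 3 * f * d\<^sup>2 / n ^ 5" if "n \<noteq> 0" for n c d f :: real
      using that by (simp add: divide_simps eval_nat_numeral, (simp add: algebra_simps)?)
    from this[of "norm z"] show ?thesis using assms by simp
  qed
  ultimately show ?thesis by simp
qed

lemma sum_Basis_inner_prod: "(\<Sum>b\<in>Basis. (z \<bullet> b) * (b \<bullet> w)) = z \<bullet> w"
  by (subst euclidean_inner[of z w]) (simp add: inner_commute)

lemma sum_Basis_inner_sq: "(\<Sum>b\<in>Basis. (z \<bullet> b)\<^sup>2) = (norm z)\<^sup>2"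
  using sum_Basis_inner_prod[of z z] by (simp add: power2_eq_square inner_commute power2_norm_eq_inner[symmetric])

text \<open>In the coordinates \<open>y = ln |z|\<close> and \<open>q = z \<bullet> e / |z|\<close> the operator \<open>|z|\<^sup>2 \<Delta>\<close> becomes
  \<open>\<partial>\<^sub>y\<^sub>y + (N - 2) \<partial>\<^sub>y + (1 - q\<^sup>2) \<partial>\<^sub>q\<^sub>q - (N - 1) q \<partial>\<^sub>q\<close>.\<close>

lemma C21_log_polar:
  fixes e :: "'a::euclidean_space" and g gy gyy gt :: "real \<Rightarrow> real \<Rightarrow> real" and k k' :: "real \<Rightarrow> real"
  assumes e: "norm e = 1"
    and g: "\<And>y t. t \<in> I \<Longrightarrow> ((\<lambda>y. g y t) has_real_derivative gy y t) (at y)"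
    and gy: "\<And>y t. t \<in> I \<Longrightarrow> ((\<lambda>y. gy y t) has_real_derivative gyy y t) (at y)"
    and gt: "\<And>y t. t \<in> I \<Longrightarrow> ((\<lambda>t. g y t) has_real_derivative gt y t) (at t)"
    and k: "\<And>t. t \<in> I \<Longrightarrow> (k has_real_derivative k' t) (at t)"
    and cont: "continuous_on (UNIV \<times> I) (\<lambda>(y, t). g y t)" "continuous_on (UNIV \<times> I) (\<lambda>(y, t). gy y t)"
      "continuous_on (UNIV \<times> I) (\<lambda>(y, t). gyy y t)" "continuous_on (UNIV \<times> I) (\<lambda>(y, t). gt y t)"
      "continuous_on I k'"
  defines "S \<equiv> {p :: 'a \<times> real. fst p \<noteq> 0 \<and> snd p \<in> I}"
  shows "\<exists>fx fxx ft. C21 S (\<lambda>p. g (ln (norm (fst p))) (snd p) * exp (k (snd p) * (fst p \<bullet> e / norm (fst p)))) fx fxx ft \<and>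
    (\<forall>p\<in>S. \<forall>\<sigma>. heat_op fxx (\<lambda>p. \<sigma> * ft p) p =
       (let y = ln (norm (fst p)); t = snd p; q = fst p \<bullet> e / norm (fst p); N = real DIM('a) in
        exp (k t * q) / (norm (fst p))\<^sup>2 *
         (gyy y t + (N - 2) * gy y t + g y t * (k t)\<^sup>2 * (1 - q\<^sup>2) - (N - 1) * g y t * k t * q
           + \<sigma> * (gt y t + g y t * k' t * q))))"
proof -
  define Y where "Y = (\<lambda>p :: 'a \<times> real. ln (norm (fst p)))"
  define q where "q = (\<lambda>p :: 'a \<times> real. fst p \<bullet> e / norm (fst p))"
  define Yx where "Yx = (\<lambda>b (p :: 'a \<times> real). fst p \<bullet> b / (norm (fst p))\<^sup>2)"
  define Yxx where "Yxx = (\<lambda>b (p :: 'a \<times> real). 1 / (norm (fst p))\<^sup>2 - 2 * (fst p \<bullet> b)\<^sup>2 / norm (fst p) ^ 4)"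
  define qx where "qx = (\<lambda>b (p :: 'a \<times> real). b \<bullet> e / norm (fst p) - (fst p \<bullet> e) * (fst p \<bullet> b) / norm (fst p) ^ 3)"
  define qxx where "qxx = (\<lambda>b (p :: 'a \<times> real). - 2 * (b \<bullet> e) * (fst p \<bullet> b) / norm (fst p) ^ 3 - (fst p \<bullet> e) / norm (fst p) ^ 3
       + 3 * (fst p \<bullet> e) * (fst p \<bullet> b)\<^sup>2 / norm (fst p) ^ 5)"
  define X where "X = (\<lambda>p. exp (k (snd p) * q p))"
  define f where "f = (\<lambda>p. g (Y p) (snd p) * X p)"
  define fx where "fx = (\<lambda>b p. (gy (Y p) (snd p) * Yx b p + g (Y p) (snd p) * (k (snd p) * qx b p)) * X p)"
  define fxx where "fxx = (\<lambda>b p. (gyy (Y p) (snd p) * (Yx b p)\<^sup>2 + gy (Y p) (snd p) * Yxx b p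
      + 2 * gy (Y p) (snd p) * k (snd p) * (Yx b p * qx b p) + g (Y p) (snd p) * (k (snd p))\<^sup>2 * (qx b p)\<^sup>2
      + g (Y p) (snd p) * k (snd p) * qxx b p) * X p)"
  define ft where "ft = (\<lambda>p. (gt (Y p) (snd p) + g (Y p) (snd p) * k' (snd p) * q p) * X p)"
  have contS: "continuous_on S (\<lambda>p. F (Y p) (snd p))" if "continuous_on (UNIV \<times> I) (\<lambda>(y, t). F y t)"
    for F :: "real \<Rightarrow> real \<Rightarrow> real"
  proof -
    have "continuous_on S (\<lambda>p. (\<lambda>(y, t). F y t) (Y p, snd p))"
      by (rule continuous_on_compose2[OF that]) (auto simp: Y_def S_def intro!: continuous_intros)
    thus ?thesis by simp
  qed
  have "continuous_on I k" using k by (meson DERIV_isCont continuous_at_imp_continuous_on)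
  hence ck: "continuous_on S (\<lambda>p. k (snd p))" "continuous_on S (\<lambda>p. k' (snd p))"
    by (rule continuous_on_compose2[OF _ continuous_on_snd[OF continuous_on_id]], force simp: S_def)
       (rule continuous_on_compose2[OF cont(5) continuous_on_snd[OF continuous_on_id]], force simp: S_def)
  have cb: "continuous_on S Y" "continuous_on S q" "continuous_on S (Yx b)" "continuous_on S (Yxx b)"
     "continuous_on S (qx b)" "continuous_on S (qxx b)" for b
    unfolding Y_def q_def Yx_def Yxx_def qx_def qxx_def S_def by (auto intro!: continuous_intros)
  note cs = contS[OF cont(1)] contS[OF cont(2)] contS[OF cont(3)] contS[OF cont(4)] ck cb
  have "C21 S f fx fxx ft"
    unfolding C21_def
  proof (intro conjI ballI)
    fix p b assume p: "p \<in> S" and b: "b \<in> (Basis :: 'a set)"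
    obtain z t where pz: "p = (z, t)" by (cases p)
    have z: "z \<noteq> 0" and t: "t \<in> I" using p by (auto simp: S_def pz)
    have dY: "DD (b, 0) Y (Yx b p) p" "DD (b, 0) (Yx b) (Yxx b p) p" "DD (b, 0) q (qx b p) p" "DD (b, 0) (qx b) (qxx b p) p"
      unfolding pz DD_x_iff Y_def Yx_def Yxx_def q_def qx_def qxx_def fst_conv
      by (fact DD_ln_norm[OF z] DD_grad_ln_norm[OF z b] DD_cos_angle[OF z] DD_grad_cos_angle[OF z b])+
    have dF: "DD (b, 0) (\<lambda>p. F (Y p) (snd p)) (F' (Y p) (snd p) * Yx b p) p"
      if "\<And>y t. t \<in> I \<Longrightarrow> ((\<lambda>y. F y t) has_real_derivative F' y t) (at y)" for F F'
    proof -
      have "DD b (\<lambda>z. Y (z, t)) (Yx b p) z" using dY(1) unfolding pz DD_x_iff .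
      from DD_chain[OF that[OF t, of "Y (z, t)"] this] show ?thesis
        unfolding pz DD_x_iff by simp
    qed
    have dk: "DD (b, 0) (\<lambda>p. k (snd p)) 0 p" unfolding pz DD_x_iff by (simp add: DD_const)
    have dX: "DD (b, 0) X (k (snd p) * qx b p * X p) p"
    proof -
      have "DD (b, 0) (\<lambda>p. k (snd p) * q p) (0 * q p + qx b p * k (snd p)) p"
        by (intro DD_mult dk dY)
      from DD_chain[OF DERIV_exp this] show ?thesis by (simp add: X_def mult_ac)
    qed
    have "DD (b, 0) f (gy (Y p) (snd p) * Yx b p * X p + k (snd p) * qx b p * X p * g (Y p) (snd p)) p"
      unfolding f_def by (intro DD_mult dF g dX)
    thus "DD (b, 0) f (fx b p) p" by (simp add: fx_def algebra_simps)
    have "DD (b, 0) (fx b)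
      (((gyy (Y p) (snd p) * Yx b p * Yx b p + Yxx b p * gy (Y p) (snd p))
       + (gy (Y p) (snd p) * Yx b p * (k (snd p) * qx b p) + (0 * qx b p + qxx b p * k (snd p)) * g (Y p) (snd p))) * X p
       + k (snd p) * qx b p * X p * (gy (Y p) (snd p) * Yx b p + g (Y p) (snd p) * (k (snd p) * qx b p))) p"
      unfolding fx_def by (intro DD_mult DD_add dF g gy dX dk dY)
    thus "DD (b, 0) (fx b) (fxx b p) p"
      by (rule back_subst[of "\<lambda>d. DD (b, 0) (fx b) d p"]) (simp add: fxx_def power2_eq_square algebra_simps)
  next
    fix p assume p: "p \<in> S"
    obtain z t where pz: "p = (z, t)" by (cases p)
    have t: "t \<in> I" using p by (auto simp: S_def pz)
    have "((\<lambda>t. g (ln (norm z)) t * exp (k t * (z \<bullet> e / norm z))) has_real_derivative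
       gt (ln (norm z)) t * exp (k t * (z \<bullet> e / norm z)) +
         exp (k t * (z \<bullet> e / norm z)) * (k' t * (z \<bullet> e / norm z)) * g (ln (norm z)) t) (at t)"
      by (intro DERIV_mult gt[OF t] DERIV_chain2[OF DERIV_exp] DERIV_cmult_right k[OF t])
    thus "DD (0, 1) f (ft p) p"
      unfolding pz DD_t_iff f_def ft_def X_def Y_def q_def fst_conv snd_conv
      by (rule back_subst[of "\<lambda>d. DERIV _ _ :> d"]) (simp add: algebra_simps)
  next
    show "continuous_on S f" "continuous_on S ft" "continuous_on S (fx b)" "continuous_on S (fxx b)" for b
      unfolding f_def ft_def fx_def fxx_def X_def by (intro continuous_intros cs)+
  qed
  \<comment> \<open>The sign is left free: \<open>\<sigma> = 1\<close> yields the backward operator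
    for test functions, \<open>\<sigma> = - 1\<close> the equation itself for the profile
    \<open>E\<close>.\<close>
  moreover have "heat_op fxx (\<lambda>p. \<sigma> * ft p) p =
       (let y = ln (norm (fst p)); t = snd p; q = fst p \<bullet> e / norm (fst p); N = real DIM('a) in
        exp (k t * q) / (norm (fst p))\<^sup>2 *
         (gyy y t + (N - 2) * gy y t + g y t * (k t)\<^sup>2 * (1 - q\<^sup>2) - (N - 1) * g y t * k t * q
           + \<sigma> * (gt y t + g y t * k' t * q)))" if p: "p \<in> S" for p \<sigma>
  proof -
    define n where "n = norm (fst p)"
    define N where "N = real DIM('a)"
    have n: "n \<noteq> 0" using p by (auto simp: n_def S_def)
    have ee: "(\<Sum>b\<in>Basis. (b \<bullet> e)\<^sup>2) = 1"
      using sum_Basis_inner_sq[of e] e by (simp add: inner_commute)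
    have zz: "(\<Sum>b\<in>Basis. (fst p \<bullet> b)\<^sup>2) = n\<^sup>2" by (simp add: sum_Basis_inner_sq n_def)
    have ze: "(\<Sum>b\<in>Basis. (fst p \<bullet> b) * (b \<bullet> e)) = q p * n"
      using n by (simp add: sum_Basis_inner_prod q_def n_def)
    have qe: "fst p \<bullet> e = q p * n" using n by (simp add: q_def n_def)
    have a1: "a / n\<^sup>2 * (c / n - d * a / n ^ 3) = a * c / n ^ 3 - d * a\<^sup>2 / n ^ 5" for a c d
      using n by (simp add: field_simps eval_nat_numeral)
    have a2: "(c / n - d * a / n ^ 3)\<^sup>2 = c\<^sup>2 / n\<^sup>2 - (2 * d) * (a * c) / n ^ 4 + d\<^sup>2 * a\<^sup>2 / n ^ 6" for a c d
      using n by (simp add: power2_diff power_divide power_mult_distrib) (simp add: field_simps eval_nat_numeral)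
    have s1: "(\<Sum>b\<in>Basis. (Yx b p)\<^sup>2) = 1 / n\<^sup>2"
    proof -
      have "(\<Sum>b\<in>Basis. (Yx b p)\<^sup>2) = (\<Sum>b\<in>Basis. (fst p \<bullet> b)\<^sup>2) / n ^ 4"
        by (simp add: Yx_def n_def power_divide sum_divide_distrib)
      thus ?thesis using n unfolding zz by (simp add: divide_simps eval_nat_numeral)
    qed
    have s2: "(\<Sum>b\<in>Basis. Yxx b p) = (N - 2) / n\<^sup>2"
    proof -
      have "(\<Sum>b\<in>Basis. Yxx b p) = N * (1 / n\<^sup>2) - 2 * (\<Sum>b\<in>Basis. (fst p \<bullet> b)\<^sup>2) / n ^ 4"
        by (simp add: Yxx_def n_def N_def sum_subtractf sum_distrib_left sum_divide_distrib)
      thus ?thesis using n unfolding zz by (simp add: divide_simps eval_nat_numeral, (simp add: algebra_simps)?)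
    qed
    \<comment> \<open>The angle is homogeneous of degree 0, so its gradient is orthogonal to the
      radial one and no mixed derivative survives.\<close>
    have s3: "(\<Sum>b\<in>Basis. Yx b p * qx b p) = 0"
    proof -
      have "(\<Sum>b\<in>Basis. Yx b p * qx b p) = (\<Sum>b\<in>Basis. (fst p \<bullet> b) * (b \<bullet> e) / n ^ 3 - (q p * n) * (fst p \<bullet> b)\<^sup>2 / n ^ 5)"
        unfolding Yx_def qx_def qe n_def[symmetric] by (intro sum.cong refl a1)
      also have "\<dots> = (\<Sum>b\<in>Basis. (fst p \<bullet> b) * (b \<bullet> e)) / n ^ 3 - (q p * n) * (\<Sum>b\<in>Basis. (fst p \<bullet> b)\<^sup>2) / n ^ 5"
        by (simp only: sum_subtractf sum_distrib_left sum_divide_distrib)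
      finally show ?thesis using n unfolding zz ze by (simp add: divide_simps eval_nat_numeral)
    qed
    have s4: "(\<Sum>b\<in>Basis. (qx b p)\<^sup>2) = (1 - (q p)\<^sup>2) / n\<^sup>2"
    proof -
      have "(\<Sum>b\<in>Basis. (qx b p)\<^sup>2) = (\<Sum>b\<in>Basis. (b \<bullet> e)\<^sup>2 / n\<^sup>2 - (2 * (q p * n)) * ((fst p \<bullet> b) * (b \<bullet> e)) / n ^ 4
           + (q p * n)\<^sup>2 * (fst p \<bullet> b)\<^sup>2 / n ^ 6)"
        unfolding qx_def qe n_def[symmetric] by (intro sum.cong refl a2)
      also have "\<dots> = (\<Sum>b\<in>Basis. (b \<bullet> e)\<^sup>2) / n\<^sup>2 - (2 * (q p * n)) * (\<Sum>b\<in>Basis. (fst p \<bullet> b) * (b \<bullet> e)) / n ^ 4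
           + (q p * n)\<^sup>2 * (\<Sum>b\<in>Basis. (fst p \<bullet> b)\<^sup>2) / n ^ 6"
        by (simp only: sum_subtractf sum.distrib sum_distrib_left sum_divide_distrib)
      finally show ?thesis using n unfolding zz ze ee by (simp add: field_simps eval_nat_numeral)
    qed
    \<comment> \<open>A linear function restricted to the sphere is a spherical harmonic of degree
      1, with eigenvalue \<open>- (N - 1)\<close>.\<close>
    have s5: "(\<Sum>b\<in>Basis. qxx b p) = - (N - 1) * q p / n\<^sup>2"
    proof -
      have "(\<Sum>b\<in>Basis. qxx b p) = (\<Sum>b\<in>Basis. - 2 * ((fst p \<bullet> b) * (b \<bullet> e)) / n ^ 3 - q p * n / n ^ 3 + 3 * (q p * n) * (fst p \<bullet> b)\<^sup>2 / n ^ 5)"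
        unfolding qxx_def qe n_def[symmetric] by (intro sum.cong refl) (simp add: mult_ac)
      also have "\<dots> = - 2 * (\<Sum>b\<in>Basis. (fst p \<bullet> b) * (b \<bullet> e)) / n ^ 3 - (\<Sum>b\<in>(Basis::'a set). q p * n / n ^ 3)
           + 3 * (q p * n) * (\<Sum>b\<in>Basis. (fst p \<bullet> b)\<^sup>2) / n ^ 5"
        by (simp only: sum_subtractf sum.distrib sum_distrib_left sum_divide_distrib)
      also have "(\<Sum>b\<in>(Basis::'a set). q p * n / n ^ 3) = N * (q p * n / n ^ 3)" by (simp add: N_def)
      finally show ?thesis using n unfolding zz ze by (simp add: divide_simps eval_nat_numeral, (simp add: algebra_simps)?)
    qed
    have "(\<Sum>b\<in>Basis. fxx b p) = (gyy (Y p) (snd p) * (\<Sum>b\<in>Basis. (Yx b p)\<^sup>2) + gy (Y p) (snd p) * (\<Sum>b\<in>Basis. Yxx b p)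
      + 2 * gy (Y p) (snd p) * k (snd p) * (\<Sum>b\<in>Basis. Yx b p * qx b p) + g (Y p) (snd p) * (k (snd p))\<^sup>2 * (\<Sum>b\<in>Basis. (qx b p)\<^sup>2)
      + g (Y p) (snd p) * k (snd p) * (\<Sum>b\<in>Basis. qxx b p)) * X p"
      unfolding fxx_def by (simp only: sum_distrib_left sum.distrib[symmetric] sum_distrib_right)
    also have "\<dots> = X p / n\<^sup>2 * (gyy (Y p) (snd p) + (N - 2) * gy (Y p) (snd p) + g (Y p) (snd p) * (k (snd p))\<^sup>2 * (1 - (q p)\<^sup>2)
       - (N - 1) * g (Y p) (snd p) * k (snd p) * q p)"
      unfolding s1 s2 s3 s4 s5 by (simp add: add_divide_distrib diff_divide_distrib algebra_simps)
    finally show ?thesis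
      unfolding heat_op_def Let_def ft_def X_def q_def[symmetric] Y_def n_def N_def
      by (simp add: q_def add_divide_distrib diff_divide_distrib algebra_simps)
  qed
  ultimately show ?thesis unfolding f_def X_def Y_def q_def by blast
qed

section \<open>Backward supersolutions\<close>

lemma max_0_square_deriv: "((\<lambda>x. (max 0 x)\<^sup>2) has_real_derivative 2 * max 0 x) (at x)" for x :: real
proof (cases x "0 :: real" rule: linorder_cases)
  case less
  have "((\<lambda>x. 0) has_real_derivative 2 * max 0 x) (at x)" using less by simp
  thus ?thesis
    by (rule has_field_derivative_transform_within_open[of _ _ _ "{..<0}"]) (use less in auto)
next
  case equal
  have "((\<lambda>x. (max 0 x)\<^sup>2) has_real_derivative 0) (at 0)"
    by (rule has_real_derivative_0_if_quadratic[of _ 1]) (auto simp: max_def)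
  thus ?thesis using equal by simp
next
  case greater
  have "((\<lambda>x. x\<^sup>2) has_real_derivative 2 * max 0 x) (at x)"
    using greater by (auto intro!: derivative_eq_intros)
  thus ?thesis
    by (rule has_field_derivative_transform_within_open[of _ _ _ "{0<..}"]) (use greater in auto)
qed

lemma max_0_cube_deriv: "((\<lambda>x. (max 0 x) ^ 3) has_real_derivative 3 * (max 0 x)\<^sup>2) (at x)" for x :: real
proof -
  have "((\<lambda>x. (max 0 x)\<^sup>2 * x) has_real_derivative 2 * max 0 x * x + 1 * (max 0 x)\<^sup>2) (at x)"
    by (rule DERIV_mult[OF max_0_square_deriv DERIV_ident])
  moreover have "2 * max 0 x * x + 1 * (max 0 x)\<^sup>2 = 3 * (max 0 x)\<^sup>2"
    by (auto simp: max_def power2_eq_square)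
  moreover have "(\<lambda>x::real. (max 0 x)\<^sup>2 * x) = (\<lambda>x. (max 0 x) ^ 3)"
    by (auto simp: max_def power2_eq_square power3_eq_cube)
  ultimately show ?thesis by (simp only:)
qed

text \<open>Two continuous derivatives are all that \<open>C21\<close> asks for, so a power of a
  positive part can replace a smooth cutoff; \<open>cutoff1\<close> and \<open>cutoff2\<close> are
  its first and second derivative.\<close>

definition cutoff :: "real \<Rightarrow> real" where "cutoff s = (max 0 (1 - s\<^sup>2)) ^ 3"
definition cutoff1 :: "real \<Rightarrow> real" where "cutoff1 s = - 6 * s * (max 0 (1 - s\<^sup>2))\<^sup>2"
definition cutoff2 :: "real \<Rightarrow> real" where
  "cutoff2 s = - 6 * (max 0 (1 - s\<^sup>2))\<^sup>2 + 24 * s\<^sup>2 * max 0 (1 - s\<^sup>2)"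

lemma cutoff_deriv: "(cutoff has_real_derivative cutoff1 s) (at s)"
proof -
  have "((\<lambda>s. 1 - s\<^sup>2) has_real_derivative - 2 * s) (at s)"
    by (auto intro!: derivative_eq_intros)
  from DERIV_chain2[OF max_0_cube_deriv this] show ?thesis
    by (simp add: cutoff_def[abs_def] cutoff1_def mult_ac)
qed

lemma cutoff1_deriv: "(cutoff1 has_real_derivative cutoff2 s) (at s)"
proof -
  have "((\<lambda>s. 1 - s\<^sup>2) has_real_derivative - 2 * s) (at s)"
    by (auto intro!: derivative_eq_intros)
  from DERIV_mult[OF DERIV_cmult[OF DERIV_ident, of "- 6"] DERIV_chain2[OF max_0_square_deriv this]]
  show ?thesis
    by (simp add: cutoff1_def[abs_def] cutoff2_def mult_ac power2_eq_square[of s])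
qed

lemma cutoff_continuous:
  "continuous_on A cutoff" "continuous_on A cutoff1" "continuous_on A cutoff2"
  unfolding cutoff_def[abs_def] cutoff1_def[abs_def] cutoff2_def[abs_def] by (intro continuous_intros)+

lemma cutoff_bounds: "0 \<le> cutoff s" "cutoff s \<le> 1" "\<bar>cutoff1 s\<bar> \<le> 6" "\<bar>cutoff2 s\<bar> \<le> 30"
proof -
  define m where "m = max 0 (1 - s\<^sup>2)"
  have m: "0 \<le> m" "m \<le> 1" by (auto simp: m_def)
  have m2: "m\<^sup>2 \<le> 1" "0 \<le> m\<^sup>2" using m by (auto simp: power_le_one)
  show "0 \<le> cutoff s" "cutoff s \<le> 1" using m by (auto simp: cutoff_def m_def[symmetric] power_le_one)
  have s: "m = 0 \<or> s\<^sup>2 \<le> 1" by (auto simp: m_def)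
  hence s': "m = 0 \<or> \<bar>s\<bar> \<le> 1" by (simp add: abs_square_le_1)
  have "\<bar>s\<bar> * m\<^sup>2 \<le> 1" using s' m2 by (auto intro: mult_le_one)
  thus "\<bar>cutoff1 s\<bar> \<le> 6" by (simp add: cutoff1_def m_def[symmetric] abs_mult)
  have "0 \<le> s\<^sup>2 * m" "s\<^sup>2 * m \<le> 1" using s m by (auto intro: mult_le_one)
  thus "\<bar>cutoff2 s\<bar> \<le> 30" using m2
    unfolding cutoff2_def m_def[symmetric] mult.assoc by linarith
qed

lemma cutoff_eq_0: "\<bar>s\<bar> \<ge> 1 \<Longrightarrow> cutoff s = 0"
  using abs_square_le_1[of s] one_le_power[of "\<bar>s\<bar>" 2] by (simp add: cutoff_def)

definition kernel_exponent :: "real \<Rightarrow> real \<Rightarrow> real \<Rightarrow> real \<Rightarrow> real \<Rightarrow> real \<Rightarrow> real" where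
  "kernel_exponent N \<theta> y0 T y t =
     - (y - y0)\<^sup>2 / (4 * (T - t)) - (N - 2) / 2 * (y0 + y) - ((N - 2) / 2)\<^sup>2 * (T - t) - ln (T - t) / 2
     + \<theta> * (- (N - 1) / 2 * ln (T - t) + (N - 1)\<^sup>2 / 4 * (T - t) - 1 / (2 * (T - t)))"

text \<open>For \<open>\<theta> = 0\<close> this is, up to a constant factor and with \<open>y\<^sub>0 = ln |x|\<close>, the heat kernel of the
  radial problem with respect to the measure \<open>|z|\<^sup>-\<^sup>2 dz\<close>, run backwards from time \<open>T\<close>; it solves
  the adjoint equation. For \<open>\<theta> = 1\<close> it carries an additional factor
  \<open>\<tau> powr (- (N - 1) / 2) * exp ((N - 1)\<^sup>2 \<tau> / 4 - (1 - q) / (2 \<tau>))\<close>, \<open>\<tau> = T - t\<close>, a supersolution of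
  the heat equation on the sphere that concentrates at the point \<open>e\<close> as \<open>\<tau> \<rightarrow> 0\<close>.\<close>

definition backward_kernel :: "real \<Rightarrow> real \<Rightarrow> 'a::euclidean_space \<Rightarrow> real \<Rightarrow> 'a \<times> real \<Rightarrow> real" where
  "backward_kernel \<theta> y0 e T p =
     exp (kernel_exponent (real DIM('a)) \<theta> y0 T (ln (norm (fst p))) (snd p)) *
     exp (\<theta> / (2 * (T - snd p)) * (fst p \<bullet> e / norm (fst p)))"

text \<open>The kernel alone satisfies the supersolution inequality. What remains is the derivative
  of \<open>\<zeta>\<close> and the terms that differentiate the cutoff; these carry
  \<open>1 / R\<close> and grow only linearly in \<open>|y - y0|\<close>, which the Gaussian can
  absorb.\<close>

lemma backward_kernel_test_function:
  fixes e :: "'a::euclidean_space" and \<theta> y0 T R :: real and \<zeta> \<zeta>' :: "real \<Rightarrow> real"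
  assumes \<theta>: "\<theta> = 0 \<or> \<theta> = 1" and e: "norm e = 1" and R: "R \<ge> 1"
    and \<zeta>: "\<And>t. (\<zeta> has_real_derivative \<zeta>' t) (at t)" "continuous_on UNIV \<zeta>'" "\<And>t. \<zeta> t \<ge> 0"
  defines "S \<equiv> {p :: 'a \<times> real. fst p \<noteq> 0 \<and> snd p \<in> {0<..<T}}"
  shows "\<exists>\<phi>x \<phi>xx \<phi>t. C21 S (\<lambda>p. backward_kernel \<theta> y0 e T p * (cutoff (ln (norm (fst p)) / R) * \<zeta> (snd p))) \<phi>x \<phi>xx \<phi>t \<and>
    (\<forall>p\<in>S. heat_op \<phi>xx \<phi>t p \<le> backward_kernel \<theta> y0 e T p / (norm (fst p))\<^sup>2 *
       (cutoff (ln (norm (fst p)) / R) * \<zeta>' (snd p) +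
        \<zeta> (snd p) * ((6 * \<bar>ln (norm (fst p)) - y0\<bar> / (T - snd p) + 30) / R)))"
proof -
  define N where "N = real DIM('a)"
  define a where "a = (N - 2) / 2"
  define h where "h = kernel_exponent N \<theta> y0 T"
  define hy where "hy = (\<lambda>y t. - (y - y0) / (2 * (T - t)) - a)"
  define hyy where "hyy = (\<lambda>(y::real) t. - 1 / (2 * (T - t)))"
  define ht where "ht = (\<lambda>y t. - (y - y0)\<^sup>2 / (4 * (T - t)\<^sup>2) + a\<^sup>2 + 1 / (2 * (T - t))
      + \<theta> * ((N - 1) / (2 * (T - t)) - (N - 1)\<^sup>2 / 4 - 1 / (2 * (T - t)\<^sup>2)))"
  define k where "k = (\<lambda>t. \<theta> / (2 * (T - t)))"
  define k' where "k' = (\<lambda>t. \<theta> / (2 * (T - t)\<^sup>2))"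
  have dh: "((\<lambda>y. h y t) has_real_derivative hy y t) (at y)"
    and dhy: "((\<lambda>y. hy y t) has_real_derivative hyy y t) (at y)"
    and dht: "((\<lambda>t. h y t) has_real_derivative ht y t) (at t)"
    and dk: "(k has_real_derivative k' t) (at t)" if t: "t \<in> {0<..<T}" for y t
  proof -
    have t': "T - t > 0" using t by simp
    show "((\<lambda>y. h y t) has_real_derivative hy y t) (at y)"
      using t' unfolding h_def kernel_exponent_def hy_def a_def
      by (auto intro!: derivative_eq_intros simp: divide_simps) (simp add: algebra_simps)
    show "((\<lambda>y. hy y t) has_real_derivative hyy y t) (at y)"
      using t' unfolding hy_def hyy_def by (auto intro!: derivative_eq_intros simp: divide_simps)
    have inv: "((\<lambda>t. 1 / (T - t)) has_real_derivative 1 / (T - t)\<^sup>2) (at t)"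
      using t' by (auto intro!: derivative_eq_intros simp: power2_eq_square)
    have ln: "((\<lambda>t. ln (T - t)) has_real_derivative - 1 / (T - t)) (at t)"
      using t' by (auto intro!: derivative_eq_intros)
    have id: "((\<lambda>t. T - t) has_real_derivative - 1) (at t)"
      by (auto intro!: derivative_eq_intros)
    have h_alt: "h y t = - (y - y0)\<^sup>2 / 4 * (1 / (T - t)) + (- a * (y0 + y)) + (- a\<^sup>2) * (T - t) + (- 1 / 2) * ln (T - t)
       + \<theta> * (- (N - 1) / 2 * ln (T - t) + (N - 1)\<^sup>2 / 4 * (T - t) + (- 1 / 2) * (1 / (T - t)))" for t
      by (simp add: h_def kernel_exponent_def a_def)
    have "((\<lambda>t. h y t) has_real_derivative
       - (y - y0)\<^sup>2 / 4 * (1 / (T - t)\<^sup>2) + 0 + (- a\<^sup>2) * (- 1) + (- 1 / 2) * (- 1 / (T - t))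
       + \<theta> * (- (N - 1) / 2 * (- 1 / (T - t)) + (N - 1)\<^sup>2 / 4 * (- 1) + (- 1 / 2) * (1 / (T - t)\<^sup>2))) (at t)"
      unfolding h_alt by (intro DERIV_add DERIV_cmult inv ln id DERIV_const)
    thus "((\<lambda>t. h y t) has_real_derivative ht y t) (at t)"
      by (rule back_subst[of "\<lambda>d. DERIV _ _ :> d"]) (simp add: ht_def diff_divide_distrib)
    have "((\<lambda>t. \<theta> / 2 * (1 / (T - t))) has_real_derivative \<theta> / 2 * (1 / (T - t)\<^sup>2)) (at t)"
      by (intro DERIV_cmult inv)
    thus "(k has_real_derivative k' t) (at t)" by (simp add: k_def[abs_def] k'_def)
  qed
  define c where "c = (\<lambda>y. cutoff (y / R))"
  define c1 where "c1 = (\<lambda>y. cutoff1 (y / R) / R)"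
  define c2 where "c2 = (\<lambda>y. cutoff2 (y / R) / R\<^sup>2)"
  have dc: "(c has_real_derivative c1 y) (at y)" "(c1 has_real_derivative c2 y) (at y)" for y
  proof -
    have i: "((\<lambda>y. y / R) has_real_derivative 1 / R) (at y)" using R by (auto intro!: derivative_eq_intros)
    show "(c has_real_derivative c1 y) (at y)"
      using DERIV_chain2[OF cutoff_deriv i] by (simp add: c_def[abs_def] c1_def)
    show "(c1 has_real_derivative c2 y) (at y)"
      using DERIV_cdivide[OF DERIV_chain2[OF cutoff1_deriv i], of R] by (simp add: c1_def[abs_def] c2_def power2_eq_square)
  qed
  define g where "g = (\<lambda>y t. exp (h y t) * (c y * \<zeta> t))"
  define gy where "gy = (\<lambda>y t. exp (h y t) * ((hy y t * c y + c1 y) * \<zeta> t))"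
  define gyy where "gyy = (\<lambda>y t. exp (h y t) * (((hyy y t + (hy y t)\<^sup>2) * c y + 2 * hy y t * c1 y + c2 y) * \<zeta> t))"
  define gt where "gt = (\<lambda>y t. exp (h y t) * (ht y t * c y * \<zeta> t + c y * \<zeta>' t))"
  have \<zeta>c: "continuous_on UNIV \<zeta>" using \<zeta>(1) by (meson DERIV_isCont continuous_at_imp_continuous_on)
  have cc: "continuous_on UNIV c" "continuous_on UNIV c1" "continuous_on UNIV c2"
    unfolding c_def c1_def c2_def using R
    by (auto intro!: continuous_intros continuous_on_compose2[OF cutoff_continuous(1)[of UNIV]]
      continuous_on_compose2[OF cutoff_continuous(2)[of UNIV]] continuous_on_compose2[OF cutoff_continuous(3)[of UNIV]])
  let ?D = "UNIV \<times> {0<..<T} :: (real \<times> real) set"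
  have ne: "T - snd p \<noteq> 0" "T - snd p > 0" if "p \<in> ?D" for p using that by auto
  have hcont: "continuous_on ?D (\<lambda>p. h (fst p) (snd p))" "continuous_on ?D (\<lambda>p. hy (fst p) (snd p))"
    "continuous_on ?D (\<lambda>p. hyy (fst p) (snd p))" "continuous_on ?D (\<lambda>p. ht (fst p) (snd p))"
    unfolding h_def kernel_exponent_def hy_def hyy_def ht_def
    by (intro continuous_intros ballI; use ne in force)+
  have ccont: "continuous_on ?D (\<lambda>p. c (fst p))" "continuous_on ?D (\<lambda>p. c1 (fst p))" "continuous_on ?D (\<lambda>p. c2 (fst p))"
     "continuous_on ?D (\<lambda>p. \<zeta> (snd p))" "continuous_on ?D (\<lambda>p. \<zeta>' (snd p))"
    by (auto intro!: continuous_on_compose2[OF cc(1)] continuous_on_compose2[OF cc(2)] continuous_on_compose2[OF cc(3)]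
      continuous_on_compose2[OF \<zeta>c] continuous_on_compose2[OF \<zeta>(2)] continuous_on_fst continuous_on_snd continuous_on_id)
  have "\<exists>fx fxx ft. C21 S (\<lambda>p. g (ln (norm (fst p))) (snd p) * exp (k (snd p) * (fst p \<bullet> e / norm (fst p)))) fx fxx ft \<and>
    (\<forall>p\<in>S. \<forall>\<sigma>. heat_op fxx (\<lambda>p. \<sigma> * ft p) p =
       (let y = ln (norm (fst p)); t = snd p; q = fst p \<bullet> e / norm (fst p); N = real DIM('a) in
        exp (k t * q) / (norm (fst p))\<^sup>2 *
         (gyy y t + (N - 2) * gy y t + g y t * (k t)\<^sup>2 * (1 - q\<^sup>2) - (N - 1) * g y t * k t * q
           + \<sigma> * (gt y t + g y t * k' t * q))))"
    unfolding S_def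
  proof (rule C21_log_polar[OF e])
    fix y t :: real assume t: "t \<in> {0<..<T}"
    have eh: "((\<lambda>y. exp (h y t)) has_real_derivative exp (h y t) * hy y t) (at y)"
      by (rule DERIV_chain2[OF DERIV_exp dh[OF t]])
    show "((\<lambda>y. g y t) has_real_derivative gy y t) (at y)"
      unfolding g_def gy_def
      using DERIV_mult[OF eh DERIV_cmult_right[OF dc(1), of "\<zeta> t"]]
      by (rule back_subst[of "\<lambda>d. DERIV _ _ :> d"]) (simp add: algebra_simps)
    show "((\<lambda>y. gy y t) has_real_derivative gyy y t) (at y)"
      unfolding gy_def gyy_def
      using DERIV_mult[OF eh DERIV_cmult_right[OF DERIV_add[OF DERIV_mult[OF dhy[OF t] dc(1)] dc(2)], of "\<zeta> t"]]
      by (rule back_subst[of "\<lambda>d. DERIV _ _ :> d"]) (simp add: algebra_simps power2_eq_square)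
    show "((\<lambda>t. g y t) has_real_derivative gt y t) (at t)"
      unfolding g_def gt_def
      using DERIV_mult[OF DERIV_chain2[OF DERIV_exp dht[OF t]] DERIV_cmult[OF \<zeta>(1), of "c y"]]
      by (rule back_subst[of "\<lambda>d. DERIV _ _ :> d"]) (simp add: algebra_simps)
    show "(k has_real_derivative k' t) (at t)" by (rule dk[OF t])
  next
    show "continuous_on ?D (\<lambda>(y, t). g y t)" "continuous_on ?D (\<lambda>(y, t). gy y t)"
      "continuous_on ?D (\<lambda>(y, t). gyy y t)" "continuous_on ?D (\<lambda>(y, t). gt y t)"
      unfolding g_def gy_def gyy_def gt_def case_prod_unfold
      by (intro continuous_intros hcont ccont)+
    show "continuous_on {0<..<T} k'" unfolding k'_def by (auto intro!: continuous_intros)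
  qed
  then obtain fx fxx ft where f: "C21 S (\<lambda>p. g (ln (norm (fst p))) (snd p) * exp (k (snd p) * (fst p \<bullet> e / norm (fst p)))) fx fxx ft"
    and op: "\<And>p \<sigma>. p \<in> S \<Longrightarrow> heat_op fxx (\<lambda>p. \<sigma> * ft p) p =
       (let y = ln (norm (fst p)); t = snd p; q = fst p \<bullet> e / norm (fst p); N = real DIM('a) in
        exp (k t * q) / (norm (fst p))\<^sup>2 *
         (gyy y t + (N - 2) * gy y t + g y t * (k t)\<^sup>2 * (1 - q\<^sup>2) - (N - 1) * g y t * k t * q
           + \<sigma> * (gt y t + g y t * k' t * q)))" by blast
  have f_eq: "(\<lambda>p. g (ln (norm (fst p))) (snd p) * exp (k (snd p) * (fst p \<bullet> e / norm (fst p)))) =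
    (\<lambda>p. backward_kernel \<theta> y0 e T p * (cutoff (ln (norm (fst p)) / R) * \<zeta> (snd p)))"
    by (auto simp: g_def backward_kernel_def h_def k_def c_def N_def fun_eq_iff)
  have "heat_op fxx ft p \<le> backward_kernel \<theta> y0 e T p / (norm (fst p))\<^sup>2 *
       (cutoff (ln (norm (fst p)) / R) * \<zeta>' (snd p) +
        \<zeta> (snd p) * ((6 * \<bar>ln (norm (fst p)) - y0\<bar> / (T - snd p) + 30) / R))" if p: "p \<in> S" for p
  proof -
    define y where "y = ln (norm (fst p))"
    define t where "t = snd p"
    define q where "q = fst p \<bullet> e / norm (fst p)"
    have t: "T - t > 0" using p by (simp add: S_def t_def)
    \<comment> \<open>\<open>|z|\<^sup>2\<close> times the backward operator applied to the kernel,
      divided by the kernel.\<close>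
    define B where "B = hyy y t + (hy y t)\<^sup>2 + (N - 2) * hy y t + (k t)\<^sup>2 * (1 - q\<^sup>2) - (N - 1) * k t * q + ht y t + k' t * q"
    have B: "B \<le> 0"
    proof -
      define \<tau> where "\<tau> = T - t"
      have \<tau>: "\<tau> > 0" using t by (simp add: \<tau>_def)
      define X where "X = (1 - q) / (2 * \<tau>)"
      have q: "q = 1 - 2 * \<tau> * X" using \<tau> by (simp add: X_def)
      \<comment> \<open>The Gaussian part cancels exactly. In the angular part the powers of
        \<open>1 / \<tau>\<close> cancel, and the term \<open>(N - 1)\<^sup>2 / 4 * \<tau>\<close>
        of the exponent is what completes \<open>X\<^sup>2 - (N - 1) * X\<close> to a
        square.\<close>
      have "B = - \<theta> * (X - (N - 1) / 2)\<^sup>2"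
        using \<tau> \<theta> unfolding B_def hyy_def hy_def ht_def k_def k'_def \<tau>_def[symmetric] a_def q
        by (elim disjE) (simp_all add: field_simps power2_eq_square)
      thus ?thesis using \<theta> by auto
    qed
    define err where "err = - (y - y0) / (T - t) * c1 y + c2 y"
    have "heat_op fxx ft p = exp (k t * q) / (norm (fst p))\<^sup>2 *
         (gyy y t + (N - 2) * gy y t + g y t * (k t)\<^sup>2 * (1 - q\<^sup>2) - (N - 1) * g y t * k t * q
           + (gt y t + g y t * k' t * q))"
      using op[OF p, of 1] by (simp add: Let_def y_def t_def q_def N_def)
    also have "gyy y t + (N - 2) * gy y t + g y t * (k t)\<^sup>2 * (1 - q\<^sup>2) - (N - 1) * g y t * k t * q
           + (gt y t + g y t * k' t * q) = exp (h y t) * (c y * \<zeta> t * B + \<zeta> t * ((2 * hy y t + (N - 2)) * c1 y + c2 y) + c y * \<zeta>' t)"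
      by (simp add: gyy_def gy_def g_def gt_def B_def algebra_simps)
    \<comment> \<open>The exponential weight in the kernel cancels the drift, so only the Gaussian
      slope multiplies the derivative of the cutoff.\<close>
    also have "2 * hy y t + (N - 2) = - (y - y0) / (T - t)" using t by (simp add: hy_def a_def field_simps)
    finally have eq: "heat_op fxx ft p = backward_kernel \<theta> y0 e T p / (norm (fst p))\<^sup>2 * (c y * \<zeta> t * B + \<zeta> t * err + c y * \<zeta>' t)"
      by (simp add: backward_kernel_def err_def h_def k_def y_def t_def q_def N_def mult_ac)
    have "c y * \<zeta> t * B \<le> 0"
      using B \<zeta>(3)[of t] cutoff_bounds(1)[of "y / R"] by (simp add: c_def mult_nonneg_nonpos)
    moreover have "\<zeta> t * err \<le> \<zeta> t * ((6 * \<bar>y - y0\<bar> / (T - t) + 30) / R)"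
    proof (intro mult_left_mono \<zeta>(3))
      have "- (y - y0) / (T - t) * c1 y \<le> \<bar>- (y - y0) / (T - t) * c1 y\<bar>" by (rule abs_ge_self)
      also have "\<dots> = \<bar>y - y0\<bar> / (T - t) * (\<bar>cutoff1 (y / R)\<bar> / R)"
        using R t by (simp add: c1_def abs_mult abs_minus_commute)
      also have "\<dots> \<le> \<bar>y - y0\<bar> / (T - t) * (6 / R)"
        using R t cutoff_bounds(3)[of "y / R"] by (intro mult_left_mono divide_right_mono) auto
      finally have 1: "- (y - y0) / (T - t) * c1 y \<le> 6 * \<bar>y - y0\<bar> / (T - t) / R" by (simp add: mult_ac)
      have "c2 y \<le> \<bar>cutoff2 (y / R)\<bar> / R\<^sup>2" by (simp add: c2_def divide_right_mono)
      also have "\<dots> \<le> 30 / R\<^sup>2" using cutoff_bounds(4)[of "y / R"] by (intro divide_right_mono) auto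
      also have "\<dots> \<le> 30 / R" using R by (simp add: power2_eq_square field_simps)
      finally show "err \<le> (6 * \<bar>y - y0\<bar> / (T - t) + 30) / R" using 1 by (simp add: err_def add_divide_distrib)
    qed
    ultimately have "c y * \<zeta> t * B + \<zeta> t * err + c y * \<zeta>' t \<le> c y * \<zeta>' t + \<zeta> t * ((6 * \<bar>y - y0\<bar> / (T - t) + 30) / R)"
      by linarith
    thus ?thesis unfolding eq y_def[symmetric] t_def[symmetric] c_def
      by (intro mult_left_mono) (auto simp: backward_kernel_def)
  qed
  thus ?thesis using f unfolding f_eq by blast
qed

section \<open>The complementary error function\<close>

text \<open>The unnormalised tail over Borel sets; translation and splitting of the interval are
  carried out here and transferred to \<open>erfc\<close> by completion.\<close>

definition gauss_tail :: "real \<Rightarrow> real" where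
  "gauss_tail \<xi> = (LINT \<theta>:{\<xi>..}|lborel. exp (- \<theta>\<^sup>2))"

lemma erfc_eq: "erfc \<xi> = 2 / sqrt pi * gauss_tail \<xi>"
  unfolding erfc_def gauss_tail_def set_lebesgue_integral_def
  by (subst integral_completion) auto

lemma integrable_gauss: "integrable lborel (\<lambda>x::real. exp (- x\<^sup>2))"
proof -
  have "has_bochner_integral lborel (\<lambda>x. indicator {0..} x *\<^sub>R exp (- x\<^sup>2 :: real)) (sqrt pi / 2)"
    by (rule gaussian_moment_0)
  from has_bochner_integral_even_function[OF this] show ?thesis by (auto simp: has_bochner_integral_iff)
qed

lemma set_integrable_gauss: "A \<in> sets borel \<Longrightarrow> set_integrable lborel A (\<lambda>x::real. exp (- x\<^sup>2))"
  unfolding set_integrable_def using integrable_gauss by (intro integrable_mult_indicator) auto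

lemma gauss_tail_0: "gauss_tail 0 = sqrt pi / 2"
  using gaussian_moment_0 unfolding gauss_tail_def set_lebesgue_integral_def
  by (rule has_bochner_integral_integral_eq)

lemma gauss_tail_nonneg: "gauss_tail \<xi> \<ge> 0"
  unfolding gauss_tail_def set_lebesgue_integral_def by (intro integral_nonneg_AE) auto

lemma gauss_tail_split:
  assumes "a \<le> b" shows "gauss_tail a = gauss_tail b + integral {a..b} (\<lambda>x. exp (- x\<^sup>2))"
proof -
  have "gauss_tail a = (LINT x|lborel. indicator {a..<b} x *\<^sub>R exp (- x\<^sup>2) + indicator {b..} x *\<^sub>R exp (- x\<^sup>2))"
    unfolding gauss_tail_def set_lebesgue_integral_def
    using assms by (intro Bochner_Integration.integral_cong refl) (auto simp: indicator_def)
  also have "\<dots> = (LINT x:{a..<b}|lborel. exp (- x\<^sup>2)) + gauss_tail b"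
    unfolding gauss_tail_def set_lebesgue_integral_def
    using set_integrable_gauss[of "{a..<b}"] set_integrable_gauss[of "{b..}"]
    by (intro Bochner_Integration.integral_add) (auto simp: set_integrable_def)
  also have "(LINT x:{a..<b}|lborel. exp (- x\<^sup>2)) = (LINT x:{a..b}|lborel. exp (- x\<^sup>2))"
    unfolding set_lebesgue_integral_def
  proof (rule integral_cong_AE)
    show "AE x in lborel. indicator {a..<b} x *\<^sub>R exp (- x\<^sup>2) = indicator {a..b} x *\<^sub>R exp (- x\<^sup>2)"
      using AE_lborel_singleton[of b] by eventually_elim (auto simp: indicator_def)
  qed auto
  also have "\<dots> = integral {a..b} (\<lambda>x. exp (- x\<^sup>2))"
    by (rule set_borel_integral_eq_integral(2)[OF set_integrable_gauss]) simp
  finally show ?thesis by simp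
qed

lemma gauss_tail_deriv: "(gauss_tail has_real_derivative - exp (- \<xi>\<^sup>2)) (at \<xi>)"
proof -
  have "((\<lambda>x. integral {\<xi> - 1..x} (\<lambda>x. exp (- x\<^sup>2))) has_real_derivative exp (- \<xi>\<^sup>2)) (at \<xi> within {\<xi> - 1..\<xi> + 1})"
    by (rule integral_has_real_derivative) (auto intro!: continuous_intros)
  moreover have "at \<xi> within {\<xi> - 1..\<xi> + 1} = at \<xi>" by (rule at_within_interior) auto
  ultimately have "((\<lambda>x. integral {\<xi> - 1..x} (\<lambda>x. exp (- x\<^sup>2))) has_real_derivative exp (- \<xi>\<^sup>2)) (at \<xi>)"
    by simp
  hence "((\<lambda>x. gauss_tail (\<xi> - 1) - integral {\<xi> - 1..x} (\<lambda>x. exp (- x\<^sup>2))) has_real_derivative 0 - exp (- \<xi>\<^sup>2)) (at \<xi>)"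
    by (intro DERIV_diff DERIV_const)
  hence "(gauss_tail has_real_derivative 0 - exp (- \<xi>\<^sup>2)) (at \<xi>)"
  proof (rule has_field_derivative_transform_within_open[of _ _ _ "{\<xi> - 1<..}"])
    fix x assume "x \<in> {\<xi> - 1<..}"
    hence "\<xi> - 1 \<le> x" by simp
    thus "gauss_tail (\<xi> - 1) - integral {\<xi> - 1..x} (\<lambda>x. exp (- x\<^sup>2)) = gauss_tail x"
      using gauss_tail_split by simp
  qed auto
  thus ?thesis by simp
qed

lemma erfc_deriv: "(erfc has_real_derivative - 2 / sqrt pi * exp (- \<xi>\<^sup>2)) (at \<xi>)"
  using DERIV_cmult[OF gauss_tail_deriv, of "2 / sqrt pi" \<xi>] by (simp add: erfc_eq[abs_def])

lemma erfc_continuous: "continuous_on A erfc"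
  by (meson DERIV_isCont continuous_at_imp_continuous_on erfc_deriv)

lemma erfc_nonneg: "erfc \<xi> \<ge> 0"
  by (simp add: erfc_eq gauss_tail_nonneg)

lemma erfc_0: "erfc 0 = 1"
  by (simp add: erfc_eq gauss_tail_0)

text \<open>\<open>erfc x + erfc (- x)\<close> has derivative 0, and its value at 0 is 2.\<close>

lemma erfc_minus: "erfc (- \<xi>) = 2 - erfc \<xi>"
proof -
  have "((\<lambda>x. erfc x + erfc (- x)) has_real_derivative 0) (at x)" for x
  proof -
    have "((\<lambda>x. erfc (- x)) has_real_derivative (- 2 / sqrt pi * exp (- (- x)\<^sup>2)) * (- 1)) (at x)"
      by (intro DERIV_chain2[OF erfc_deriv]) (auto intro!: derivative_eq_intros)
    from DERIV_add[OF erfc_deriv[of x] this] show ?thesis by simp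
  qed
  hence "erfc \<xi> + erfc (- \<xi>) = erfc 0 + erfc (- 0)"
    using DERIV_isconst_all[of "\<lambda>x. erfc x + erfc (- x)" \<xi> 0] by blast
  thus ?thesis by (simp add: erfc_0)
qed

lemma erfc_le_2: "erfc \<xi> \<le> 2"
  using erfc_nonneg[of "- \<xi>"] by (simp add: erfc_minus)

text \<open>After a shift by \<open>\<xi>\<close>, use
  \<open>(\<xi> + x)\<^sup>2 \<ge> \<xi>\<^sup>2 + x\<^sup>2\<close> for nonnegative
  \<open>x\<close>; the remaining half Gaussian integral cancels the normalisation.\<close>

lemma erfc_le_gauss:
  assumes "\<xi> \<ge> 0" shows "erfc \<xi> \<le> exp (- \<xi>\<^sup>2)"
proof -
  have "gauss_tail \<xi> = (LINT x|lborel. indicator {\<xi>..} (\<xi> + x) *\<^sub>R exp (- (\<xi> + x)\<^sup>2))"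
    unfolding gauss_tail_def set_lebesgue_integral_def
    by (rule lborel_integral_shift[symmetric]) measurable
  also have "\<dots> = (LINT x|lborel. indicator {0..} x *\<^sub>R exp (- (\<xi> + x)\<^sup>2))"
    by (intro Bochner_Integration.integral_cong refl) (auto simp: indicator_def)
  also have "\<dots> \<le> (LINT x|lborel. exp (- \<xi>\<^sup>2) * (indicator {0..} x *\<^sub>R exp (- x\<^sup>2)))"
  proof (rule integral_mono')
    show "integrable lborel (\<lambda>x::real. exp (- \<xi>\<^sup>2) * (indicator {0..} x *\<^sub>R exp (- x\<^sup>2)))"
      using set_integrable_gauss[of "{0..}"] by (intro integrable_mult_right) (auto simp: set_integrable_def)
    fix x :: real
    show "indicator {0..} x *\<^sub>R exp (- (\<xi> + x)\<^sup>2) \<le> exp (- \<xi>\<^sup>2) * (indicator {0..} x *\<^sub>R exp (- x\<^sup>2))"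
    proof (cases "x \<ge> 0")
      case True
      have "- (\<xi> + x)\<^sup>2 \<le> - \<xi>\<^sup>2 + - x\<^sup>2" using True assms by (simp add: power2_sum)
      hence "exp (- (\<xi> + x)\<^sup>2) \<le> exp (- \<xi>\<^sup>2 + - x\<^sup>2)" by simp
      thus ?thesis using True by (simp only: exp_add indicator_simps) (simp add: True)
    qed simp
  qed auto
  also have "\<dots> = exp (- \<xi>\<^sup>2) * gauss_tail 0"
    unfolding gauss_tail_def set_lebesgue_integral_def by simp
  finally have "gauss_tail \<xi> \<le> exp (- \<xi>\<^sup>2) * (sqrt pi / 2)" by (simp add: gauss_tail_0)
  thus ?thesis by (simp add: erfc_eq divide_simps mult.commute)
qed

lemma erfc_at_top: "(erfc \<longlongrightarrow> 0) at_top"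
proof (rule tendsto_sandwich[of "\<lambda>_. 0" _ _ "\<lambda>x. exp (- x)"])
  have "erfc x \<le> exp (- x)" if "x \<ge> 1" for x
  proof -
    have "erfc x \<le> exp (- x\<^sup>2)" using that by (intro erfc_le_gauss) auto
    also have "\<dots> \<le> exp (- x)" using that by (simp add: power2_eq_square)
    finally show ?thesis .
  qed
  thus "\<forall>\<^sub>F x in at_top. erfc x \<le> exp (- x)" by (auto simp: eventually_at_top_linorder)
  show "((\<lambda>x::real. exp (- x)) \<longlongrightarrow> 0) at_top"
    by (rule filterlim_compose[OF exp_at_bot filterlim_uminus_at_bot_at_top])
qed (auto simp: erfc_nonneg)

lemma erfc_at_bot: "(erfc \<longlongrightarrow> 2) at_bot"
proof -
  have "((\<lambda>x. 2 - erfc (- x)) \<longlongrightarrow> 2 - 0) at_bot"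
    by (intro tendsto_intros filterlim_compose[OF erfc_at_top filterlim_uminus_at_top_at_bot])
  thus ?thesis by (simp add: erfc_minus)
qed

text \<open>In the logarithmic variable \<open>E\<close> is \<open>erfc\<close> of the similarity
  variable of the heat equation on the line, transported by the drift \<open>N - 2\<close>. Being
  radial, it is covered by the polar formula with exponent \<open>k = 0\<close>.\<close>

lemma E_C21:
  "\<exists>ex exx et. C21 (Qstar :: ('a::euclidean_space \<times> real) set) (\<lambda>p. c * E (fst p) (snd p)) ex exx et \<and>
     (\<forall>p\<in>Qstar. heat_op exx (\<lambda>p. - et p) p = 0)"
proof -
  define N where "N = real DIM('a)"
  define arg where "arg = (\<lambda>y t. (y + (N - 2) * t) / (2 * sqrt t))"
  define d where "d = (\<lambda>y t. - 2 / sqrt pi * exp (- (arg y t)\<^sup>2))"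
  define g where "g = (\<lambda>y t. c * erfc (arg y t))"
  define gy where "gy = (\<lambda>y t. c * (d y t * (1 / (2 * sqrt t))))"
  define gyy where "gyy = (\<lambda>y t. c * (d y t * (- 2 * arg y t * (1 / (2 * sqrt t))) * (1 / (2 * sqrt t))))"
  define argt where "argt = (\<lambda>y t. - y / (4 * t * sqrt t) + (N - 2) / (4 * sqrt t))"
  define gt where "gt = (\<lambda>y t. c * (d y t * argt y t))"
  \<comment> \<open>Any unit vector will do, since with \<open>k = 0\<close> the angle drops
    out.\<close>
  obtain e :: 'a where e: "e \<in> Basis" using nonempty_Basis by blast
  have dy: "((\<lambda>y. arg y t) has_real_derivative 1 / (2 * sqrt t)) (at y)" if "t > 0" for t y
    unfolding arg_def by (rule DERIV_cdivide) (auto intro!: derivative_eq_intros)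
  have dt: "((\<lambda>t. arg y t) has_real_derivative argt y t) (at t)" if t: "t > 0" for t y
  proof -
    have "((\<lambda>t. (y + (N - 2) * t) / (2 * sqrt t)) has_real_derivative
       ((N - 2) * (2 * sqrt t) - (y + (N - 2) * t) * (2 * (inverse (sqrt t) / 2))) / ((2 * sqrt t) * (2 * sqrt t))) (at t)"
      using t by (intro DERIV_divide DERIV_cmult DERIV_real_sqrt) (auto intro!: derivative_eq_intros)
    moreover have "((N - 2) * (2 * sqrt t) - (y + (N - 2) * t) * (2 * (inverse (sqrt t) / 2))) / ((2 * sqrt t) * (2 * sqrt t)) = argt y t"
    proof -
      define s where "s = sqrt t"
      have s: "s > 0" "t = s * s" using t by (auto simp: s_def)
      show ?thesis using s(1) unfolding argt_def s_def[symmetric] s(2)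
        by (simp add: field_simps)
    qed
    ultimately show ?thesis unfolding arg_def by simp
  qed
  let ?D = "UNIV \<times> {0<..} :: (real \<times> real) set"
  have ac: "continuous_on ?D (\<lambda>p. arg (fst p) (snd p))" "continuous_on ?D (\<lambda>p. argt (fst p) (snd p))"
    unfolding arg_def argt_def by (auto intro!: continuous_intros)
  have dcont: "continuous_on ?D (\<lambda>p. d (fst p) (snd p))"
    unfolding d_def by (intro continuous_intros ac)
  have sc: "continuous_on ?D (\<lambda>p. 1 / (2 * sqrt (snd p)))"
    by (auto intro!: continuous_intros)
  define S where "S = {p :: 'a \<times> real. fst p \<noteq> 0 \<and> snd p \<in> {0<..}}"
  have "\<exists>fx fxx ft. C21 S (\<lambda>p. g (ln (norm (fst p))) (snd p) * exp ((\<lambda>_. 0) (snd p) * (fst p \<bullet> e / norm (fst p)))) fx fxx ft \<and>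
    (\<forall>p\<in>S. \<forall>\<sigma>. heat_op fxx (\<lambda>p. \<sigma> * ft p) p =
       (let y = ln (norm (fst p)); t = snd p; q = fst p \<bullet> e / norm (fst p); N = real DIM('a) in
        exp ((\<lambda>_. 0) t * q) / (norm (fst p))\<^sup>2 *
         (gyy y t + (N - 2) * gy y t + g y t * ((\<lambda>_. 0) t)\<^sup>2 * (1 - q\<^sup>2) - (N - 1) * g y t * (\<lambda>_. 0) t * q
           + \<sigma> * (gt y t + g y t * (\<lambda>_. 0) t * q))))"
    unfolding S_def
  proof (rule C21_log_polar)
    fix y t :: real assume t: "t \<in> {0<..}"
    show "((\<lambda>y. g y t) has_real_derivative gy y t) (at y)"
      unfolding g_def gy_def d_def using t by (intro DERIV_cmult DERIV_chain2[OF erfc_deriv] dy) auto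
    have "((\<lambda>y. - (arg y t)\<^sup>2) has_real_derivative - 2 * arg y t * (1 / (2 * sqrt t))) (at y)"
      using DERIV_minus[OF DERIV_power[OF dy[of t y], of 2]] t by simp
    from DERIV_cmult[OF DERIV_chain2[OF DERIV_exp this], of "- 2 / sqrt pi"]
    have dd: "((\<lambda>y. d y t) has_real_derivative d y t * (- 2 * arg y t * (1 / (2 * sqrt t)))) (at y)"
      unfolding d_def by (simp add: mult_ac)
    show "((\<lambda>y. gy y t) has_real_derivative gyy y t) (at y)"
      unfolding gy_def gyy_def by (intro DERIV_cmult DERIV_cmult_right dd)
    show "((\<lambda>t. g y t) has_real_derivative gt y t) (at t)"
      unfolding g_def gt_def d_def using t by (intro DERIV_cmult DERIV_chain2[OF erfc_deriv] dt) auto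
    show "((\<lambda>_. 0) has_real_derivative (\<lambda>_. 0) t) (at t)" by simp
  next
    have ec: "continuous_on ?D (\<lambda>p. erfc (arg (fst p) (snd p)))"
      by (rule continuous_on_compose2[OF erfc_continuous[of UNIV] ac(1)]) simp
    show "continuous_on ?D (\<lambda>(y, t). g y t)" "continuous_on ?D (\<lambda>(y, t). gy y t)"
      "continuous_on ?D (\<lambda>(y, t). gyy y t)" "continuous_on ?D (\<lambda>(y, t). gt y t)"
      unfolding g_def gy_def gyy_def gt_def case_prod_unfold
      by (intro continuous_on_mult continuous_on_const ac dcont sc ec)+
  qed (use e in auto)
  then obtain fx fxx ft where f: "C21 S (\<lambda>p. g (ln (norm (fst p))) (snd p)) fx fxx ft"
    and op: "\<And>p \<sigma>. p \<in> S \<Longrightarrow> heat_op fxx (\<lambda>p. \<sigma> * ft p) p =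
        1 / (norm (fst p))\<^sup>2 * (gyy (ln (norm (fst p))) (snd p) + (N - 2) * gy (ln (norm (fst p))) (snd p) + \<sigma> * gt (ln (norm (fst p))) (snd p))"
    by (auto simp: Let_def N_def)
  have S: "S = Qstar" by (auto simp: S_def Qstar_eq)
  have fE: "g (ln (norm (fst p))) (snd p) = c * E (fst p) (snd p)" if "p \<in> S" for p
    using that by (simp add: S_def g_def E_def arg_def N_def)
  have "heat_op fxx (\<lambda>p. - ft p) p = 0" if p: "p \<in> S" for p
  proof -
    define y where "y = ln (norm (fst p))"
    define s where "s = sqrt (snd p)"
    have s: "s > 0" "snd p = s * s" using p by (auto simp: s_def S_def)
    have "gyy y (snd p) + (N - 2) * gy y (snd p) - gt y (snd p) =
        c * d y (snd p) * (- 2 * arg y (snd p) / (4 * s * s) + (N - 2) / (2 * s) - argt y (snd p))"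
      by (simp add: gyy_def gy_def gt_def s_def[symmetric] algebra_simps)
    also have "- 2 * arg y (snd p) / (4 * s * s) + (N - 2) / (2 * s) - argt y (snd p) = 0"
      using s(1) unfolding arg_def argt_def s_def[symmetric] s(2) by (simp add: field_simps)
    finally show ?thesis using op[OF p, of "- 1"] by (simp add: y_def)
  qed
  moreover have "C21 S (\<lambda>p. c * E (fst p) (snd p)) fx fxx ft"
  proof -
    have op: "open S" unfolding S by (rule open_Qstar)
    have "DD b (\<lambda>p. c * E (fst p) (snd p)) d' p" if "p \<in> S" "DD b (\<lambda>p. g (ln (norm (fst p))) (snd p)) d' p" for b d' p
      using DD_cong_open[OF that(2) op that(1), of "\<lambda>p. c * E (fst p) (snd p)"] fE by blast
    moreover have "continuous_on S (\<lambda>p. c * E (fst p) (snd p))"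
      by (rule continuous_on_eq[of _ "\<lambda>p. g (ln (norm (fst p))) (snd p)"]) (use f fE in \<open>auto simp: C21_def\<close>)
    ultimately show ?thesis using f unfolding C21_def by blast
  qed
  ultimately show ?thesis unfolding S by blast
qed

section \<open>Gaussian bounds for the backward kernels\<close>

lemma neg_square_plus_linear_le:
  fixes D \<tau> b :: real assumes "\<tau> > 0" shows "- D\<^sup>2 / (4 * \<tau>) + b * D \<le> b\<^sup>2 * \<tau>"
proof -
  have "0 \<le> (D - 2 * \<tau> * b)\<^sup>2 / (4 * \<tau>)" using assms by simp
  also have "(D - 2 * \<tau> * b)\<^sup>2 / (4 * \<tau>) = D\<^sup>2 / (4 * \<tau>) - b * D + b\<^sup>2 * \<tau>"
    using assms by (simp add: power2_eq_square field_simps)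
  finally show ?thesis by simp
qed

lemma cos_angle_le_1: "norm e = 1 \<Longrightarrow> \<bar>z \<bullet> e / norm z\<bar> \<le> 1"
  using Cauchy_Schwarz_ineq2[of z e] by (cases "z = 0") auto

lemma backward_kernel_pos: "backward_kernel \<theta> y0 e T p > 0"
  by (simp add: backward_kernel_def)

text \<open>The Gaussian absorbs the drift weight together with \<open>1 + D \<le> exp D\<close>. In
  the angular factor the singular terms \<open>1 / (2 * \<tau>)\<close> combine to
  \<open>- (1 - q) / (2 * \<tau>) \<le> 0\<close>. As \<open>ln (norm z)\<close> is treated as an
  arbitrary real, \<open>z = 0\<close> needs no exception.\<close>

lemma backward_kernel_bounded:
  fixes e :: "'a::euclidean_space"
  assumes \<theta>: "\<theta> = 0 \<or> \<theta> = 1" and e: "norm e = 1" and N: "DIM('a) \<ge> 3" and s: "s < T"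
  shows "\<exists>B\<ge>0. \<forall>z. \<forall>t\<in>{0..s}. backward_kernel \<theta> y0 e T (z, t) * (1 + \<bar>ln (norm z) - y0\<bar>) \<le> B"
proof -
  define N where "N = real DIM('a)"
  define a where "a = (N - 2) / 2"
  have N3: "N \<ge> 3" and a0: "a \<ge> 0" using N by (auto simp: N_def a_def)
  define B where "B = exp ((a + 1)\<^sup>2 * T - 2 * a * y0 + (1/2 + (N - 1) / 2) * \<bar>ln (T - s)\<bar> + (N - 1)\<^sup>2 / 4 * T)"
  have "backward_kernel \<theta> y0 e T (z, t) * (1 + \<bar>ln (norm z) - y0\<bar>) \<le> B" if t: "t \<in> {0..s}" for z t
  proof -
    define \<tau> where "\<tau> = T - t"
    have \<tau>: "\<tau> > 0" "\<tau> \<ge> T - s" "\<tau> \<le> T" using t s by (auto simp: \<tau>_def)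
    define D where "D = \<bar>ln (norm z) - y0\<bar>"
    define q where "q = z \<bullet> e / norm z"
    have q: "q \<le> 1" unfolding q_def by (rule abs_le_D1[OF cos_angle_le_1[OF e]])
    have lnt: "- ln \<tau> \<le> \<bar>ln (T - s)\<bar>" using \<tau> s by (smt (verit) ln_le_cancel_iff)
    have th: "0 \<le> \<theta>" "\<theta> \<le> 1" using \<theta> by auto
    have 1: "- (ln (norm z) - y0)\<^sup>2 / (4 * \<tau>) - a * (y0 + ln (norm z)) + D \<le> (a + 1)\<^sup>2 * T - 2 * a * y0"
    proof -
      have "- D\<^sup>2 / (4 * \<tau>) + (a + 1) * D \<le> (a + 1)\<^sup>2 * \<tau>" by (rule neg_square_plus_linear_le[OF \<tau>(1)])
      also have "\<dots> \<le> (a + 1)\<^sup>2 * T" using \<tau> by (intro mult_left_mono) auto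
      finally have "- D\<^sup>2 / (4 * \<tau>) + (a + 1) * D \<le> (a + 1)\<^sup>2 * T" .
      moreover have "- a * (ln (norm z) - y0) \<le> a * D"
        using a0 mult_left_mono[of "- (ln (norm z) - y0)" D a] by (simp add: D_def algebra_simps)
      ultimately show ?thesis by (simp add: D_def algebra_simps)
    qed
    have 2: "\<theta> * (- (N - 1) / 2 * ln \<tau> + (N - 1)\<^sup>2 / 4 * \<tau> - 1 / (2 * \<tau>)) + \<theta> / (2 * \<tau>) * q
        \<le> (N - 1) / 2 * \<bar>ln (T - s)\<bar> + (N - 1)\<^sup>2 / 4 * T"
    proof -
      have "\<theta> * (- (N - 1) / 2 * ln \<tau> + (N - 1)\<^sup>2 / 4 * \<tau> - 1 / (2 * \<tau>)) + \<theta> / (2 * \<tau>) * q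
          = \<theta> * ((N - 1) / 2 * (- ln \<tau>) + (N - 1)\<^sup>2 / 4 * \<tau> - (1 - q) / (2 * \<tau>))"
        using \<tau> by (simp add: field_simps)
      also have "\<dots> \<le> \<theta> * ((N - 1) / 2 * \<bar>ln (T - s)\<bar> + (N - 1)\<^sup>2 / 4 * T)"
      proof (intro mult_left_mono th)
        have "(N - 1) / 2 * (- ln \<tau>) \<le> (N - 1) / 2 * \<bar>ln (T - s)\<bar>" using lnt N3 by (intro mult_left_mono) auto
        moreover have "(N - 1)\<^sup>2 / 4 * \<tau> \<le> (N - 1)\<^sup>2 / 4 * T" using \<tau> by (intro mult_left_mono) auto
        moreover have "(1 - q) / (2 * \<tau>) \<ge> 0" using q \<tau> by simp
        ultimately show "(N - 1) / 2 * (- ln \<tau>) + (N - 1)\<^sup>2 / 4 * \<tau> - (1 - q) / (2 * \<tau>)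
           \<le> (N - 1) / 2 * \<bar>ln (T - s)\<bar> + (N - 1)\<^sup>2 / 4 * T" by linarith
      qed
      also have "\<dots> \<le> 1 * ((N - 1) / 2 * \<bar>ln (T - s)\<bar> + (N - 1)\<^sup>2 / 4 * T)"
        using \<tau> N3 by (intro mult_right_mono th add_nonneg_nonneg mult_nonneg_nonneg) auto
      finally show ?thesis by simp
    qed
    have "1 + D \<le> exp D" by (rule exp_ge_add_one_self)
    hence "backward_kernel \<theta> y0 e T (z, t) * (1 + D) \<le> backward_kernel \<theta> y0 e T (z, t) * exp D"
      by (intro mult_left_mono) (auto simp: backward_kernel_pos less_imp_le)
    also have "\<dots> = exp (kernel_exponent N \<theta> y0 T (ln (norm z)) t + \<theta> / (2 * \<tau>) * q + D)"
      by (simp add: backward_kernel_def exp_add N_def q_def \<tau>_def)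
    also have "\<dots> \<le> B"
    proof -
      have "kernel_exponent N \<theta> y0 T (ln (norm z)) t + \<theta> / (2 * \<tau>) * q + D =
        (- (ln (norm z) - y0)\<^sup>2 / (4 * \<tau>) - a * (y0 + ln (norm z)) + D) - a\<^sup>2 * \<tau> + 1/2 * (- ln \<tau>)
        + (\<theta> * (- (N - 1) / 2 * ln \<tau> + (N - 1)\<^sup>2 / 4 * \<tau> - 1 / (2 * \<tau>)) + \<theta> / (2 * \<tau>) * q)"
        by (simp add: kernel_exponent_def a_def \<tau>_def)
      also have "\<dots> \<le> ((a + 1)\<^sup>2 * T - 2 * a * y0) - 0 + 1/2 * \<bar>ln (T - s)\<bar> + ((N - 1) / 2 * \<bar>ln (T - s)\<bar> + (N - 1)\<^sup>2 / 4 * T)"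
        using \<tau> by (intro add_mono diff_mono 1 2 mult_left_mono lnt) auto
      finally show ?thesis unfolding B_def by (simp add: algebra_simps)
    qed
    finally show ?thesis by (simp add: D_def)
  qed
  moreover have "B \<ge> 0" by (simp add: B_def)
  ultimately show ?thesis by blast
qed

section \<open>Monotonicity in time\<close>

text \<open>A piecewise quadratic C^1 transition from 0 to 1 on the unit interval; its derivative is
  the function \<open>tent\<close> of total mass 1.\<close>

definition smooth_step :: "real \<Rightarrow> real" where
  "smooth_step x = 2 * (max 0 x)\<^sup>2 - 4 * (max 0 (x - 1/2))\<^sup>2 + 2 * (max 0 (x - 1))\<^sup>2"

definition tent :: "real \<Rightarrow> real" where
  "tent x = 4 * max 0 x - 8 * max 0 (x - 1/2) + 4 * max 0 (x - 1)"

lemma smooth_step_deriv: "(smooth_step has_real_derivative tent x) (at x)"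
proof -
  have s: "((\<lambda>x. (max 0 (x - c))\<^sup>2) has_real_derivative 2 * max 0 (x - c)) (at x)" for c
  proof -
    have "((\<lambda>x. (max 0 (x - c))\<^sup>2) has_real_derivative 2 * max 0 (x - c) * 1) (at x)"
      by (rule DERIV_chain2[where f="\<lambda>x. (max 0 x)\<^sup>2", OF max_0_square_deriv]) (auto intro!: derivative_eq_intros)
    thus ?thesis by simp
  qed
  have "((\<lambda>x. 2 * (max 0 (x - 0))\<^sup>2 - 4 * (max 0 (x - 1/2))\<^sup>2 + 2 * (max 0 (x - 1))\<^sup>2) has_real_derivative
     2 * (2 * max 0 (x - 0)) - 4 * (2 * max 0 (x - 1/2)) + 2 * (2 * max 0 (x - 1))) (at x)"
    by (intro DERIV_add DERIV_diff DERIV_cmult s)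
  thus ?thesis by (simp add: smooth_step_def[abs_def] tent_def)
qed

lemma tent_nonneg: "tent x \<ge> 0" by (auto simp: tent_def max_def)
lemma tent_eq_0: "x \<le> 0 \<or> x \<ge> 1 \<Longrightarrow> tent x = 0" by (auto simp: tent_def max_def)
lemma tent_continuous: "continuous_on A tent" unfolding tent_def[abs_def] by (intro continuous_intros)
lemma smooth_step_mono: "x \<le> y \<Longrightarrow> smooth_step x \<le> smooth_step y"
  by (rule DERIV_nonneg_imp_nondecreasing) (use smooth_step_deriv tent_nonneg in blast)+
lemma smooth_step_0: "x \<le> 0 \<Longrightarrow> smooth_step x = 0" by (simp add: smooth_step_def)
lemma smooth_step_1: "x \<ge> 1 \<Longrightarrow> smooth_step x = 1"
  by (simp add: smooth_step_def max_def power2_eq_square algebra_simps)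

text \<open>Otherwise \<open>G = F - c * t\<close> gains \<open>4 * \<eta>\<close> over the
  interval. A trapezoid \<open>\<zeta>\<close> rises only near \<open>s1\<close>, where
  \<open>G - m \<le> - \<eta>\<close>, and falls only near \<open>s2\<close>, where
  \<open>G - m \<ge> 0\<close>, so the tested integral would be at most
  \<open>- \<eta>\<close>.\<close>

lemma weak_derivative_le_imp_le:
  fixes F :: "real \<Rightarrow> real"
  assumes s: "s1 < s2" and F: "continuous_on {s1..s2} F"
    and weak: "\<And>\<zeta> \<zeta>'. (\<And>t. (\<zeta> has_real_derivative \<zeta>' t) (at t)) \<Longrightarrow> continuous_on UNIV \<zeta>' \<Longrightarrow> (\<And>t. \<zeta> t \<ge> 0) \<Longrightarrow>
        (\<And>t. t \<notin> {s1..s2} \<Longrightarrow> \<zeta> t = 0) \<Longrightarrow> 0 \<le> integral {s1..s2} (\<lambda>t. \<zeta>' t * F t + c * \<zeta> t)"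
  shows "F s2 \<le> F s1 + c * (s2 - s1)"
proof (rule ccontr)
  assume neg: "\<not> F s2 \<le> F s1 + c * (s2 - s1)"
  define G where "G = (\<lambda>t. F t - c * t)"
  have Gc: "continuous_on {s1..s2} G" unfolding G_def by (intro continuous_intros F)
  define \<eta> where "\<eta> = (G s2 - G s1) / 4"
  define m where "m = (G s1 + G s2) / 2"
  have \<eta>: "\<eta> > 0" using neg by (simp add: \<eta>_def G_def algebra_simps)
  have near: "\<exists>d>0. \<forall>t\<in>{s1..s2}. \<bar>t - s\<bar> < d \<longrightarrow> \<bar>G t - G s\<bar> < \<eta>" if "s \<in> {s1..s2}" for s
    using Gc that \<eta> unfolding continuous_on_iff dist_real_def by blast
  obtain d1 where d1: "d1 > 0" "\<And>t. t \<in> {s1..s2} \<Longrightarrow> \<bar>t - s1\<bar> < d1 \<Longrightarrow> \<bar>G t - G s1\<bar> < \<eta>"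
    using near[of s1] s by auto
  obtain d2 where d2: "d2 > 0" "\<And>t. t \<in> {s1..s2} \<Longrightarrow> \<bar>t - s2\<bar> < d2 \<Longrightarrow> \<bar>G t - G s2\<bar> < \<eta>"
    using near[of s2] s by auto
  define h where "h = min (min d1 d2) (s2 - s1) / 3"
  have h: "h > 0" "h < d1" "h < d2" "h < s2 - s1" using d1 d2 s by (auto simp: h_def min_def)
  define \<zeta> where "\<zeta> = (\<lambda>t. smooth_step ((t - s1) / h) - smooth_step ((t - s2) / h + 1))"
  define \<zeta>' where "\<zeta>' = (\<lambda>t. tent ((t - s1) / h) * (1 / h) - tent ((t - s2) / h + 1) * (1 / h))"
  have l: "((\<lambda>t. (t - b) / h + a) has_real_derivative 1 / h) (at t)" for a b t
    using h by (auto intro!: derivative_eq_intros)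
  have D1: "((\<lambda>t. smooth_step ((t - s1) / h)) has_real_derivative tent ((t - s1) / h) * (1 / h)) (at t)" for t
    using DERIV_chain2[OF smooth_step_deriv l[of s1 0 t]] by simp
  have D2: "((\<lambda>t. smooth_step ((t - s2) / h + 1)) has_real_derivative tent ((t - s2) / h + 1) * (1 / h)) (at t)" for t
    by (rule DERIV_chain2[OF smooth_step_deriv l])
  have D: "(\<zeta> has_real_derivative \<zeta>' t) (at t)" for t
    unfolding \<zeta>_def \<zeta>'_def by (intro DERIV_diff D1 D2)
  have tc: "continuous_on A (\<lambda>t. tent ((t - s1) / h))" "continuous_on A (\<lambda>t. tent ((t - s2) / h + 1))" for A
    using h by (auto intro!: continuous_on_compose2[OF tent_continuous[of UNIV]] continuous_intros)
  have \<zeta>'c: "continuous_on A \<zeta>'" for A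
    unfolding \<zeta>'_def by (intro continuous_on_diff continuous_on_mult_right tc)
  have \<zeta>c: "continuous_on A \<zeta>" for A
    using D by (meson DERIV_isCont continuous_at_imp_continuous_on)
  have out: "\<zeta> t = 0" if "t \<notin> {s1<..<s2}" for t
  proof (cases "t \<le> s1")
    case True
    thus ?thesis using h by (simp add: \<zeta>_def smooth_step_0 divide_simps)
  next
    case False
    hence "t \<ge> s2" using that by simp
    thus ?thesis using h s by (simp add: \<zeta>_def smooth_step_1 divide_simps)
  qed
  have nonneg: "\<zeta> t \<ge> 0" for t
    \<comment> \<open>The falling ramp starts after the rising one because
      \<open>h < s2 - s1\<close>; monotonicity of the step does the rest.\<close>
    unfolding \<zeta>_def using h by (simp add: divide_simps smooth_step_mono)
  have 0: "0 \<le> integral {s1..s2} (\<lambda>t. \<zeta>' t * F t + c * \<zeta> t)"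
    using D \<zeta>'c nonneg out by (intro weak) auto
  \<comment> \<open>The derivative of \<open>\<zeta> t * (c * t + m)\<close> integrates to 0;
    subtracting it turns the tested integrand into \<open>\<zeta>' t * (G t - m)\<close>.\<close>
  have I0: "((\<lambda>t. \<zeta>' t * (c * t + m) + c * \<zeta> t) has_integral \<zeta> s2 * (c * s2 + m) - \<zeta> s1 * (c * s1 + m)) {s1..s2}"
  proof (rule fundamental_theorem_of_calculus)
    fix t assume "t \<in> {s1..s2}"
    have "((\<lambda>t. \<zeta> t * (c * t + m)) has_real_derivative \<zeta>' t * (c * t + m) + c * \<zeta> t) (at t)"
      by (auto intro!: derivative_eq_intros D)
    thus "((\<lambda>t. \<zeta> t * (c * t + m)) has_vector_derivative \<zeta>' t * (c * t + m) + c * \<zeta> t) (at t within {s1..s2})"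
      by (meson has_real_derivative_iff_has_vector_derivative has_vector_derivative_at_within)
  qed (use s in simp)
  have I1: "((\<lambda>t. - \<eta> * (tent ((t - s1) / h) * (1 / h))) has_integral
      - \<eta> * smooth_step ((s2 - s1) / h) - (- \<eta> * smooth_step ((s1 - s1) / h))) {s1..s2}"
  proof (rule fundamental_theorem_of_calculus)
    fix t assume "t \<in> {s1..s2}"
    show "((\<lambda>t. - \<eta> * smooth_step ((t - s1) / h)) has_vector_derivative - \<eta> * (tent ((t - s1) / h) * (1 / h))) (at t within {s1..s2})"
      using DERIV_cmult[OF D1, of "- \<eta>" t]
      by (meson has_real_derivative_iff_has_vector_derivative has_vector_derivative_at_within)
  qed (use s in simp)
  have "integral {s1..s2} (\<lambda>t. \<zeta>' t * F t + c * \<zeta> t) - 0 =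
      integral {s1..s2} (\<lambda>t. (\<zeta>' t * F t + c * \<zeta> t) - (\<zeta>' t * (c * t + m) + c * \<zeta> t))"
  proof -
    have "integral {s1..s2} (\<lambda>t. \<zeta>' t * (c * t + m) + c * \<zeta> t) = 0"
      using integral_unique[OF I0] out[of s1] out[of s2] by simp
    moreover have "(\<lambda>t. \<zeta>' t * F t + c * \<zeta> t) integrable_on {s1..s2}"
      by (intro integrable_continuous_real continuous_intros F \<zeta>c \<zeta>'c)
    ultimately show ?thesis
      using has_integral_integrable[OF I0] by (simp only: Henstock_Kurzweil_Integration.integral_diff)
  qed
  also have "\<dots> \<le> integral {s1..s2} (\<lambda>t. - \<eta> * (tent ((t - s1) / h) * (1 / h)))"
  proof (rule integral_le)
    show "(\<lambda>t. (\<zeta>' t * F t + c * \<zeta> t) - (\<zeta>' t * (c * t + m) + c * \<zeta> t)) integrable_on {s1..s2}"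
      by (intro integrable_continuous_real continuous_intros F \<zeta>c \<zeta>'c)
    show "(\<lambda>t. - \<eta> * (tent ((t - s1) / h) * (1 / h))) integrable_on {s1..s2}" using I1 by blast
    fix t assume t: "t \<in> {s1..s2}"
    have e: "(\<zeta>' t * F t + c * \<zeta> t) - (\<zeta>' t * (c * t + m) + c * \<zeta> t) = \<zeta>' t * (G t - m)"
      by (simp add: G_def algebra_simps)
    define A where "A = tent ((t - s1) / h) * (1 / h)"
    define B where "B = tent ((t - s2) / h + 1) * (1 / h)"
    have AB: "A \<ge> 0" "B \<ge> 0" using h tent_nonneg by (auto simp: A_def B_def)
    have "A * (G t - m) \<le> A * (- \<eta>)"
    proof (cases "t - s1 < h")
      case True
      hence "\<bar>G t - G s1\<bar> < \<eta>" using d1(2)[OF t] h t by auto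
      hence "G t < G s1 + \<eta>" by linarith
      hence "G t - m \<le> - \<eta>" by (simp add: m_def \<eta>_def field_simps)
      thus ?thesis using AB by (intro mult_left_mono) auto
    next
      case False
      hence "A = 0" using h by (simp add: A_def tent_eq_0 divide_simps)
      thus ?thesis by simp
    qed
    moreover have "B * (G t - m) \<ge> 0"
    proof (cases "s2 - t < h")
      case True
      hence "\<bar>G t - G s2\<bar> < \<eta>" using d2(2)[OF t] h t by auto
      hence "G t > G s2 - \<eta>" by linarith
      hence "G t - m \<ge> 0" using \<eta> by (simp add: m_def \<eta>_def field_simps)
      thus ?thesis using AB by simp
    next
      case False
      hence "B = 0" using h by (simp add: B_def tent_eq_0 divide_simps)
      thus ?thesis by simp
    qed
    ultimately show "(\<zeta>' t * F t + c * \<zeta> t) - (\<zeta>' t * (c * t + m) + c * \<zeta> t) \<le> - \<eta> * (tent ((t - s1) / h) * (1 / h))"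
      unfolding e unfolding \<zeta>'_def A_def[symmetric] B_def[symmetric] by (simp add: algebra_simps)
  qed
  also have "\<dots> = - \<eta>"
    using integral_unique[OF I1] h s by (simp add: smooth_step_0 smooth_step_1 divide_simps)
  finally show False using 0 \<eta> by simp
qed

section \<open>The weighted space \<open>L12\<close> and its pairings with bounded functions\<close>

lemma L12_integrable: "h \<in> L12 \<Longrightarrow> integrable lebesgue (\<lambda>x. h x / (norm x)\<^sup>2)"
proof -
  assume h: "h \<in> L12"
  have [measurable]: "(\<lambda>x::'a. (norm x)\<^sup>2) \<in> borel_measurable lebesgue"
    by (intro measurable_completion) simp
  from h have [measurable]: "h \<in> borel_measurable lebesgue" by (simp add: L12_def)
  have "integrable lebesgue (\<lambda>x. norm (h x / (norm x)\<^sup>2))" using h by (simp add: L12_def)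
  thus "integrable lebesgue (\<lambda>x. h x / (norm x)\<^sup>2)"
    by (subst (asm) integrable_norm_iff) auto
qed

lemma L12_diff: "g \<in> L12 \<Longrightarrow> h \<in> L12 \<Longrightarrow> (\<lambda>x. g x - h x) \<in> L12"
proof -
  assume gh: "g \<in> L12" "h \<in> L12"
  have "integrable lebesgue (\<lambda>x. norm (g x / (norm x)\<^sup>2 - h x / (norm x)\<^sup>2))"
    using L12_integrable gh by (intro integrable_norm Bochner_Integration.integrable_diff) auto
  moreover have "(\<lambda>x. norm (g x / (norm x)\<^sup>2 - h x / (norm x)\<^sup>2)) = (\<lambda>x. \<bar>g x - h x\<bar> / (norm x)\<^sup>2)"
    by (simp add: diff_divide_distrib[symmetric])
  moreover have "(\<lambda>x. g x - h x) \<in> borel_measurable lebesgue"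
    using gh by (intro borel_measurable_diff) (auto simp: L12_def)
  ultimately show ?thesis by (simp add: L12_def)
qed

lemma L12_abs: "h \<in> L12 \<Longrightarrow> (\<lambda>x. \<bar>h x\<bar>) \<in> L12"
  by (auto simp: L12_def intro: borel_measurable_abs)

lemma integrable_bounded_mult:
  fixes h g :: "'b \<Rightarrow> real"
  assumes "integrable M h" "g \<in> borel_measurable M" "\<And>x. \<bar>g x\<bar> \<le> B"
  shows "integrable M (\<lambda>x. h x * g x)"
proof (rule Bochner_Integration.integrable_bound[of _ "\<lambda>x. B * h x"])
  show "AE x in M. norm (h x * g x) \<le> norm (B * h x)"
  proof (rule AE_I2)
    fix x
    have "\<bar>h x\<bar> * \<bar>g x\<bar> \<le> \<bar>h x\<bar> * \<bar>B\<bar>" using assms(3)[of x] by (intro mult_left_mono) auto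
    thus "norm (h x * g x) \<le> norm (B * h x)" by (simp add: abs_mult mult.commute)
  qed
qed (use assms in auto)

text \<open>The change of \<open>g n\<close> is handled by dominated convergence with
  \<open>h0\<close> held fixed, the change of \<open>h n\<close> by the norm and the bound
  \<open>B\<close>.\<close>

lemma weighted_integral_tendsto:
  fixes h :: "nat \<Rightarrow> 'a::euclidean_space \<Rightarrow> real"
  assumes h: "\<And>n. h n \<in> L12" "h0 \<in> L12" "(\<lambda>n. L12_norm (\<lambda>x. h n x - h0 x)) \<longlonglongrightarrow> 0"
    and g: "\<And>n. g n \<in> borel_measurable lebesgue" "g0 \<in> borel_measurable lebesgue"
      "\<And>n x. \<bar>g n x\<bar> \<le> B" "\<And>x. x \<noteq> 0 \<Longrightarrow> (\<lambda>n. g n x) \<longlonglongrightarrow> g0 x"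
  shows "(\<lambda>n. LINT x|lebesgue. h n x / (norm x)\<^sup>2 * g n x) \<longlonglongrightarrow> (LINT x|lebesgue. h0 x / (norm x)\<^sup>2 * g0 x)"
proof -
  have B: "B \<ge> 0" using g(3)[of 0 0] by linarith
  note hi = L12_integrable[OF h(1)] L12_integrable[OF h(2)]
  have d: "integrable lebesgue (\<lambda>x. \<bar>h n x - h0 x\<bar> / (norm x)\<^sup>2)" for n
    using L12_diff[OF h(1)[of n] h(2)] by (simp add: L12_def)
  have "(\<lambda>n. LINT x|lebesgue. h0 x / (norm x)\<^sup>2 * g n x) \<longlonglongrightarrow> (LINT x|lebesgue. h0 x / (norm x)\<^sup>2 * g0 x)"
  proof (rule integral_dominated_convergence[where w="\<lambda>x. \<bar>h0 x / (norm x)\<^sup>2\<bar> * B"])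
    show "AE x in lebesgue. (\<lambda>n. h0 x / (norm x)\<^sup>2 * g n x) \<longlonglongrightarrow> h0 x / (norm x)\<^sup>2 * g0 x"
    proof (rule AE_I2)
      fix x :: 'a
      \<comment> \<open>At \<open>x = 0\<close> the quotient by 0 is 0, so the limit holds there
        whatever \<open>g n\<close> does.\<close>
      show "(\<lambda>n. h0 x / (norm x)\<^sup>2 * g n x) \<longlonglongrightarrow> h0 x / (norm x)\<^sup>2 * g0 x"
        using g(4)[of x] by (cases "x = 0") (auto intro!: tendsto_intros)
    qed
    show "AE x in lebesgue. norm (h0 x / (norm x)\<^sup>2 * g n x) \<le> \<bar>h0 x / (norm x)\<^sup>2\<bar> * B" for n
      unfolding real_norm_def abs_mult by (intro AE_I2 mult_left_mono g(3) abs_ge_zero)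
  qed (intro borel_measurable_times borel_measurable_integrable[OF hi(2)] g integrable_mult_left integrable_abs[OF hi(2)])+
  moreover have "(\<lambda>n. (LINT x|lebesgue. h n x / (norm x)\<^sup>2 * g n x) - (LINT x|lebesgue. h0 x / (norm x)\<^sup>2 * g n x)) \<longlonglongrightarrow> 0"
  proof (rule Lim_null_comparison)
    show "\<forall>\<^sub>F n in sequentially. norm ((LINT x|lebesgue. h n x / (norm x)\<^sup>2 * g n x) - (LINT x|lebesgue. h0 x / (norm x)\<^sup>2 * g n x))
        \<le> B * L12_norm (\<lambda>x. h n x - h0 x)"
    proof (intro always_eventually allI)
      fix n
      have i1: "integrable lebesgue (\<lambda>x. h n x / (norm x)\<^sup>2 * g n x)" and i2: "integrable lebesgue (\<lambda>x. h0 x / (norm x)\<^sup>2 * g n x)"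
        by (rule integrable_bounded_mult[where B=B, OF hi(1) g(1) g(3)])
           (rule integrable_bounded_mult[where B=B, OF hi(2) g(1) g(3)])
      have "norm ((LINT x|lebesgue. h n x / (norm x)\<^sup>2 * g n x) - (LINT x|lebesgue. h0 x / (norm x)\<^sup>2 * g n x))
        = norm (LINT x|lebesgue. h n x / (norm x)\<^sup>2 * g n x - h0 x / (norm x)\<^sup>2 * g n x)"
        using i1 i2 by (simp add: Bochner_Integration.integral_diff)
      also have "\<dots> \<le> (LINT x|lebesgue. norm (h n x / (norm x)\<^sup>2 * g n x - h0 x / (norm x)\<^sup>2 * g n x))"
        by (rule integral_norm_bound)
      also have "\<dots> \<le> (LINT x|lebesgue. B * (\<bar>h n x - h0 x\<bar> / (norm x)\<^sup>2))"
      proof (rule integral_mono)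
        fix x
        have "h n x / (norm x)\<^sup>2 * g n x - h0 x / (norm x)\<^sup>2 * g n x = (h n x - h0 x) / (norm x)\<^sup>2 * g n x"
          by (simp add: diff_divide_distrib left_diff_distrib)
        hence "norm (h n x / (norm x)\<^sup>2 * g n x - h0 x / (norm x)\<^sup>2 * g n x) = \<bar>h n x - h0 x\<bar> / (norm x)\<^sup>2 * \<bar>g n x\<bar>"
          by (simp add: abs_mult)
        also have "\<dots> \<le> \<bar>h n x - h0 x\<bar> / (norm x)\<^sup>2 * B" using g(3) by (intro mult_left_mono) auto
        finally show "norm (h n x / (norm x)\<^sup>2 * g n x - h0 x / (norm x)\<^sup>2 * g n x) \<le> B * (\<bar>h n x - h0 x\<bar> / (norm x)\<^sup>2)"
          by (simp only: mult.commute)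
      qed (intro integrable_mult_right d integrable_norm Bochner_Integration.integrable_diff i1 i2)+
      also have "\<dots> = B * L12_norm (\<lambda>x. h n x - h0 x)"
        unfolding L12_norm_def by (rule integral_mult_right_zero)
      finally show "norm ((LINT x|lebesgue. h n x / (norm x)\<^sup>2 * g n x) - (LINT x|lebesgue. h0 x / (norm x)\<^sup>2 * g n x))
        \<le> B * L12_norm (\<lambda>x. h n x - h0 x)" .
    qed
    show "(\<lambda>n. B * L12_norm (\<lambda>x. h n x - h0 x)) \<longlonglongrightarrow> 0"
      using tendsto_mult_right_zero[OF h(3)] by simp
  qed
  ultimately show ?thesis using tendsto_add by fastforce
qed

lemma continuous_in_L12_sequentially:
  assumes "continuous_in_L12 f" "\<And>n. t n \<ge> 0" "s \<ge> 0" "t \<longlonglongrightarrow> s"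
  shows "(\<lambda>n. L12_norm (\<lambda>x. f (t n) x - f s x)) \<longlonglongrightarrow> 0"
proof -
  have c: "((\<lambda>t. L12_norm (\<lambda>x. f t x - f s x)) \<longlongrightarrow> 0) (at s within {0..})"
    using assms by (simp add: continuous_in_L12_def)
  have "continuous (at s within {0..}) (\<lambda>t. L12_norm (\<lambda>x. f t x - f s x))"
    unfolding continuous_within using c by (simp add: L12_norm_def)
  from continuous_within_tendsto_compose[OF this _ assms(4)] assms(2)
  show ?thesis by (simp add: L12_norm_def)
qed

lemma backward_kernel_measurable[measurable]:
  "(\<lambda>x. backward_kernel \<theta> y0 e T (x, t)) \<in> borel_measurable borel"
  unfolding backward_kernel_def kernel_exponent_def fst_conv snd_conv by measurable

lemma cutoff_measurable[measurable]: "cutoff \<in> borel_measurable borel"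
  using cutoff_continuous(1) by (rule borel_measurable_continuous_onI)

lemma borel_imp_lebesgue: "f \<in> borel_measurable borel \<Longrightarrow> f \<in> borel_measurable lebesgue"
  by (intro measurable_completion) simp

text \<open>\<open>W\<close> is a Borel version of the space-time function of the curve \<open>f\<close>.\<close>

locale L12_subsolution =
  fixes f :: "real \<Rightarrow> 'a::euclidean_space \<Rightarrow> real" and W :: "'a \<times> real \<Rightarrow> real"
  assumes dim: "DIM('a) \<ge> 3"
    and f_nonneg: "\<And>t x. f t x \<ge> 0"
    and f_cont: "continuous_in_L12 f"
    and W_borel[measurable]: "W \<in> borel_measurable borel"
    and W_eq: "AE p in lborel. p \<in> Qstar \<longrightarrow> W p = f (snd p) (fst p)"
    and W_int: "\<And>K. compact K \<Longrightarrow> K \<subseteq> Qstar \<Longrightarrow> integrable lborel (\<lambda>p. indicator K p * W p)"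
    and W_sub: "\<And>S K \<phi> \<phi>x \<phi>xx \<phi>t. open S \<Longrightarrow> S \<subseteq> Qstar \<Longrightarrow> compact K \<Longrightarrow> K \<subseteq> S \<Longrightarrow> C21 S \<phi> \<phi>x \<phi>xx \<phi>t \<Longrightarrow>
       (\<And>p. p \<in> S - K \<Longrightarrow> \<phi> p = 0) \<Longrightarrow> (\<And>p. p \<in> K \<Longrightarrow> \<phi> p \<ge> 0) \<Longrightarrow>
       0 \<le> (LINT p|lborel. indicator K p * (W p * heat_op \<phi>xx \<phi>t p))"
begin

lemma f_L12: "t \<ge> 0 \<Longrightarrow> f t \<in> L12"
  using f_cont by (simp add: continuous_in_L12_def)

lemma f_meas: "t \<ge> 0 \<Longrightarrow> f t \<in> borel_measurable lebesgue"
  using f_L12 by (simp add: L12_def)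

lemma L12_norm_bounded: "\<exists>M\<ge>0. \<forall>t\<in>{0..s}. L12_norm (f t) \<le> M"
proof -
  have "continuous_on {0..s} (\<lambda>t. L12_norm (f t))"
    unfolding continuous_on_sequentially comp_def
  proof (intro allI ballI impI, elim conjE)
    fix t :: "nat \<Rightarrow> real" and r assume r: "r \<in> {0..s}" "\<forall>n. t n \<in> {0..s}" "t \<longlonglongrightarrow> r"
    have "(\<lambda>n. LINT x|lebesgue. f (t n) x / (norm x)\<^sup>2 * 1) \<longlonglongrightarrow> (LINT x|lebesgue. f r x / (norm x)\<^sup>2 * 1)"
      using r by (intro weighted_integral_tendsto[where B=1] f_L12 continuous_in_L12_sequentially[OF f_cont]) auto
    thus "(\<lambda>n. L12_norm (f (t n))) \<longlonglongrightarrow> L12_norm (f r)" by (simp add: L12_norm_def f_nonneg)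
  qed
  hence "bounded ((\<lambda>t. L12_norm (f t)) ` {0..s})"
    by (intro compact_imp_bounded compact_continuous_image) auto
  then obtain M where "\<forall>t\<in>{0..s}. \<bar>L12_norm (f t)\<bar> \<le> M" by (auto simp: bounded_iff)
  hence "\<forall>t\<in>{0..s}. L12_norm (f t) \<le> max M 0" by fastforce
  thus ?thesis by (metis max.cobounded2)
qed

text \<open>Fubini for null sets, with the variables exchanged. \<open>W\<close> agrees with
  \<open>f\<close> only almost everywhere in space-time, whereas pairings are taken at a fixed
  time.\<close>

lemma AE_slice: "AE t in lborel. t > 0 \<longrightarrow> (AE x in lborel. W (x, t) = f t x)"
proof -
  obtain X where X: "X \<in> null_sets lborel" "{p. \<not> (p \<in> Qstar \<longrightarrow> W p = f (snd p) (fst p))} \<subseteq> X"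
    using W_eq by (auto simp: eventually_ae_filter)
  have Xb: "X \<in> sets (lborel \<Otimes>\<^sub>M lborel)" unfolding lborel_prod using X(1) by (simp add: null_sets_def)
  have "AE p in (lborel \<Otimes>\<^sub>M lborel). p \<notin> X"
    using X(1) unfolding lborel_prod by (rule AE_not_in)
  hence "AE x in lborel. AE t in lborel. (x, t) \<notin> X"
    by (rule lborel_pair.AE_pair)
  hence "AE t in lborel. AE x in lborel. (x, t) \<notin> X"
    using lborel_pair.AE_commute[of "\<lambda>x t. (x, t) \<notin> X"] Xb sets.compl_sets[OF Xb]
    by (simp add: space_pair_measure Collect_neg_eq set_diff_eq)
  thus ?thesis
  proof eventually_elim
    case (elim t)
    show ?case
    proof
      assume t: "t > 0"
      show "AE x in lborel. W (x, t) = f t x"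
        using elim AE_lborel_singleton[of "0 :: 'a"]
      proof eventually_elim
        case (elim x)
        hence "(x, t) \<in> Qstar" using t by (simp add: Qstar_eq)
        thus ?case using X(2) elim by fastforce
      qed
    qed
  qed
qed

context
  fixes \<theta> y0 T :: real and e :: 'a
  assumes \<theta>: "\<theta> = 0 \<or> \<theta> = 1" and e: "norm e = 1"
begin

definition pairing :: "real \<Rightarrow> real" where
  "pairing t = (LINT x|lebesgue. f t x / (norm x)\<^sup>2 * backward_kernel \<theta> y0 e T (x, t))"

definition cut_pairing :: "real \<Rightarrow> real \<Rightarrow> real" where
  "cut_pairing R t = (LINT x|lebesgue. f t x / (norm x)\<^sup>2 * (backward_kernel \<theta> y0 e T (x, t) * cutoff (ln (norm x) / R)))"

lemma cut_kernel_measurable: "(\<lambda>x. backward_kernel \<theta> y0 e T (x, t) * cutoff (ln (norm x) / R)) \<in> borel_measurable lebesgue"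
  by (intro borel_imp_lebesgue) measurable

lemma kernel_le: "\<exists>B\<ge>0. \<forall>z. \<forall>t\<in>{0..s}. backward_kernel \<theta> y0 e T (z, t) \<le> B \<and>
    backward_kernel \<theta> y0 e T (z, t) * \<bar>ln (norm z) - y0\<bar> \<le> B" if s: "s < T"
proof -
  obtain B where B: "B \<ge> 0" "\<And>z t. t \<in> {0..s} \<Longrightarrow> backward_kernel \<theta> y0 e T (z, t) * (1 + \<bar>ln (norm z) - y0\<bar>) \<le> B"
    using backward_kernel_bounded[OF \<theta> e dim s, of y0] by blast
  have "backward_kernel \<theta> y0 e T (z, t) \<le> B \<and> backward_kernel \<theta> y0 e T (z, t) * \<bar>ln (norm z) - y0\<bar> \<le> B"
    if "t \<in> {0..s}" for z t
  proof -
    have p: "backward_kernel \<theta> y0 e T (z, t) \<ge> 0" using backward_kernel_pos less_imp_le by blast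
    hence "0 \<le> backward_kernel \<theta> y0 e T (z, t) * \<bar>ln (norm z) - y0\<bar>" by simp
    thus ?thesis using B(2)[OF that, of z] p unfolding distrib_left by linarith
  qed
  thus ?thesis using B(1) by blast
qed

lemma cut_kernel_bound:
  assumes "backward_kernel \<theta> y0 e T (x, t) \<le> B"
  shows "\<bar>backward_kernel \<theta> y0 e T (x, t) * cutoff s\<bar> \<le> B"
proof -
  have "0 \<le> backward_kernel \<theta> y0 e T (x, t)" using backward_kernel_pos less_imp_le by blast
  hence "backward_kernel \<theta> y0 e T (x, t) * cutoff s \<le> B * 1"
    using assms cutoff_bounds by (intro mult_mono) auto
  thus ?thesis using \<open>0 \<le> backward_kernel \<theta> y0 e T (x, t)\<close> cutoff_bounds(1)[of s] by simp
qed

lemma cut_pairing_continuous: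
  assumes s: "s < T" shows "continuous_on {0..s} (cut_pairing R)"
  unfolding continuous_on_sequentially comp_def
proof (intro allI ballI impI, elim conjE)
  fix t :: "nat \<Rightarrow> real" and r assume r: "r \<in> {0..s}" "\<forall>n. t n \<in> {0..s}" "t \<longlonglongrightarrow> r"
  obtain B where B: "B \<ge> 0" "\<And>z t. t \<in> {0..s} \<Longrightarrow> backward_kernel \<theta> y0 e T (z, t) \<le> B"
    using kernel_le[OF s] by blast
  show "(\<lambda>n. cut_pairing R (t n)) \<longlonglongrightarrow> cut_pairing R r"
    unfolding cut_pairing_def
  proof (rule weighted_integral_tendsto[where B=B])
    show "f (t n) \<in> L12" "f r \<in> L12" for n using r f_L12 by auto
    show "(\<lambda>n. L12_norm (\<lambda>x. f (t n) x - f r x)) \<longlonglongrightarrow> 0"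
      using r by (intro continuous_in_L12_sequentially[OF f_cont]) auto
    show "\<bar>backward_kernel \<theta> y0 e T (x, t n) * cutoff (ln (norm x) / R)\<bar> \<le> B" for n x
      using r by (intro cut_kernel_bound B) auto
    show "(\<lambda>n. backward_kernel \<theta> y0 e T (x, t n) * cutoff (ln (norm x) / R))
        \<longlonglongrightarrow> backward_kernel \<theta> y0 e T (x, r) * cutoff (ln (norm x) / R)" for x
      unfolding backward_kernel_def kernel_exponent_def fst_conv snd_conv
      using r s by (intro tendsto_intros) auto
  qed (rule cut_kernel_measurable)+
qed

lemma cut_pairing_tendsto:
  assumes s: "s < T" and t: "t \<in> {0..s}"
  shows "(\<lambda>n. cut_pairing (real (Suc n)) t) \<longlonglongrightarrow> pairing t"
proof -
  obtain B where B: "B \<ge> 0" "\<And>z t. t \<in> {0..s} \<Longrightarrow> backward_kernel \<theta> y0 e T (z, t) \<le> B"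
    using kernel_le[OF s] by blast
  show ?thesis
    unfolding cut_pairing_def pairing_def
  proof (rule weighted_integral_tendsto[where B=B])
    show "(\<lambda>n. L12_norm (\<lambda>x. f t x - f t x)) \<longlonglongrightarrow> 0" by (simp add: L12_norm_def)
    show "\<bar>backward_kernel \<theta> y0 e T (x, t) * cutoff (ln (norm x) / real (Suc n))\<bar> \<le> B" for n x
      using t by (intro cut_kernel_bound B)
    show "(\<lambda>n. backward_kernel \<theta> y0 e T (x, t) * cutoff (ln (norm x) / real (Suc n))) \<longlonglongrightarrow> backward_kernel \<theta> y0 e T (x, t)" for x
    proof -
      have "(\<lambda>n. ln (norm x) * (1 / real (Suc n))) \<longlonglongrightarrow> ln (norm x) * 0"
        by (intro tendsto_intros LIMSEQ_Suc[OF lim_1_over_n])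
      hence "(\<lambda>n. ln (norm x) / real (Suc n)) \<longlonglongrightarrow> 0" by simp
      moreover have "isCont cutoff 0" using cutoff_deriv by (rule DERIV_isCont)
      ultimately have "(\<lambda>n. cutoff (ln (norm x) / real (Suc n))) \<longlonglongrightarrow> cutoff 0"
        by (rule isCont_tendsto_compose[rotated])
      hence "(\<lambda>n. backward_kernel \<theta> y0 e T (x, t) * cutoff (ln (norm x) / real (Suc n))) \<longlonglongrightarrow> backward_kernel \<theta> y0 e T (x, t) * cutoff 0"
        by (intro tendsto_mult tendsto_const)
      thus ?thesis by (simp add: cutoff_def)
    qed
    show "(\<lambda>x. backward_kernel \<theta> y0 e T (x, t)) \<in> borel_measurable lebesgue"
      by (intro borel_imp_lebesgue) measurable
  qed (use t f_L12 cut_kernel_measurable in auto)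
qed

text \<open>The subsolution property is tested with kernel times cutoff times \<open>\<zeta>\<close>
  and sliced in time. The outcome says that the derivative of \<open>cut_pairing R\<close> is at
  most \<open>c\<close> in the weak sense, with \<open>c\<close> of order \<open>1 / R\<close>. The
  interval stays at positive times so that the support lies in \<open>Qstar\<close>.\<close>

lemma cut_pairing_weak:
  assumes s: "0 < s1" "s1 < s2" "s2 < T" and R: "R \<ge> 1"
    and B: "B \<ge> 0" "\<And>z t. t \<in> {0..s2} \<Longrightarrow> backward_kernel \<theta> y0 e T (z, t) \<le> B \<and>
       backward_kernel \<theta> y0 e T (z, t) * \<bar>ln (norm z) - y0\<bar> \<le> B"
    and M: "M \<ge> 0" "\<And>t. t \<in> {0..s2} \<Longrightarrow> L12_norm (f t) \<le> M"
    and \<zeta>: "\<And>t. (\<zeta> has_real_derivative \<zeta>' t) (at t)" "continuous_on UNIV \<zeta>'" "\<And>t. \<zeta> t \<ge> 0"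
      "\<And>t. t \<notin> {s1..s2} \<Longrightarrow> \<zeta> t = 0"
  defines "c \<equiv> B * (6 / (T - s2) + 30) * M / R"
  shows "0 \<le> integral {s1..s2} (\<lambda>t. \<zeta>' t * cut_pairing R t + c * \<zeta> t)"
proof -
  define S where "S = {p :: 'a \<times> real. fst p \<noteq> 0 \<and> snd p \<in> {0<..<T}}"
  \<comment> \<open>Away from the origin, the cutoff in \<open>ln |z|\<close> is supported in this
    closed annulus.\<close>
  define A where "A = {z :: 'a. exp (- R) \<le> norm z \<and> norm z \<le> exp R}"
  define K where "K = A \<times> {s1..s2}"
  have A: "compact A"
  proof -
    have "A = cball 0 (exp R) \<inter> {z. exp (- R) \<le> norm z}" by (auto simp: A_def)
    moreover have "closed {z :: 'a. exp (- R) \<le> norm z}" by (intro closed_Collect_le continuous_intros)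
    ultimately show ?thesis by (simp add: compact_Int_closed)
  qed
  have Ab[measurable]: "A \<in> sets borel" using A by (rule borel_compact)
  have A0: "z \<noteq> 0" if "z \<in> A" for z
  proof -
    have "norm z \<ge> exp (- R)" using that by (simp add: A_def)
    thus ?thesis using exp_gt_zero[of "- R"] by auto
  qed
  have Aout: "cutoff (ln (norm z) / R) = 0" if "z \<notin> A" "z \<noteq> 0" for z
  proof -
    have "\<bar>ln (norm z)\<bar> \<ge> R"
    proof (cases "exp (- R) \<le> norm z")
      case True
      hence "norm z > exp R" using that by (simp add: A_def)
      hence "ln (norm z) > R" using that by (metis exp_gt_zero ln_exp ln_less_cancel_iff zero_less_norm_iff)
      thus ?thesis by simp
    next
      case False
      hence "ln (norm z) < - R" using that by (metis exp_gt_zero ln_exp ln_less_cancel_iff zero_less_norm_iff not_le)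
      thus ?thesis using R by simp
    qed
    thus ?thesis using R by (intro cutoff_eq_0) (simp add: divide_simps)
  qed
  have K: "compact K" unfolding K_def by (intro compact_Times A compact_Icc)
  have KS: "K \<subseteq> S" "S \<subseteq> Qstar" using s A0 by (auto simp: K_def S_def Qstar_eq)
  have opS: "open S"
  proof -
    have "S = Qstar \<inter> {p. snd p < T}" by (auto simp: S_def Qstar_eq)
    moreover have "open {p :: 'a \<times> real. snd p < T}" by (intro open_Collect_less continuous_intros)
    ultimately show ?thesis using open_Qstar by auto
  qed
  define \<Psi> where "\<Psi> = backward_kernel \<theta> y0 e T"
  have \<Psi>pos: "\<Psi> p \<ge> 0" for p unfolding \<Psi>_def using backward_kernel_pos less_imp_le by blast
  define Y where "Y = (\<lambda>p :: 'a \<times> real. ln (norm (fst p)))"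
  obtain \<phi>x \<phi>xx \<phi>t where \<phi>: "C21 S (\<lambda>p. \<Psi> p * (cutoff (Y p / R) * \<zeta> (snd p))) \<phi>x \<phi>xx \<phi>t"
    and op: "\<And>p. p \<in> S \<Longrightarrow> heat_op \<phi>xx \<phi>t p \<le> \<Psi> p / (norm (fst p))\<^sup>2 *
       (cutoff (Y p / R) * \<zeta>' (snd p) + \<zeta> (snd p) * ((6 * \<bar>Y p - y0\<bar> / (T - snd p) + 30) / R))"
    using backward_kernel_test_function[OF \<theta> e R \<zeta>(1-3), of T y0] unfolding S_def Y_def \<Psi>_def by blast
  have sub: "0 \<le> (LINT p|lborel. indicator K p * (W p * heat_op \<phi>xx \<phi>t p))"
  proof (rule W_sub[OF opS KS(2) K KS(1) \<phi>])
    fix p assume "p \<in> S - K"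
    thus "\<Psi> p * (cutoff (Y p / R) * \<zeta> (snd p)) = 0"
      using Aout[of "fst p"] \<zeta>(4)[of "snd p"] by (cases p) (auto simp: K_def S_def Y_def)
  qed (auto intro!: mult_nonneg_nonneg \<Psi>pos cutoff_bounds \<zeta>(3))
  have Wi: "integrable lborel (\<lambda>p. indicator K p * W p)" using K KS by (intro W_int) auto
  have cK: "continuous_on K g" if "continuous_on S g" for g :: "'a \<times> real \<Rightarrow> real"
    using that KS(1) by (rule continuous_on_subset)
  have mult: "integrable lborel (\<lambda>p. indicator K p * (W p * g p))" if g: "continuous_on K g" for g :: "'a \<times> real \<Rightarrow> real"
  proof -
    have gm: "(\<lambda>p. indicator K p * g p) \<in> borel_measurable lborel"
      using integrable_indicator_compact[OF K g] by (rule borel_measurable_integrable)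
    obtain D where D: "\<And>p. p \<in> K \<Longrightarrow> \<bar>g p\<bar> \<le> D"
      using compact_imp_bounded[OF compact_continuous_image[OF g K]] by (auto simp: bounded_iff)
    have "integrable lborel (\<lambda>p. (indicator K p * W p) * (indicator K p * g p))"
    proof (rule integrable_bounded_mult[OF Wi gm])
      show "\<bar>indicator K p * g p\<bar> \<le> \<bar>D\<bar>" for p using D[of p] by (cases "p \<in> K") auto
    qed
    thus ?thesis by (rule back_subst[of "integrable lborel"]) (auto simp: indicator_def)
  qed
  have Kne: "fst p \<noteq> 0" "snd p \<in> {s1..s2}" "0 < T - snd p" if "p \<in> K" for p
    using that A0 s by (auto simp: K_def)
  have nK: "continuous_on K (\<lambda>p. 1 / (norm (fst p))\<^sup>2)"
    using Kne by (intro continuous_intros) auto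
  have YK: "continuous_on K Y" unfolding Y_def using Kne by (intro continuous_intros) auto
  have \<Psi>K: "continuous_on K \<Psi>"
    unfolding \<Psi>_def backward_kernel_def kernel_exponent_def using Kne
    by (intro continuous_intros ballI) fastforce+
  have cutK: "continuous_on K (\<lambda>p. cutoff (Y p / R))"
    using R by (intro continuous_on_compose2[OF cutoff_continuous(1)[of UNIV]] continuous_intros YK) auto
  have \<zeta>K: "continuous_on K (\<lambda>p. \<zeta> (snd p))" "continuous_on K (\<lambda>p. \<zeta>' (snd p))"
  proof -
    have "continuous_on UNIV \<zeta>" using \<zeta>(1) by (meson DERIV_isCont continuous_at_imp_continuous_on)
    thus "continuous_on K (\<lambda>p. \<zeta> (snd p))"
      by (rule continuous_on_compose2[OF _ continuous_on_snd[OF continuous_on_id]]) auto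
    show "continuous_on K (\<lambda>p. \<zeta>' (snd p))"
      by (rule continuous_on_compose2[OF \<zeta>(2) continuous_on_snd[OF continuous_on_id]]) auto
  qed
  define C1 where "C1 = B * (6 / (T - s2) + 30) / R"
  have C1: "C1 \<ge> 0" using B(1) R s by (simp add: C1_def)
  \<comment> \<open>\<open>P\<close> carries \<open>\<zeta>'\<close> and integrates to the cut
    pairing. \<open>Q\<close> collects the cutoff error, with the bounded kernel already replaced by
    a constant, and is controlled by the norm of \<open>f\<close>.\<close>
  define P where "P = (\<lambda>p. indicator K p * (W p * (1 / (norm (fst p))\<^sup>2 * (\<Psi> p * cutoff (Y p / R)) * \<zeta>' (snd p))))"
  define Q where "Q = (\<lambda>p. indicator K p * (W p * (1 / (norm (fst p))\<^sup>2 * \<zeta> (snd p))))"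
  have Pi: "integrable lborel P" unfolding P_def by (intro mult continuous_on_mult nK \<Psi>K cutK \<zeta>K)
  have Qi: "integrable lborel Q" unfolding Q_def by (intro mult continuous_on_mult nK \<zeta>K)
  have hK: "continuous_on K (heat_op \<phi>xx \<phi>t)"
    using \<phi> unfolding heat_op_def C21_def S_def[symmetric] by (intro cK continuous_intros) (auto simp: S_def)
  have "0 \<le> (LINT p|lborel. indicator K p * (W p * heat_op \<phi>xx \<phi>t p))" by (rule sub)
  also have "\<dots> \<le> (LINT p|lborel. P p + C1 * Q p)"
  proof (rule integral_mono_AE)
    show "integrable lborel (\<lambda>p. indicator K p * (W p * heat_op \<phi>xx \<phi>t p))" by (rule mult[OF hK])
    show "integrable lborel (\<lambda>p. P p + C1 * Q p)" using Pi Qi by auto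
    show "AE p in lborel. indicator K p * (W p * heat_op \<phi>xx \<phi>t p) \<le> P p + C1 * Q p"
      using W_eq
    proof eventually_elim
      case (elim p)
      show ?case
      proof (cases "p \<in> K")
        case True
        \<comment> \<open>The sign of \<open>W\<close> permits multiplying the one-sided estimate of
          \<open>heat_op\<close>.\<close>
        have Wp: "W p \<ge> 0" using elim True KS f_nonneg by auto
        have pS: "p \<in> S" using True KS by auto
        have t: "snd p \<in> {0..s2}" "snd p \<le> s2" using Kne(2)[OF True] s by auto
        have "\<Psi> p * ((6 * \<bar>Y p - y0\<bar> / (T - snd p) + 30) / R) \<le> C1"
        proof -
          have "\<Psi> p * \<bar>Y p - y0\<bar> * (6 / (T - snd p)) \<le> B * (6 / (T - s2))"
            using B(2)[OF t(1), of "fst p"] B(1) s t by (intro mult_mono frac_le) (auto simp: \<Psi>_def Y_def)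
          moreover have "\<Psi> p * 30 \<le> B * 30" using B(2)[OF t(1), of "fst p"] by (simp add: \<Psi>_def)
          ultimately have "\<Psi> p * (6 * \<bar>Y p - y0\<bar> / (T - snd p) + 30) \<le> B * (6 / (T - s2) + 30)"
            by (simp add: distrib_left mult_ac)
          from divide_right_mono[OF this, of R] R show ?thesis by (simp add: C1_def)
        qed
        hence a: "\<zeta> (snd p) * (\<Psi> p * ((6 * \<bar>Y p - y0\<bar> / (T - snd p) + 30) / R)) \<le> \<zeta> (snd p) * C1"
          by (intro mult_left_mono \<zeta>(3))
        have "heat_op \<phi>xx \<phi>t p \<le> 1 / (norm (fst p))\<^sup>2 * (\<Psi> p * cutoff (Y p / R) * \<zeta>' (snd p) +
            \<zeta> (snd p) * (\<Psi> p * ((6 * \<bar>Y p - y0\<bar> / (T - snd p) + 30) / R)))"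
          by (rule order_trans[OF op[OF pS]], rule eq_refl)
             (simp only: divide_inverse distrib_left distrib_right mult_1_left mult_ac)
        also have "\<dots> \<le> 1 / (norm (fst p))\<^sup>2 * (\<Psi> p * cutoff (Y p / R) * \<zeta>' (snd p) + \<zeta> (snd p) * C1)"
          by (intro mult_left_mono add_left_mono a) auto
        finally have "W p * heat_op \<phi>xx \<phi>t p \<le> W p * (1 / (norm (fst p))\<^sup>2 * (\<Psi> p * cutoff (Y p / R) * \<zeta>' (snd p) + \<zeta> (snd p) * C1))"
          using Wp by (rule mult_left_mono)
        thus ?thesis using True by (simp add: P_def Q_def add_divide_distrib distrib_left mult_ac)
      qed (simp add: P_def Q_def)
    qed
  qed
  also have "\<dots> = (LINT t|lborel. (LINT x|lborel. P (x, t) + C1 * Q (x, t)))"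
  proof -
    have "integrable (lborel \<Otimes>\<^sub>M lborel) (\<lambda>(x, t). P (x, t) + C1 * Q (x, t))"
      using Pi Qi by (simp add: lborel_prod case_prod_unfold)
    from lborel_pair.integral_snd[OF this] show ?thesis by (simp add: lborel_prod case_prod_unfold)
  qed
  also have "\<dots> \<le> (LINT t|lborel. indicator {s1..s2} t * (\<zeta>' t * cut_pairing R t + c * \<zeta> t))"
  proof (rule integral_mono_AE)
    have i: "integrable (lborel \<Otimes>\<^sub>M lborel) (\<lambda>(x, t). P (x, t) + C1 * Q (x, t))"
      using Pi Qi by (simp add: lborel_prod case_prod_unfold)
    show "integrable lborel (\<lambda>t. LINT x|lborel. P (x, t) + C1 * Q (x, t))"
      using lborel_pair.integrable_snd[OF i] by simp
    have "continuous_on {s1..s2} (cut_pairing R)"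
      using s by (intro continuous_on_subset[OF cut_pairing_continuous[of s2]]) auto
    moreover have "continuous_on {s1..s2} \<zeta>" using \<zeta>(1) by (meson DERIV_isCont continuous_at_imp_continuous_on)
    ultimately have cont: "continuous_on {s1..s2} (\<lambda>t. \<zeta>' t * cut_pairing R t + c * \<zeta> t)"
      using continuous_on_subset[OF \<zeta>(2)] by (intro continuous_intros) auto
    show "integrable lborel (\<lambda>t. indicator {s1..s2} t * (\<zeta>' t * cut_pairing R t + c * \<zeta> t))"
      by (rule integrable_indicator_compact[OF compact_Icc cont])
    have iP: "integrable (lborel \<Otimes>\<^sub>M lborel) (\<lambda>(x, t). P (x, t))" and iQ: "integrable (lborel \<Otimes>\<^sub>M lborel) (\<lambda>(x, t). Q (x, t))"
      using Pi Qi by (simp_all add: lborel_prod)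
    show "AE t in lborel. (LINT x|lborel. P (x, t) + C1 * Q (x, t)) \<le> indicator {s1..s2} t * (\<zeta>' t * cut_pairing R t + c * \<zeta> t)"
      using AE_slice lborel_pair.AE_integrable_snd[OF iP] lborel_pair.AE_integrable_snd[OF iQ]
    proof eventually_elim
      case (elim t)
      show ?case
      proof (cases "t \<in> {s1..s2}")
        case False
        hence "(x, t) \<notin> K" for x by (auto simp: K_def)
        thus ?thesis using False by (simp add: P_def Q_def)
      next
        case True
        hence t: "t > 0" "t \<in> {0..s2}" using s by auto
        have W: "AE x in lborel. W (x, t) = f t x" using elim(1) t by simp
        have WL: "AE x in lebesgue. W (x, t) = f t x" using W by (rule AE_completion)
        have iP': "integrable lborel (\<lambda>x. P (x, t))" and iQ': "integrable lborel (\<lambda>x. Q (x, t))" using elim(2,3) by auto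
        have [measurable]: "(\<lambda>x. P (x, t)) \<in> borel_measurable borel" "(\<lambda>x. Q (x, t)) \<in> borel_measurable borel"
          using iP' iQ' by auto
        have fi: "integrable lebesgue (\<lambda>x. f t x / (norm x)\<^sup>2)" using L12_integrable[OF f_L12] t by simp
        have 1: "(LINT x|lborel. P (x, t)) = \<zeta>' t * cut_pairing R t"
        proof -
          have "(LINT x|lborel. P (x, t)) = (LINT x|lebesgue. P (x, t))"
            by (simp add: integral_completion)
          also have "\<dots> = (LINT x|lebesgue. \<zeta>' t * (f t x / (norm x)\<^sup>2 * (\<Psi> (x, t) * cutoff (ln (norm x) / R))))"
          proof (rule integral_cong_AE)
            show "(\<lambda>x. P (x, t)) \<in> borel_measurable lebesgue" by (intro borel_imp_lebesgue) simp
            show "(\<lambda>x. \<zeta>' t * (f t x / (norm x)\<^sup>2 * (\<Psi> (x, t) * cutoff (ln (norm x) / R)))) \<in> borel_measurable lebesgue"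
              unfolding \<Psi>_def
              by (rule borel_measurable_times[OF borel_measurable_const
                    borel_measurable_times[OF borel_measurable_integrable[OF fi] cut_kernel_measurable]])
            show "AE x in lebesgue. P (x, t) = \<zeta>' t * (f t x / (norm x)\<^sup>2 * (\<Psi> (x, t) * cutoff (ln (norm x) / R)))"
              using WL
            proof eventually_elim
              case (elim x)
              \<comment> \<open>Outside \<open>A\<close> the cutoff vanishes, except at
                \<open>x = 0\<close>, where division by 0 makes the right-hand side 0.\<close>
              show ?case using elim Aout[of x] True by (cases "x \<in> A"; cases "x = 0") (auto simp: P_def K_def Y_def)
            qed
          qed
          finally show ?thesis
            unfolding cut_pairing_def \<Psi>_def by (simp only: integral_mult_right_zero)
        qed
        have 2: "(LINT x|lborel. Q (x, t)) \<le> \<zeta> t * M"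
        proof -
          have "(LINT x|lborel. Q (x, t)) = (LINT x|lebesgue. Q (x, t))"
            by (simp add: integral_completion)
          also have "\<dots> \<le> (LINT x|lebesgue. \<zeta> t * (f t x / (norm x)\<^sup>2))"
          proof (rule integral_mono_AE)
            show "integrable lebesgue (\<lambda>x. Q (x, t))" using iQ' by (simp add: integrable_completion)
            show "integrable lebesgue (\<lambda>x. \<zeta> t * (f t x / (norm x)\<^sup>2))" using fi by (intro integrable_mult_right)
            show "AE x in lebesgue. Q (x, t) \<le> \<zeta> t * (f t x / (norm x)\<^sup>2)"
              using WL
            proof eventually_elim
              case (elim x)
              show ?case using elim True \<zeta>(3)[of t] f_nonneg[of t x] by (cases "x \<in> A") (auto simp: Q_def K_def mult.commute)
            qed
          qed
          also have "\<dots> = \<zeta> t * L12_norm (f t)"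
            unfolding L12_norm_def by (simp only: integral_mult_right_zero abs_of_nonneg[OF f_nonneg])
          also have "\<dots> \<le> \<zeta> t * M" using M(2)[OF t(2)] \<zeta>(3) by (intro mult_left_mono)
          finally show ?thesis .
        qed
        have "(LINT x|lborel. P (x, t) + C1 * Q (x, t)) = (LINT x|lborel. P (x, t)) + C1 * (LINT x|lborel. Q (x, t))"
          by (simp only: Bochner_Integration.integral_add[OF iP' integrable_mult_right[OF iQ']] integral_mult_right_zero)
        also have "\<dots> \<le> \<zeta>' t * cut_pairing R t + C1 * (\<zeta> t * M)"
          unfolding 1 using 2 C1 by (intro add_left_mono mult_left_mono)
        finally show ?thesis using True by (simp add: c_def C1_def mult_ac)
      qed
    qed
  qed
  also have "\<dots> = integral {s1..s2} (\<lambda>t. \<zeta>' t * cut_pairing R t + c * \<zeta> t)"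
  proof -
    have "continuous_on {s1..s2} (cut_pairing R)"
      using s by (intro continuous_on_subset[OF cut_pairing_continuous[of s2]]) auto
    moreover have "continuous_on {s1..s2} \<zeta>" using \<zeta>(1) by (meson DERIV_isCont continuous_at_imp_continuous_on)
    ultimately have cont: "continuous_on {s1..s2} (\<lambda>t. \<zeta>' t * cut_pairing R t + c * \<zeta> t)"
      using continuous_on_subset[OF \<zeta>(2)] by (intro continuous_intros) auto
    have "set_integrable lborel {s1..s2} (\<lambda>t. \<zeta>' t * cut_pairing R t + c * \<zeta> t)"
      using integrable_indicator_compact[OF compact_Icc cont] by (simp add: set_integrable_def)
    from set_borel_integral_eq_integral(2)[OF this] show ?thesis by (simp add: set_lebesgue_integral_def)
  qed
  finally show ?thesis .
qed

text \<open>The weak inequality yields the estimate from any positive starting time. Continuity in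
  the weighted norm extends it to \<open>s = 0\<close>, and letting \<open>R\<close> tend to
  infinity removes the cutoff together with the error \<open>c / R\<close>.\<close>

lemma pairing_antimono:
  assumes st: "0 \<le> s" "s < t" "t < T"
  shows "pairing t \<le> pairing s"
proof -
  obtain B where B: "B \<ge> 0" "\<And>z r. r \<in> {0..t} \<Longrightarrow> backward_kernel \<theta> y0 e T (z, r) \<le> B \<and>
       backward_kernel \<theta> y0 e T (z, r) * \<bar>ln (norm z) - y0\<bar> \<le> B"
    using kernel_le[OF st(3)] by blast
  obtain M where M: "M \<ge> 0" "\<And>r. r \<in> {0..t} \<Longrightarrow> L12_norm (f r) \<le> M" using L12_norm_bounded by blast
  define c where "c = B * (6 / (T - t) + 30) * M"
  have step: "cut_pairing R t \<le> cut_pairing R s1 + c / R * (t - s1)" if R: "R \<ge> 1" and s1: "0 < s1" "s1 < t" for R s1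
  proof (rule weak_derivative_le_imp_le[OF s1(2)])
    show "continuous_on {s1..t} (cut_pairing R)"
      using s1 by (intro continuous_on_subset[OF cut_pairing_continuous[OF st(3)]]) auto
    fix \<zeta> \<zeta>' :: "real \<Rightarrow> real"
    assume "\<And>r. (\<zeta> has_real_derivative \<zeta>' r) (at r)" "continuous_on UNIV \<zeta>'" "\<And>r. 0 \<le> \<zeta> r"
      "\<And>r. r \<notin> {s1..t} \<Longrightarrow> \<zeta> r = 0"
    from cut_pairing_weak[OF s1 st(3) R B M this]
    show "0 \<le> integral {s1..t} (\<lambda>t. \<zeta>' t * cut_pairing R t + c / R * \<zeta> t)" by (simp add: c_def)
  qed
  have step0: "cut_pairing R t \<le> cut_pairing R s + c / R * (t - s)" if R: "R \<ge> 1" for R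
  proof -
    \<comment> \<open>The offset 2 in the denominator keeps every \<open>r n\<close> strictly below
      \<open>t\<close>.\<close>
    define r where "r = (\<lambda>n. s + (t - s) * (1 / real (Suc (Suc n))))"
    have r: "s < r n" "r n < t" for n
    proof -
      have "(t - s) * (1 / real (Suc (Suc n))) < (t - s) * 1" using st by (intro mult_strict_left_mono) auto
      thus "s < r n" "r n < t" using st by (auto simp: r_def)
    qed
    have rl: "r \<longlonglongrightarrow> s"
    proof -
      have "(\<lambda>n. s + (t - s) * (1 / real (Suc (Suc n)))) \<longlonglongrightarrow> s + (t - s) * 0"
        by (intro tendsto_intros LIMSEQ_Suc[OF LIMSEQ_Suc[OF lim_1_over_n]])
      thus ?thesis by (simp add: r_def)
    qed
    have "(\<lambda>n. cut_pairing R (r n)) \<longlonglongrightarrow> cut_pairing R s"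
    proof -
      have "s \<in> {0..t}" using st by auto
      moreover have "\<forall>n. r n \<in> {0..t}"
      proof
        show "r n \<in> {0..t}" for n using r[of n] st by auto
      qed
      ultimately show ?thesis
        using cut_pairing_continuous[OF st(3), of R] rl unfolding continuous_on_sequentially comp_def by blast
    qed
    hence "(\<lambda>n. cut_pairing R (r n) + c / R * (t - r n)) \<longlonglongrightarrow> cut_pairing R s + c / R * (t - s)"
      by (intro tendsto_intros rl)
    moreover have "cut_pairing R t \<le> cut_pairing R (r n) + c / R * (t - r n)" for n
      by (rule step[OF R]) (use r[of n] st in linarith)+
    ultimately show ?thesis by (intro LIMSEQ_le_const) auto
  qed
  have "(\<lambda>n. cut_pairing (real (Suc n)) s + c * (1 / real (Suc n)) * (t - s)) \<longlonglongrightarrow> pairing s + c * 0 * (t - s)"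
    using st by (intro tendsto_intros cut_pairing_tendsto[of t] LIMSEQ_Suc[OF lim_1_over_n]) auto
  moreover have "(\<lambda>n. cut_pairing (real (Suc n)) t) \<longlonglongrightarrow> pairing t"
    using st by (intro cut_pairing_tendsto[of t]) auto
  moreover have "cut_pairing (real (Suc n)) t \<le> cut_pairing (real (Suc n)) s + c * (1 / real (Suc n)) * (t - s)" for n
    using step0[of "real (Suc n)"] by simp
  ultimately have "pairing t \<le> pairing s + c * 0 * (t - s)"
    by (intro LIMSEQ_le) auto
  thus ?thesis by simp
qed

end

end

section \<open>Integrability of powers and a covering argument\<close>

text \<open>\<open>f\<close> is dominated by a series of multiples of indicators of balls. Full
  balls instead of disjoint shells are good enough, because the masses form a geometric series
  anyway.\<close>

lemma integrable_shells:
  fixes f :: "'a::euclidean_space \<Rightarrow> real" and r c :: "nat \<Rightarrow> real"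
  assumes [measurable]: "f \<in> borel_measurable borel" and f0: "\<And>x. f x \<ge> 0"
    and shell: "\<And>x. f x \<noteq> 0 \<Longrightarrow> \<exists>n. norm x < r n \<and> f x \<le> c n"
    and c: "\<And>n. c n \<ge> 0" and r: "\<And>n. r n \<ge> 0"
    and b: "0 \<le> b" "b < 1" and le: "\<And>n. c n * r n ^ DIM('a) \<le> C * b ^ n"
  shows "integrable lborel f"
proof -
  define V where "V = unit_ball_vol (real DIM('a))"
  have V: "V \<ge> 0" by (simp add: V_def)
  have C: "C \<ge> 0" 
  proof -
    have "0 \<le> c 0 * r 0 ^ DIM('a)" by (intro mult_nonneg_nonneg zero_le_power c r)
    thus ?thesis using le[of 0] by simp
  qed
  have "(\<integral>\<^sup>+x. ennreal (f x) \<partial>lborel) \<le> (\<integral>\<^sup>+x. (\<Sum>n. ennreal (c n) * indicator (ball (0::'a) (r n)) x) \<partial>lborel)"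
  proof (rule nn_integral_mono)
    fix x :: 'a
    show "ennreal (f x) \<le> (\<Sum>n. ennreal (c n) * indicator (ball 0 (r n)) x)"
    proof (cases "f x = 0")
      case False
      then obtain n where n: "norm x < r n" "f x \<le> c n" using shell by blast
      have "ennreal (f x) \<le> ennreal (c n) * indicator (ball 0 (r n)) x" using n by (simp add: ennreal_leI)
      also have "\<dots> \<le> (\<Sum>n. ennreal (c n) * indicator (ball 0 (r n)) x)"
      proof -
        have "h n \<le> suminf h" for h :: "nat \<Rightarrow> ennreal" using sum_le_suminf[of h "{n}"] by simp
        thus ?thesis .
      qed
      finally show ?thesis .
    qed simp
  qed
  also have "\<dots> = (\<Sum>n. \<integral>\<^sup>+x. ennreal (c n) * indicator (ball (0::'a) (r n)) x \<partial>lborel)"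
    by (rule nn_integral_suminf, intro borel_measurable_times_ennreal borel_measurable_const borel_measurable_indicator) simp
  also have "\<dots> = (\<Sum>n. ennreal (c n) * ennreal (V * r n ^ DIM('a)))"
    by (intro suminf_cong) (simp add: nn_integral_cmult_indicator emeasure_ball r V_def)
  also have "\<dots> \<le> (\<Sum>n. ennreal (V * C * b ^ n))"
  proof (intro suminf_le summableI)
    fix n
    have "c n * (V * r n ^ DIM('a)) \<le> V * C * b ^ n"
      using mult_left_mono[OF le[of n] V] by (simp add: mult_ac)
    thus "ennreal (c n) * ennreal (V * r n ^ DIM('a)) \<le> ennreal (V * C * b ^ n)"
      using c V r by (simp add: ennreal_mult[symmetric] ennreal_leI)
  qed
  also have "\<dots> = ennreal (\<Sum>n. V * C * b ^ n)"
    using b V C by (intro suminf_ennreal2 summable_mult summable_geometric) auto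
  also have "\<dots> < \<infinity>" by simp
  finally show ?thesis
    using f0 by (subst integrable_iff_bounded) simp
qed

lemma integrable_powr_ball:
  assumes p: "0 \<le> p" "p < real DIM('a::euclidean_space)"
  shows "integrable lborel (\<lambda>x::'a. indicator (ball 0 1) x * norm x powr (- p))"
proof -
  define N where "N = real DIM('a)"
  define b where "b = 2 powr (p - N)"
  show ?thesis
  proof (rule integrable_shells[where r="\<lambda>n. 2 powr (- real n)" and c="\<lambda>n. 2 powr (real (Suc n) * p)" and b=b and C="2 powr p"])
    fix x :: 'a
    assume "indicator (ball 0 1) x * norm x powr (- p) \<noteq> 0"
    hence x: "norm x < 1" "norm x > 0" by (auto simp: indicator_def split: if_splits)
    define l where "l = - log 2 (norm x)"
    have l: "l > 0" using x by (simp add: l_def)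
    have nx: "norm x = 2 powr (- l)" using x by (simp add: l_def)
    \<comment> \<open>Gives \<open>n < l \<le> n + 1\<close>; the first inequality is strict because
      \<open>norm x < r n\<close> is.\<close>
    define n where "n = nat (\<lceil>l\<rceil> - 1)"
    have n: "real n < l" "l \<le> real (Suc n)" using l unfolding n_def by linarith+
    have "norm x < 2 powr (- real n)" using n unfolding nx by simp
    moreover have "norm x powr (- p) \<le> 2 powr (real (Suc n) * p)"
      unfolding nx powr_powr using n p by (simp add: mult_right_mono)
    ultimately show "\<exists>n. norm x < 2 powr (- real n) \<and> indicator (ball 0 1) x * norm x powr (- p) \<le> 2 powr (real (Suc n) * p)"
      using x by auto
  next
    fix n
    have "2 powr (real (Suc n) * p) * (2 powr (- real n)) ^ DIM('a) = 2 powr (real (Suc n) * p + (- real n) * N)"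
    proof -
      have "(2 powr (- real n)) ^ DIM('a) = 2 powr ((- real n) * N)" by (simp add: powr_power N_def mult.commute)
      thus ?thesis by (simp only: powr_add)
    qed
    also have "\<dots> = 2 powr (p + (p - N) * real n)" by (simp add: algebra_simps)
    also have "\<dots> = 2 powr p * b ^ n" by (simp only: b_def powr_add) (simp add: powr_power mult.commute)
    finally show "2 powr (real (Suc n) * p) * (2 powr (- real n)) ^ DIM('a) \<le> 2 powr p * b ^ n" by simp
    show "b < 1" using p powr_less_mono[of "p - N" 0 2] by (simp add: b_def N_def)
    show "(\<lambda>x::'a. indicator (ball 0 1) x * norm x powr (- p)) \<in> borel_measurable borel"
      by (intro borel_measurable_times borel_measurable_indicator powr_real_measurable) auto
  qed (auto simp: b_def)
qed

lemma integrable_powr_outside_ball: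
  assumes p: "p > real DIM('a::euclidean_space)"
  shows "integrable lborel (\<lambda>x::'a. indicator (- ball 0 1) x * norm x powr (- p))"
proof -
  define N where "N = real DIM('a)"
  define b where "b = 2 powr (N - p)"
  show ?thesis
  proof (rule integrable_shells[where r="\<lambda>n. 2 powr (real (Suc n))" and c="\<lambda>n. 2 powr (- real n * p)" and b=b and C="2 powr N"])
    fix x :: 'a
    assume "indicator (- ball 0 1) x * norm x powr (- p) \<noteq> 0"
    hence x: "norm x \<ge> 1" "norm x > 0" by (auto simp: indicator_def split: if_splits)
    define l where "l = log 2 (norm x)"
    have l: "l \<ge> 0" using x by (simp add: l_def)
    have nx: "norm x = 2 powr l" using x by (simp add: l_def)
    define n where "n = nat \<lfloor>l\<rfloor>"
    have n: "real n \<le> l" "l < real (Suc n)" using l unfolding n_def by linarith+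
    have p0: "p > 0" using p by (meson of_nat_0_le_iff le_less_trans)
    have "norm x < 2 powr (real (Suc n))" using n unfolding nx by simp
    moreover have "norm x powr (- p) \<le> 2 powr (- real n * p)"
      unfolding nx powr_powr using n p0 by (simp add: mult_right_mono)
    ultimately show "\<exists>n. norm x < 2 powr (real (Suc n)) \<and> indicator (- ball 0 1) x * norm x powr (- p) \<le> 2 powr (- real n * p)"
      using x by (auto simp: indicator_def)
  next
    fix n
    have "2 powr (- real n * p) * (2 powr (real (Suc n))) ^ DIM('a) = 2 powr (- real n * p + real (Suc n) * N)"
    proof -
      have "(2 powr (real (Suc n))) ^ DIM('a) = 2 powr (real (Suc n) * N)" by (simp add: powr_power N_def mult.commute)
      thus ?thesis by (simp only: powr_add)
    qed
    also have "\<dots> = 2 powr (N + (N - p) * real n)" by (simp add: algebra_simps)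
    also have "\<dots> = 2 powr N * b ^ n" by (simp only: b_def powr_add) (simp add: powr_power mult.commute)
    finally show "2 powr (- real n * p) * (2 powr (real (Suc n))) ^ DIM('a) \<le> 2 powr N * b ^ n" by simp
    show "b < 1" using p powr_less_mono[of "N - p" 0 2] by (simp add: b_def N_def)
    show "(\<lambda>x::'a. indicator (- ball 0 1) x * norm x powr (- p)) \<in> borel_measurable borel"
      by (intro borel_measurable_times borel_measurable_indicator powr_real_measurable) auto
  qed (auto simp: b_def)
qed

text \<open>Vitali covering: if \<open>g\<close> exceeds \<open>B + 1 / (k + 1)\<close> on a set of
  positive measure, disjoint balls cover almost all of it inside an open set of nearly the same
  measure, and their averages are at most \<open>B\<close>. The admissible radius may depend on the
  centre, and the origin is exempt.\<close>

lemma AE_le_if_ball_averages_le: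
  fixes g :: "'a::euclidean_space \<Rightarrow> real"
  assumes g: "g \<in> borel_measurable lebesgue" "\<And>x. g x \<ge> 0" and B: "B \<ge> 0"
    and avg: "\<And>x. x \<noteq> 0 \<Longrightarrow> \<exists>\<rho>>0. \<forall>r. 0 < r \<and> r < \<rho> \<longrightarrow>
       (\<integral>\<^sup>+z. ennreal (g z) * indicator (ball x r) z \<partial>lebesgue) \<le> ennreal B * emeasure lebesgue (ball x r)"
  shows "AE x in lebesgue. g x \<le> B"
proof -
  have gm[measurable]: "(\<lambda>x. ennreal (g x)) \<in> borel_measurable lebesgue" using g(1) by simp
  \<comment> \<open>Intersected with a ball to have finite measure; the origin is removed since
    \<open>avg\<close> says nothing there.\<close>
  define S where "S = (\<lambda>k::nat. {x. g x \<ge> B + 1 / real (Suc k)} \<inter> cball 0 (real k) - {0})"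
  have S_meas: "S k \<in> sets lebesgue" for k
  proof -
    have "{x \<in> space lebesgue. g x \<ge> B + 1 / real (Suc k)} \<in> sets lebesgue"
      using g(1) by (intro borel_measurable_le) auto
    thus ?thesis unfolding S_def by (intro sets.Diff sets.Int) auto
  qed
  have S_null: "emeasure lebesgue (S k) = 0" for k
  proof -
    define s where "s = measure lebesgue (S k)"
    have fin: "emeasure lebesgue (S k) < \<infinity>"
    proof -
      have "emeasure lebesgue (S k) \<le> emeasure lebesgue (cball (0::'a) (real k))"
        by (intro emeasure_mono) (auto simp: S_def)
      also have "\<dots> < \<infinity>" using emeasure_bounded_finite[of "cball (0::'a) (real k)"] by simp
      finally show ?thesis .
    qed
    hence se: "emeasure lebesgue (S k) = ennreal s" by (simp add: s_def emeasure_eq_ennreal_measure)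
    have key: "(B + 1 / real (Suc k)) * s \<le> B * (s + \<eta>)" if \<eta>: "\<eta> > 0" for \<eta>
    proof -
      obtain V where V: "open V" "S k \<subseteq> V" "V - S k \<in> lmeasurable" "emeasure lebesgue (V - S k) < ennreal \<eta>"
        using sets_lebesgue_outer_open[OF S_meas \<eta>] by blast
      have VL: "V \<in> sets lebesgue" using V(1) by simp
      define I where "I = {i. ball (fst i) (snd i) \<subseteq> V \<and>
         (\<integral>\<^sup>+z. ennreal (g z) * indicator (ball (fst i) (snd i)) z \<partial>lebesgue) \<le> ennreal B * emeasure lebesgue (ball (fst i) (snd i))}"
      obtain D where D: "countable D" "D \<subseteq> I"
        "pairwise (\<lambda>i j. disjnt (ball (fst i) (snd i)) (ball (fst j) (snd j))) D"
        "negligible (S k - (\<Union>i\<in>D. ball (fst i) (snd i)))"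
      proof (rule Vitali_covering_theorem_balls[of "S k" I fst snd])
        fix x :: 'a and d :: real assume x: "x \<in> S k" and d: "0 < d"
        obtain k where k: "k > 0" "ball x k \<subseteq> V" using x V by (meson open_contains_ball subsetD)
        obtain \<rho> where \<rho>: "\<rho> > 0" "\<And>r. 0 < r \<Longrightarrow> r < \<rho> \<Longrightarrow>
           (\<integral>\<^sup>+z. ennreal (g z) * indicator (ball x r) z \<partial>lebesgue) \<le> ennreal B * emeasure lebesgue (ball x r)"
          using avg[of x] x by (auto simp: S_def)
        define r where "r = min (min k \<rho>) d / 2"
        have r: "0 < r" "r < \<rho>" "r < d" "r < k" using k \<rho> d by (auto simp: r_def)
        have "ball x r \<subseteq> V" using k(2) r(4) by (meson less_imp_le order_trans subset_ball)
        hence "(x, r) \<in> I" using \<rho>(2)[OF r(1,2)] by (simp add: I_def)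
        thus "\<exists>i. i \<in> I \<and> x \<in> ball (fst i) (snd i) \<and> snd i < d"
          using r by (intro exI[of _ "(x, r)"]) auto
      qed
      define U where "U = (\<Union>i\<in>D. ball (fst i) (snd i))"
      have disj: "disjoint_family_on (\<lambda>i. ball (fst i) (snd i)) D"
        using D(3) by (auto simp: disjoint_family_on_def pairwise_def disjnt_def)
      have UV: "U \<subseteq> V" using D(2) unfolding U_def I_def by blast
      have US: "AE x in lebesgue. x \<in> S k \<longrightarrow> x \<in> U"
        using AE_not_in[of "S k - U" lebesgue] D(4) by (auto simp: negligible_iff_null_sets U_def elim: eventually_mono)
      define \<mu> where "\<mu> = density lebesgue (\<lambda>x. ennreal (g x))"
      have \<mu>: "emeasure \<mu> A = (\<integral>\<^sup>+x. ennreal (g x) * indicator A x \<partial>lebesgue)" if "A \<in> sets lebesgue" for A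
        unfolding \<mu>_def by (rule emeasure_density[OF gm that])
      have ballL: "ball x r \<in> sets lebesgue" for x :: 'a and r by simp
      have UL: "U \<in> sets lebesgue" 
      proof -
        have "open U" unfolding U_def by (intro open_UN ballI open_ball)
        thus ?thesis by simp
      qed
      have "ennreal (B + 1 / real (Suc k)) * emeasure lebesgue (S k) = (\<integral>\<^sup>+x. ennreal (B + 1 / real (Suc k)) * indicator (S k) x \<partial>lebesgue)"
        using S_meas by (simp add: nn_integral_cmult_indicator)
      also have "\<dots> \<le> (\<integral>\<^sup>+x. ennreal (g x) * indicator U x \<partial>lebesgue)"
      proof (rule nn_integral_mono_AE)
        show "AE x in lebesgue. ennreal (B + 1 / real (Suc k)) * indicator (S k) x \<le> ennreal (g x) * indicator U x"
          using US
        proof eventually_elim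
          case (elim x)
          thus ?case by (cases "x \<in> S k") (auto simp: S_def intro!: ennreal_leI)
        qed
      qed
      also have "\<dots> = emeasure \<mu> U" by (rule \<mu>[OF UL, symmetric])
      also have "\<dots> = (\<integral>\<^sup>+i. emeasure \<mu> (ball (fst i) (snd i)) \<partial>count_space D)"
        unfolding U_def by (rule emeasure_UN_countable[OF _ D(1) disj]) (simp add: \<mu>_def)
      also have "\<dots> \<le> (\<integral>\<^sup>+i. ennreal B * emeasure lebesgue (ball (fst i) (snd i)) \<partial>count_space D)"
      proof (rule nn_integral_mono)
        fix i assume "i \<in> space (count_space D)"
        hence "i \<in> I" using D(2) by auto
        thus "emeasure \<mu> (ball (fst i) (snd i)) \<le> ennreal B * emeasure lebesgue (ball (fst i) (snd i))"
          unfolding \<mu>[OF ballL] by (simp add: I_def)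
      qed
      also have "\<dots> = ennreal B * (\<integral>\<^sup>+i. emeasure lebesgue (ball (fst i) (snd i)) \<partial>count_space D)"
        by (rule nn_integral_cmult) simp
      also have "(\<integral>\<^sup>+i. emeasure lebesgue (ball (fst i) (snd i)) \<partial>count_space D) = emeasure lebesgue U"
        unfolding U_def by (rule emeasure_UN_countable[OF ballL D(1) disj, symmetric])
      also have "emeasure lebesgue U \<le> emeasure lebesgue V" by (rule emeasure_mono[OF UV VL])
      also have "emeasure lebesgue V = emeasure lebesgue (S k) + emeasure lebesgue (V - S k)"
      proof -
        have "S k \<union> (V - S k) = V" using V(2) by auto
        thus ?thesis using plus_emeasure[of "S k" lebesgue "V - S k"] S_meas VL by auto
      qed
      also have "\<dots> \<le> ennreal s + ennreal \<eta>" unfolding se using V(4) by (intro add_left_mono) auto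
      finally have "ennreal (B + 1 / real (Suc k)) * ennreal s \<le> ennreal B * (ennreal s + ennreal \<eta>)"
        unfolding se by (simp add: mult_left_mono)
      moreover have "s \<ge> 0" by (simp add: s_def)
      ultimately have "ennreal ((B + 1 / real (Suc k)) * s) \<le> ennreal (B * (s + \<eta>))"
        using B \<eta> by (simp add: ennreal_mult ennreal_plus[symmetric] del: ennreal_plus)
      thus ?thesis using B \<eta> \<open>s \<ge> 0\<close> by simp
    qed
    have s0: "s \<ge> 0" by (simp add: s_def)
    have "s \<le> 0"
    proof (rule ccontr)
      assume "\<not> s \<le> 0"
      hence sp: "s > 0" by simp
      \<comment> \<open>Makes \<open>B * \<eta>\<close> smaller than the excess
        \<open>s / (k + 1)\<close>; the summand 1 avoids a zero denominator.\<close>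
      define \<eta> where "\<eta> = s / (2 * real (Suc k) * (B + 1))"
      have \<eta>: "\<eta> > 0" using sp B by (simp add: \<eta>_def)
      have "B * \<eta> \<le> (B + 1) * \<eta>" using \<eta> by simp
      also have "(B + 1) * \<eta> = s / (2 * real (Suc k))" 
      proof -
        have "b * (s / (2 * m * b)) = s / (2 * m)" if "b \<noteq> 0" for b m using that by simp
        from this[of "B + 1"] B show ?thesis unfolding \<eta>_def by auto
      qed
      finally have 1: "B * \<eta> \<le> s / (2 * real (Suc k))" .
      have 2: "s / real (Suc k) \<le> B * \<eta>" using key[OF \<eta>] by (simp add: algebra_simps)
      have "s / (2 * real (Suc k)) < s / real (Suc k)" using sp by (intro divide_strict_left_mono) auto
      thus False using 1 2 by linarith
    qed
    thus ?thesis using se s0 by simp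
  qed
  have "AE x in lebesgue. x \<notin> S k" for k
    using S_null[of k] S_meas[of k] by (intro AE_not_in) (simp add: null_setsI)
  hence "AE x in lebesgue. \<forall>k. x \<notin> S k" by (simp add: AE_all_countable)
  moreover have "AE x in lebesgue. x \<noteq> (0::'a)" using AE_completion[OF AE_lborel_singleton[of "0::'a"]] .
  ultimately show ?thesis
  proof eventually_elim
    case (elim x)
    show "g x \<le> B"
    proof (rule ccontr)
      assume "\<not> g x \<le> B"
      then obtain n where n: "1 / real (Suc n) < g x - B" using reals_Archimedean[of "g x - B"] by (auto simp: inverse_eq_divide)
      obtain m where m: "norm x \<le> real m" using real_arch_simple by blast
      define k where "k = max n m"
      have "1 / real (Suc k) \<le> 1 / real (Suc n)" by (simp add: k_def frac_le)
      moreover have "norm x \<le> real k" using m by (simp add: k_def)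
      ultimately have "x \<in> S k" using n elim(2) by (simp add: S_def)
      thus False using elim(1) by blast
    qed
  qed
qed

section \<open>Decay of subsolutions\<close>

text \<open>The quotient of the kernels is the angular factor alone. For
  \<open>\<tau> \<ge> 1\<close> its power of \<open>\<tau>\<close> is at most 1, the angular
  exponent is nonpositive, and \<open>\<tau> \<le> 5 / 4\<close> yields the constant. So a time lag
  of one unit trades the concentrated kernel for the radial one.\<close>

lemma backward_kernel_compare:
  fixes e z :: "'a::euclidean_space"
  assumes e: "norm e = 1" and \<tau>: "1 \<le> T - t" "T - t \<le> 5 / 4"
  shows "backward_kernel 1 y0 e T (z, t) \<le> exp ((real DIM('a) - 1)\<^sup>2 * 5 / 16) * backward_kernel 0 y0 e T (z, t)"
proof -
  define N where "N = real DIM('a)"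
  define \<tau> where "\<tau> = T - t"
  have t: "\<tau> \<ge> 1" "\<tau> \<le> 5/4" using \<tau> by (auto simp: \<tau>_def)
  have N1: "N \<ge> 1" using DIM_positive[where 'a='a] by (simp add: N_def)
  define q where "q = z \<bullet> e / norm z"
  have q: "q \<le> 1" unfolding q_def by (rule abs_le_D1[OF cos_angle_le_1[OF e]])
  have eq: "backward_kernel 1 y0 e T (z, t) =
    exp (- (N - 1) / 2 * ln \<tau> + (N - 1)\<^sup>2 / 4 * \<tau> - (1 - q) / (2 * \<tau>)) * backward_kernel 0 y0 e T (z, t)"
    by (simp add: backward_kernel_def kernel_exponent_def N_def \<tau>_def q_def exp_add[symmetric] diff_divide_distrib)
  have "- (N - 1) / 2 * ln \<tau> \<le> 0" using N1 t by (simp add: mult_nonpos_nonneg)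
  moreover have "(N - 1)\<^sup>2 / 4 * \<tau> \<le> (N - 1)\<^sup>2 / 4 * (5 / 4)" using t by (intro mult_left_mono) auto
  moreover have "(1 - q) / (2 * \<tau>) \<ge> 0" using q t by simp
  ultimately have "exp (- (N - 1) / 2 * ln \<tau> + (N - 1)\<^sup>2 / 4 * \<tau> - (1 - q) / (2 * \<tau>)) \<le> exp ((N - 1)\<^sup>2 * 5 / 16)"
    unfolding exp_le_cancel_iff by linarith
  thus ?thesis unfolding eq N_def using backward_kernel_pos less_imp_le by (intro mult_right_mono) blast+
qed

text \<open>Completing the square eliminates \<open>y0\<close>, so the bound is uniform in the point
  of evaluation. Together with the weight \<open>|z|\<^sup>-\<^sup>2\<close> it produces
  \<open>|z|^(-N)\<close>, the weight put on the initial deviation.\<close>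

lemma backward_kernel_initial_le:
  fixes e z :: "'a::euclidean_space"
  assumes T: "T > 0" and z: "z \<noteq> 0"
  shows "backward_kernel 0 y0 e T (z, 0) \<le> T powr (- 1 / 2) * norm z powr (- (real DIM('a) - 2))"
proof -
  define a where "a = (real DIM('a) - 2) / 2"
  define D where "D = ln (norm z) - y0"
  have "- D\<^sup>2 / (4 * T) + a * D \<le> a\<^sup>2 * T" by (rule neg_square_plus_linear_le[OF T])
  hence "kernel_exponent (real DIM('a)) 0 y0 T (ln (norm z)) 0 \<le> - ln T / 2 - 2 * a * ln (norm z)"
    by (simp add: kernel_exponent_def a_def[symmetric] D_def algebra_simps)
  also have "- ln T / 2 - 2 * a * ln (norm z) = - ln T / 2 + (- (real DIM('a) - 2) * ln (norm z))"
    by (simp add: a_def field_simps)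
  finally have "kernel_exponent (real DIM('a)) 0 y0 T (ln (norm z)) 0 \<le> - ln T / 2 + (- (real DIM('a) - 2) * ln (norm z))" .
  hence "exp (kernel_exponent (real DIM('a)) 0 y0 T (ln (norm z)) 0) \<le> exp (- ln T / 2) * exp (- (real DIM('a) - 2) * ln (norm z))"
    by (simp only: exp_add[symmetric] exp_le_cancel_iff)
  thus ?thesis using T z by (simp add: backward_kernel_def powr_def)
qed

lemma abs_ln_le: "\<bar>ln s\<bar> \<le> 2 * \<bar>s - 1\<bar>" if "s \<ge> 1 / 2" for s :: real
proof (cases "s \<ge> 1")
  case True
  thus ?thesis using ln_le_minus_one[of s] by simp
next
  case False
  have s: "s > 0" using that by simp
  have "- ln s = ln (1 / s)" using s by (simp add: ln_div)
  also have "\<dots> \<le> 1 / s - 1" using s by (intro ln_le_minus_one) simp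
  also have "\<dots> = (1 - s) / s" using s by (simp add: field_simps)
  also have "\<dots> \<le> (1 - s) / (1 / 2)" using that False by (intro divide_left_mono) auto
  finally show ?thesis using False s by (simp add: ln_less_zero abs_if)
qed

text \<open>At scale \<open>r\<close> around \<open>x\<close> the kernel that concentrates at \<open>x\<close> has size comparable to
  \<open>r\<^sup>-\<^sup>N\<close>, once the remaining time is chosen as \<open>(r / |x|)\<^sup>2\<close>.\<close>

lemma backward_kernel_lower_bound:
  fixes x z :: "'a::euclidean_space"
  assumes dim: "DIM('a) \<ge> 3" and x: "x \<noteq> 0" and r: "0 < r" "r \<le> norm x / 2" and z: "z \<in> ball x r"
  defines "a \<equiv> (real DIM('a) - 2) / 2"
  shows "backward_kernel 1 (ln (norm x)) (x /\<^sub>R norm x) (t + (r / norm x)\<^sup>2) (z, t) / (norm z)\<^sup>2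
     \<ge> exp (- 3 / 2 - a - a\<^sup>2) * (4 / 9) * r powr (- real DIM('a))"
proof -
  define N where "N = real DIM('a)"
  define X where "X = norm x"
  define Z where "Z = norm z"
  define \<rho> where "\<rho> = r / X"
  have X: "X > 0" using x by (simp add: X_def)
  have N: "N \<ge> 3" "a > 0" "a = (N - 2) / 2" using dim by (auto simp: N_def a_def)
  have \<rho>: "0 < \<rho>" "\<rho> \<le> 1 / 2" using r X by (auto simp: \<rho>_def X_def field_simps)
  have d: "norm (z - x) < r" using z by (simp add: dist_norm norm_minus_commute)
  have ZX: "\<bar>Z - X\<bar> \<le> norm (z - x)" unfolding Z_def X_def by (rule norm_triangle_ineq3)
  have Z: "Z \<ge> X / 2" "Z \<le> 3 / 2 * X" "Z > 0" using ZX d r(2) X unfolding X_def[symmetric] by linarith+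
  have ZX1: "\<bar>Z / X - 1\<bar> \<le> \<rho>"
  proof -
    have "\<bar>Z / X - 1\<bar> = \<bar>Z - X\<bar> / X" using X by (simp add: field_simps abs_if)
    also have "\<dots> \<le> r / X" using ZX d X by (intro divide_right_mono) auto
    finally show ?thesis by (simp add: \<rho>_def)
  qed
  define D where "D = ln Z - ln X"
  have D: "\<bar>D\<bar> \<le> 2 * \<rho>"
  proof -
    have "D = ln (Z / X)" using Z X by (simp add: D_def ln_div)
    moreover have "Z / X \<ge> 1 / 2" using Z X by (simp add: field_simps)
    ultimately show ?thesis using abs_ln_le[of "Z / X"] ZX1 by simp
  qed
  have D2: "D\<^sup>2 / (4 * \<rho>\<^sup>2) \<le> 1"
  proof -
    have "D\<^sup>2 \<le> (2 * \<rho>)\<^sup>2" using D by (metis abs_le_square_iff abs_of_nonneg \<rho>(1) less_imp_le mult_nonneg_nonneg zero_le_numeral)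
    thus ?thesis using \<rho> by (simp add: power_mult_distrib)
  qed
  define q where "q = z \<bullet> (x /\<^sub>R X) / Z"
  \<comment> \<open>By the law of cosines
    \<open>2 * (Z * X - z \<bullet> x) \<le> r\<^sup>2\<close>, hence the cosine \<open>q\<close>
    differs from 1 by at most \<open>\<rho>\<^sup>2\<close>, the remaining time.\<close>
  have q: "(1 - q) / (2 * \<rho>\<^sup>2) \<le> 1 / 2"
  proof -
    have "(norm (z - x))\<^sup>2 = Z\<^sup>2 + X\<^sup>2 - 2 * (z \<bullet> x)"
      by (simp add: Z_def X_def power2_norm_eq_inner inner_diff_left inner_diff_right inner_commute)
    moreover have "(norm (z - x))\<^sup>2 \<le> r\<^sup>2" using d by (intro power_mono) auto
    moreover have "Z\<^sup>2 + X\<^sup>2 - 2 * (Z * X) \<ge> 0"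
      using zero_le_power2[of "Z - X"] by (simp only: power2_diff mult.assoc)
    ultimately have "2 * (Z * X - z \<bullet> x) \<le> r\<^sup>2" by (simp add: right_diff_distrib)
    moreover have "Z * X - z \<bullet> x = (1 - q) * (Z * X)"
    proof -
      have "q = (z \<bullet> x) / (Z * X)" by (simp add: q_def field_simps)
      thus ?thesis using Z X by (simp add: field_simps)
    qed
    ultimately have "2 * ((1 - q) * (Z * X)) \<le> r\<^sup>2" by (simp only:)
    hence 1: "(1 - q) * (2 * Z * X) \<le> r\<^sup>2" by (simp only: mult_ac)
    have "X * X \<le> 2 * Z * X" using Z X by simp
    moreover have q1: "q \<le> 1" unfolding q_def Z_def X_def using x by (intro abs_le_D1[OF cos_angle_le_1]) simp
    ultimately have "(1 - q) * (X * X) \<le> (1 - q) * (2 * Z * X)" by (intro mult_left_mono) auto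
    hence "(1 - q) * X\<^sup>2 \<le> r\<^sup>2" using 1 by (simp add: power2_eq_square)
    hence "1 - q \<le> \<rho>\<^sup>2" using X by (simp add: \<rho>_def power_divide pos_le_divide_eq)
    thus ?thesis using \<rho> by (simp add: divide_simps)
  qed
  have lnZ: "ln Z \<le> ln X + 1"
    using D \<rho> by (simp add: D_def)
  \<comment> \<open>The constant collects 1 from the Gaussian, 1/2 from the angle, \<open>a\<close>
    from \<open>ln Z \<le> ln X + 1\<close> and \<open>a\<^sup>2\<close> from
    \<open>\<rho> \<le> 1\<close>. The radial and angular logarithms of the remaining time
    \<open>\<rho>\<^sup>2\<close> add up to \<open>- N * ln \<rho>\<close>.\<close>
  have "- 3 / 2 - a - a\<^sup>2 - N * ln \<rho> - 2 * a * ln X \<le>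
     kernel_exponent N 1 (ln X) (t + \<rho>\<^sup>2) (ln Z) t + 1 / (2 * \<rho>\<^sup>2) * q"
  proof -
    have "kernel_exponent N 1 (ln X) (t + \<rho>\<^sup>2) (ln Z) t + 1 / (2 * \<rho>\<^sup>2) * q =
       - (D\<^sup>2 / (4 * \<rho>\<^sup>2)) - a * (ln X + ln Z) - a\<^sup>2 * \<rho>\<^sup>2 - N / 2 * ln (\<rho>\<^sup>2) + (N - 1)\<^sup>2 / 4 * \<rho>\<^sup>2 - (1 - q) / (2 * \<rho>\<^sup>2)"
      by (simp add: kernel_exponent_def N(3) D_def diff_divide_distrib algebra_simps add_divide_distrib)
    moreover have "a * (ln X + ln Z) \<le> 2 * a * ln X + a"
    proof -
      have "a * (ln X + ln Z) \<le> a * (2 * ln X + 1)" using lnZ N by (intro mult_left_mono) auto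
      thus ?thesis by (simp add: algebra_simps)
    qed
    moreover have "a\<^sup>2 * \<rho>\<^sup>2 \<le> a\<^sup>2 * 1" using \<rho> by (intro mult_left_mono) (auto simp: power_le_one)
    moreover have "N / 2 * ln (\<rho>\<^sup>2) = N * ln \<rho>" using \<rho> by (simp add: ln_realpow)
    moreover have "(N - 1)\<^sup>2 / 4 * \<rho>\<^sup>2 \<ge> 0" by simp
    ultimately show ?thesis using D2 q by linarith
  qed
  hence "exp (- 3 / 2 - a - a\<^sup>2 - N * ln \<rho> - 2 * a * ln X) \<le> backward_kernel 1 (ln X) (x /\<^sub>R X) (t + \<rho>\<^sup>2) (z, t)"
    by (simp add: backward_kernel_def N_def exp_add[symmetric] q_def Z_def)
  moreover have "exp (- 3 / 2 - a - a\<^sup>2 - N * ln \<rho> - 2 * a * ln X) = exp (- 3 / 2 - a - a\<^sup>2) * (r powr (- N) * X\<^sup>2)"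
  proof -
    \<comment> \<open>The powers of \<open>X\<close> combine to \<open>X\<^sup>2\<close>, which the
      weight \<open>1 / Z\<^sup>2\<close> cancels up to the factor 4/9 coming from
      \<open>Z \<le> 3 / 2 * X\<close>. Hence the bound depends on \<open>r\<close> alone.\<close>
    have a1: "- N * ln \<rho> - 2 * a * ln X = - N * ln r + 2 * ln X"
    proof -
      have "ln \<rho> = ln r - ln X" using r X by (simp add: \<rho>_def ln_div)
      moreover have "2 * a = N - 2" by (simp add: N(3))
      ultimately show ?thesis by (simp only:) (simp add: algebra_simps)
    qed
    have a2: "exp (2 * ln X) = X\<^sup>2" using X by (simp add: exp_of_nat_mult[of 2, simplified])
    have "exp (- N * ln \<rho> - 2 * a * ln X) = r powr (- N) * X\<^sup>2"
    proof -
      have "r powr (- N) = exp (- N * ln r)" using r by (simp add: powr_def)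
      thus ?thesis unfolding a1 exp_add a2 by simp
    qed
    moreover have "- 3 / 2 - a - a\<^sup>2 - N * ln \<rho> - 2 * a * ln X = (- 3 / 2 - a - a\<^sup>2) + (- N * ln \<rho> - 2 * a * ln X)" by simp
    ultimately show ?thesis by (simp only: exp_add)
  qed
  ultimately have 1: "exp (- 3 / 2 - a - a\<^sup>2) * (r powr (- N) * X\<^sup>2) \<le> backward_kernel 1 (ln X) (x /\<^sub>R X) (t + \<rho>\<^sup>2) (z, t)" by simp
  have "Z\<^sup>2 \<le> (3 / 2 * X)\<^sup>2" using Z by (intro power_mono) auto
  hence 2: "4 / 9 \<le> X\<^sup>2 / Z\<^sup>2" using Z X by (simp add: field_simps power_mult_distrib)
  have "exp (- 3 / 2 - a - a\<^sup>2) * (4 / 9) * r powr (- N) \<le> exp (- 3 / 2 - a - a\<^sup>2) * r powr (- N) * (X\<^sup>2 / Z\<^sup>2)"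
    using mult_left_mono[OF 2, of "exp (- 3 / 2 - a - a\<^sup>2) * r powr (- N)"] by (simp add: mult_ac)
  also have "\<dots> = exp (- 3 / 2 - a - a\<^sup>2) * (r powr (- N) * X\<^sup>2) / Z\<^sup>2" by simp
  also have "\<dots> \<le> backward_kernel 1 (ln X) (x /\<^sub>R X) (t + \<rho>\<^sup>2) (z, t) / Z\<^sup>2" by (intro divide_right_mono 1) simp
  finally show ?thesis by (simp add: N_def X_def Z_def \<rho>_def)
qed

context L12_subsolution
begin

text \<open>The integral over a small ball is bounded by the pairing with the concentrated kernel at
  time \<open>t\<close>. Monotonicity goes back to \<open>t - 1\<close>, where the radial kernel
  takes over, and then to time 0, where \<open>t powr (- 1 / 2)\<close> appears. The volume of the
  ball cancels \<open>r powr (- N)\<close>, so \<open>C\<close> depends on neither \<open>x\<close>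
  nor \<open>r\<close>.\<close>

lemma decay:
  assumes init: "integrable lebesgue (\<lambda>x. f 0 x * norm x powr (- real DIM('a)))"
  shows "\<exists>C. \<forall>t\<ge>1. AE x in lebesgue. f t x \<le> C * t powr (- 1 / 2)"
proof -
  define N where "N = real DIM('a)"
  define I0 where "I0 = (LINT x|lebesgue. f 0 x * norm x powr (- N))"
  define a where "a = (N - 2) / 2"
  define c0 where "c0 = exp (- 3 / 2 - a - a\<^sup>2) * (4 / 9)"
  define c1 where "c1 = exp ((N - 1)\<^sup>2 * 5 / 16)"
  define v where "v = unit_ball_vol N"
  have c0: "c0 > 0" by (simp add: c0_def)
  have v: "v > 0" by (simp add: v_def N_def)
  have I0: "I0 \<ge> 0" unfolding I0_def using f_nonneg by (intro integral_nonneg_AE) auto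
  define C where "C = c1 * I0 / (c0 * v)"
  have C: "C \<ge> 0" using c0 v I0 by (simp add: C_def c1_def)
  have "AE x in lebesgue. f t x \<le> C * t powr (- 1 / 2)" if t: "t \<ge> 1" for t
  proof (rule AE_le_if_ball_averages_le)
    show "f t \<in> borel_measurable lebesgue" using f_meas t by simp
    show "C * t powr (- 1 / 2) \<ge> 0" using C by simp
    fix x :: 'a assume x: "x \<noteq> 0"
    show "\<exists>\<rho>>0. \<forall>r. 0 < r \<and> r < \<rho> \<longrightarrow> (\<integral>\<^sup>+z. ennreal (f t z) * indicator (ball x r) z \<partial>lebesgue)
        \<le> ennreal (C * t powr (- 1 / 2)) * emeasure lebesgue (ball x r)"
    proof (intro exI[of _ "norm x / 2"] conjI allI impI)
      show "0 < norm x / 2" using x by simp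
      fix r assume "0 < r \<and> r < norm x / 2"
      hence r: "0 < r" "r < norm x / 2" by auto
      \<comment> \<open>With \<open>\<sigma> \<le> 1 / 4\<close> the remaining time seen from
        \<open>t - 1\<close> lies between 1 and 5/4, as the comparison of the kernels
        requires.\<close>
      define \<sigma> where "\<sigma> = (r / norm x)\<^sup>2"
      define T where "T = t + \<sigma>"
      define e where "e = x /\<^sub>R norm x"
      define y0 where "y0 = ln (norm x)"
      have e: "norm e = 1" using x by (simp add: e_def)
      have \<rho>: "0 < r / norm x" "r / norm x \<le> 1 / 2" using r x by (auto simp: field_simps)
      have \<sigma>: "0 < \<sigma>" "\<sigma> \<le> 1 / 4"
      proof -
        show "0 < \<sigma>" unfolding \<sigma>_def by (rule zero_less_power[OF \<rho>(1)])
        have "\<sigma> \<le> (1 / 2)\<^sup>2" unfolding \<sigma>_def using \<rho> by (intro power_mono) auto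
        thus "\<sigma> \<le> 1 / 4" by (simp add: power2_eq_square)
      qed
      have B: "\<exists>B. \<forall>z. \<bar>backward_kernel \<theta> y0 e T (z, s)\<bar> \<le> B" if \<theta>: "\<theta> = 0 \<or> \<theta> = 1" and s: "0 \<le> s" "s < T" for \<theta> s
      proof -
        obtain B where "\<forall>z. \<forall>t\<in>{0..s}. backward_kernel \<theta> y0 e T (z, t) \<le> B \<and> backward_kernel \<theta> y0 e T (z, t) * \<bar>ln (norm z) - y0\<bar> \<le> B"
          using kernel_le[OF \<theta> e s(2), of y0] by blast
        hence "\<forall>z. \<bar>backward_kernel \<theta> y0 e T (z, s)\<bar> \<le> B" using s(1) by (simp add: abs_of_pos backward_kernel_pos)
        thus ?thesis by blast
      qed
      have int: "integrable lebesgue (\<lambda>z. f s z / (norm z)\<^sup>2 * backward_kernel \<theta> y0 e T (z, s))"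
        if \<theta>: "\<theta> = 0 \<or> \<theta> = 1" and s: "0 \<le> s" "s < T" for \<theta> s
      proof -
        obtain B where "\<And>z. \<bar>backward_kernel \<theta> y0 e T (z, s)\<bar> \<le> B" using B[OF \<theta> s] by blast
        thus ?thesis
          by (rule integrable_bounded_mult[OF L12_integrable[OF f_L12[OF s(1)]] borel_imp_lebesgue[OF backward_kernel_measurable]])
      qed
      have pd: "pairing \<theta> y0 T e s = (LINT z|lebesgue. f s z / (norm z)\<^sup>2 * backward_kernel \<theta> y0 e T (z, s))"
        if "\<theta> = 0 \<or> \<theta> = 1" for \<theta> s
        by (rule pairing_def[OF that e])
      have "pairing 1 y0 T e t \<le> pairing 1 y0 T e (t - 1)"
        using t \<sigma> by (intro pairing_antimono[OF _ e]) (auto simp: T_def)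
      also have "\<dots> \<le> c1 * pairing 0 y0 T e (t - 1)"
      proof -
        have "pairing 1 y0 T e (t - 1) \<le> (LINT z|lebesgue. c1 * (f (t - 1) z / (norm z)\<^sup>2 * backward_kernel 0 y0 e T (z, t - 1)))"
          unfolding pd[OF disjI2[OF refl]] pd[OF disjI1[OF refl]]
        proof (rule integral_mono)
          fix z :: 'a
          have "backward_kernel 1 y0 e T (z, t - 1) \<le> c1 * backward_kernel 0 y0 e T (z, t - 1)"
            unfolding c1_def N_def using \<sigma> by (intro backward_kernel_compare[OF e]) (auto simp: T_def)
          from mult_left_mono[OF this, of "f (t - 1) z / (norm z)\<^sup>2"] f_nonneg
          show "f (t - 1) z / (norm z)\<^sup>2 * backward_kernel 1 y0 e T (z, t - 1)
             \<le> c1 * (f (t - 1) z / (norm z)\<^sup>2 * backward_kernel 0 y0 e T (z, t - 1))"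
            by (simp add: mult_ac)
        next
          have s: "0 \<le> t - 1" "t - 1 < T" using t \<sigma> by (auto simp: T_def)
          show "integrable lebesgue (\<lambda>z. f (t - 1) z / (norm z)\<^sup>2 * backward_kernel 1 y0 e T (z, t - 1))"
            by (rule int[OF disjI2[OF refl] s])
          show "integrable lebesgue (\<lambda>z. c1 * (f (t - 1) z / (norm z)\<^sup>2 * backward_kernel 0 y0 e T (z, t - 1)))"
            by (rule integrable_mult_right[OF int[OF disjI1[OF refl] s]])
        qed
        also have "\<dots> = c1 * pairing 0 y0 T e (t - 1)" unfolding pd[OF disjI1[OF refl]] by (rule integral_mult_right_zero)
        finally show ?thesis .
      qed
      also have "pairing 0 y0 T e (t - 1) \<le> pairing 0 y0 T e 0"
      \<comment> \<open>Monotonicity is available for strictly ordered times only, and for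
        \<open>t = 1\<close> both sides coincide.\<close>
      proof (cases "t = 1")
        case False
        thus ?thesis using t \<sigma> by (intro pairing_antimono[OF _ e]) (auto simp: T_def)
      qed simp
      also have "pairing 0 y0 T e 0 \<le> t powr (- 1 / 2) * I0"
      proof -
        have T: "T \<ge> t" "T > 0" using t \<sigma> by (auto simp: T_def)
        have "pairing 0 y0 T e 0 \<le> (LINT z|lebesgue. t powr (- 1 / 2) * (f 0 z * norm z powr (- N)))"
          unfolding pd[OF disjI1[OF refl]]
        proof (rule integral_mono)
          fix z :: 'a
          show "f 0 z / (norm z)\<^sup>2 * backward_kernel 0 y0 e T (z, 0) \<le> t powr (- 1 / 2) * (f 0 z * norm z powr (- N))"
          proof (cases "z = 0")
            case False
            have "backward_kernel 0 y0 e T (z, 0) \<le> T powr (- 1 / 2) * norm z powr (- (N - 2))"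
              unfolding N_def by (rule backward_kernel_initial_le[OF T(2) False])
            also have "T powr (- 1 / 2) \<le> t powr (- 1 / 2)" using T t by (intro powr_mono2') auto
            finally have "backward_kernel 0 y0 e T (z, 0) \<le> t powr (- 1 / 2) * norm z powr (- (N - 2))"
              by (simp add: mult_right_mono)
            hence "f 0 z / (norm z)\<^sup>2 * backward_kernel 0 y0 e T (z, 0) \<le> f 0 z / (norm z)\<^sup>2 * (t powr (- 1 / 2) * norm z powr (- (N - 2)))"
              using f_nonneg by (intro mult_left_mono) auto
            also have "norm z powr (- (N - 2)) = norm z powr (- N) * (norm z)\<^sup>2"
            proof -
              have "- (N - 2) = - N + 2" by simp
              hence "norm z powr (- (N - 2)) = norm z powr (- N) * norm z powr 2" by (simp only: powr_add)
              thus ?thesis using False by (simp add: powr_numeral)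
            qed
            finally show ?thesis using False by (simp add: mult_ac)
          qed simp
        next
          show "integrable lebesgue (\<lambda>z. f 0 z / (norm z)\<^sup>2 * backward_kernel 0 y0 e T (z, 0))"
            by (rule int[OF disjI1[OF refl] order_refl T(2)])
          show "integrable lebesgue (\<lambda>z. t powr (- 1 / 2) * (f 0 z * norm z powr (- N)))"
            unfolding N_def by (rule integrable_mult_right[OF init])
        qed
        also have "\<dots> = t powr (- 1 / 2) * I0" unfolding I0_def by (rule integral_mult_right_zero)
        finally show ?thesis .
      qed
      finally have up: "pairing 1 y0 T e t \<le> c1 * (t powr (- 1 / 2) * I0)" by (simp add: c1_def)
      define P where "P = (\<lambda>z. f t z / (norm z)\<^sup>2 * backward_kernel 1 y0 e T (z, t))"
      have Pi: "integrable lebesgue P" unfolding P_def using t \<sigma> by (intro int) (auto simp: T_def)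
      have P0: "P z \<ge> 0" for z unfolding P_def using f_nonneg backward_kernel_pos[of 1 y0 e T "(z, t)"] by (intro mult_nonneg_nonneg) auto
      define k where "k = c0 * r powr (- N)"
      have k: "k > 0" using c0 r by (simp add: k_def)
      have fP: "f t z * k \<le> P z" if "z \<in> ball x r" for z
      proof -
        have "k \<le> backward_kernel 1 y0 e T (z, t) / (norm z)\<^sup>2"
          using backward_kernel_lower_bound[OF dim x r(1) less_imp_le[OF r(2)] that, of t]
          unfolding k_def c0_def a_def N_def y0_def e_def T_def \<sigma>_def by simp
        from mult_left_mono[OF this f_nonneg[of t z]] show ?thesis by (simp add: P_def)
      qed
      have "ennreal k * (\<integral>\<^sup>+z. ennreal (f t z) * indicator (ball x r) z \<partial>lebesgue)
          = (\<integral>\<^sup>+z. ennreal k * (ennreal (f t z) * indicator (ball x r) z) \<partial>lebesgue)"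
      proof (rule nn_integral_cmult[symmetric])
        have "f t \<in> borel_measurable lebesgue" using f_meas t by simp
        thus "(\<lambda>z. ennreal (f t z) * indicator (ball x r) z) \<in> borel_measurable lebesgue"
          by (intro borel_measurable_times_ennreal borel_measurable_indicator measurable_compose[OF _ measurable_ennreal]) auto
      qed
      also have "\<dots> \<le> (\<integral>\<^sup>+z. ennreal (P z) \<partial>lebesgue)"
      proof (rule nn_integral_mono)
        fix z
        show "ennreal k * (ennreal (f t z) * indicator (ball x r) z) \<le> ennreal (P z)"
          using fP[of z] k f_nonneg[of t z]
          by (cases "z \<in> ball x r") (auto simp: ennreal_mult[symmetric] mult.commute intro!: ennreal_leI)
      qed
      also have "\<dots> = ennreal (pairing 1 y0 T e t)"
        using Pi P0 by (subst nn_integral_eq_integral) (auto simp: pd P_def)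
      also have "\<dots> \<le> ennreal (c1 * (t powr (- 1 / 2) * I0))" by (rule ennreal_leI[OF up])
      finally have main: "ennreal k * (\<integral>\<^sup>+z. ennreal (f t z) * indicator (ball x r) z \<partial>lebesgue) \<le> ennreal (c1 * (t powr (- 1 / 2) * I0))" .
      have "(\<integral>\<^sup>+z. ennreal (f t z) * indicator (ball x r) z \<partial>lebesgue) =
          ennreal (1 / k) * (ennreal k * (\<integral>\<^sup>+z. ennreal (f t z) * indicator (ball x r) z \<partial>lebesgue))"
        using k by (simp add: mult.assoc[symmetric] ennreal_mult[symmetric])
      also have "\<dots> \<le> ennreal (1 / k) * ennreal (c1 * (t powr (- 1 / 2) * I0))" by (intro mult_left_mono main) simp
      also have "\<dots> = ennreal (1 / k * (c1 * (t powr (- 1 / 2) * I0)))" using k I0 by (intro ennreal_mult[symmetric]) (auto simp: c1_def)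
      also have "1 / k * (c1 * (t powr (- 1 / 2) * I0)) = C * t powr (- 1 / 2) * (v * r ^ DIM('a))"
      proof -
        have "r powr (- N) = 1 / r ^ DIM('a)" using r by (simp add: N_def powr_minus_divide powr_realpow)
        thus ?thesis using c0 v r by (simp add: k_def C_def)
      qed
      also have "ennreal (C * t powr (- 1 / 2) * (v * r ^ DIM('a))) = ennreal (C * t powr (- 1 / 2)) * emeasure lebesgue (ball x r)"
        using C v r by (simp add: emeasure_ball v_def N_def ennreal_mult)
      finally show "(\<integral>\<^sup>+z. ennreal (f t z) * indicator (ball x r) z \<partial>lebesgue)
        \<le> ennreal (C * t powr (- 1 / 2)) * emeasure lebesgue (ball x r)" .
    qed
  qed (rule f_nonneg)
  thus ?thesis by blast
qed

end

section \<open>The profile as a curve of functions\<close>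

text \<open>At time 0 the definition of \<^const>\<open>E\<close> divides by 0 and gives the value \<open>erfc 0 = 1\<close>;
  here the limit is used instead.\<close>

definition E0 :: "real \<Rightarrow> 'a::euclidean_space \<Rightarrow> real" where
  "E0 t x = (if t = 0 then if norm x < 1 then 2 else 0 else E x t)"

lemma E0_nonneg: "E0 t x \<ge> 0"
  by (simp add: E0_def E_def erfc_nonneg)

lemma E0_le_2: "E0 t x \<le> 2"
  by (simp add: E0_def E_def erfc_le_2)

lemma E0_borel[measurable]: "(E0 t :: 'a::euclidean_space \<Rightarrow> real) \<in> borel_measurable borel"
proof -
  have [measurable]: "erfc \<in> borel_measurable borel"
    using erfc_continuous by (rule borel_measurable_continuous_onI)
  show ?thesis unfolding E0_def[abs_def] E_def by measurable
qed

text \<open>The nonnegative drift is dropped, \<open>erfc\<close> is bounded by a Gaussian in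
  \<open>ln |x|\<close>, and the square is completed against \<open>N * ln |x|\<close>. The power
  \<open>N\<close> is ample for integrability at infinity.\<close>

lemma E0_decay:
  fixes x :: "'a::euclidean_space"
  assumes dim: "DIM('a) \<ge> 3" and t: "0 \<le> t" "t \<le> \<tau>" and x: "norm x \<ge> 1"
  shows "E0 t x \<le> exp ((real DIM('a))\<^sup>2 * \<tau>) * norm x powr (- real DIM('a))"
proof (cases "t = 0")
  case False
  define N where "N = real DIM('a)"
  define y where "y = ln (norm x)"
  define \<xi> where "\<xi> = (y + (N - 2) * t) / (2 * sqrt t)"
  have t0: "t > 0" using t False by simp
  have N: "N \<ge> 3" using dim by (simp add: N_def)
  have y: "y \<ge> 0" using x by (simp add: y_def)
  have x0: "x \<noteq> 0" using x by auto
  have \<xi>: "y / (2 * sqrt t) \<le> \<xi>" unfolding \<xi>_def using N t0 by (intro divide_right_mono) auto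
  have \<xi>0: "0 \<le> y / (2 * sqrt t)" using y t0 by simp
  have "E0 t x = erfc \<xi>" using False x0 by (simp add: E0_def E_def \<xi>_def y_def N_def)
  also have "\<dots> \<le> exp (- \<xi>\<^sup>2)" using \<xi> \<xi>0 by (intro erfc_le_gauss) simp
  also have "\<dots> \<le> exp (N\<^sup>2 * \<tau> + - N * y)"
  proof -
    have "(y / (2 * sqrt t))\<^sup>2 \<le> \<xi>\<^sup>2" using \<xi> \<xi>0 by (intro power_mono)
    moreover have "(y / (2 * sqrt t))\<^sup>2 = y\<^sup>2 / (4 * t)" using t0 by (simp add: power_divide power_mult_distrib)
    moreover have "- y\<^sup>2 / (4 * t) + N * y \<le> N\<^sup>2 * t" by (rule neg_square_plus_linear_le[OF t0])
    moreover have "N\<^sup>2 * t \<le> N\<^sup>2 * \<tau>" using t by (intro mult_left_mono) auto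
    ultimately show ?thesis by simp
  qed
  also have "\<dots> = exp (N\<^sup>2 * \<tau>) * norm x powr (- N)"
    using x0 by (simp only: exp_add) (simp add: powr_def y_def)
  finally show ?thesis by (simp add: N_def)
qed (use x in \<open>simp add: E0_def\<close>)

text \<open>As \<open>t\<close> tends to 0, the argument of \<open>erfc\<close> tends to plus or
  minus infinity according to the sign of \<open>ln |x|\<close>. On the unit sphere it tends to 0
  instead, hence the exclusion of this null set.\<close>

lemma E0_tendsto:
  fixes x :: "'a::euclidean_space"
  assumes x: "x \<noteq> 0" "norm x \<noteq> 1" and s: "s \<ge> 0"
  shows "((\<lambda>t. E0 t x) \<longlongrightarrow> E0 s x) (at s within {0..})"
proof (cases "s = 0")
  case True
  define c where "c = real DIM('a) - 2"
  define y where "y = ln (norm x)"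
  have y: "y \<noteq> 0" using x by (simp add: y_def)
  have num: "((\<lambda>t. y + c * t) \<longlongrightarrow> y) (at_right 0)"
    by (auto intro!: tendsto_eq_intros)
  have den: "filterlim (\<lambda>t. inverse (2 * sqrt t)) at_top (at_right 0)"
  proof (rule filterlim_inverse_at_top)
    show "((\<lambda>t. 2 * sqrt t) \<longlongrightarrow> 0) (at_right 0)" by (auto intro!: tendsto_eq_intros)
    show "\<forall>\<^sub>F t in at_right 0. 0 < 2 * sqrt t" 
      by (rule eventually_mono[OF eventually_at_right_less]) simp
  qed
  have "((\<lambda>t. erfc ((y + c * t) * inverse (2 * sqrt t))) \<longlongrightarrow> E0 0 x) (at_right 0)"
  proof (cases "y > 0")
    case pos: True
    have "filterlim (\<lambda>t. (y + c * t) * inverse (2 * sqrt t)) at_top (at_right 0)"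
      by (rule filterlim_tendsto_pos_mult_at_top[OF num pos den])
    moreover have "norm x \<ge> 1" using pos x by (simp add: y_def)
    ultimately show ?thesis using filterlim_compose[OF erfc_at_top] by (simp add: E0_def)
  next
    case False
    hence neg: "y < 0" using y by simp
    have "filterlim (\<lambda>t. (y + c * t) * inverse (2 * sqrt t)) at_bot (at_right 0)"
      by (rule filterlim_tendsto_neg_mult_at_bot[OF num neg den])
    moreover have "norm x < 1" using neg x by (simp add: y_def ln_less_zero_iff)
    ultimately show ?thesis using filterlim_compose[OF erfc_at_bot] by (simp add: E0_def)
  qed
  moreover have "\<forall>\<^sub>F t in at_right 0. erfc ((y + c * t) * inverse (2 * sqrt t)) = E0 t x"
    using eventually_at_right_less[of "0::real"]
  proof eventually_elim
    case (elim t)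
    thus ?case using x by (simp only: E0_def E_def y_def c_def divide_inverse if_False less_irrefl) auto
  qed
  ultimately have "((\<lambda>t. E0 t x) \<longlongrightarrow> E0 0 x) (at_right 0)" by (rule Lim_transform_eventually)
  thus ?thesis using True by (simp add: at_within_Ici_at_right)
next
  case False
  hence s0: "s > 0" using s by simp
  define arg where "arg = (\<lambda>t. (ln (norm x) + (real DIM('a) - 2) * t) / (2 * sqrt t))"
  have "isCont erfc (arg s)" using erfc_deriv by (rule DERIV_isCont)
  moreover have "(arg \<longlongrightarrow> arg s) (at s)"
    unfolding arg_def using s0 by (intro tendsto_intros) auto
  ultimately have "((\<lambda>t. erfc (arg t)) \<longlongrightarrow> erfc (arg s)) (at s)" by (rule isCont_tendsto_compose)
  moreover have "\<forall>\<^sub>F t in at s. erfc (arg t) = E0 t x"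
  proof -
    have "\<forall>\<^sub>F t in at s. t \<in> {0<..}" using s0 by (intro eventually_at_in_open') auto
    thus ?thesis by eventually_elim (use x in \<open>simp add: E0_def E_def arg_def\<close>)
  qed
  moreover have "erfc (arg s) = E0 s x" using s0 x by (simp add: E0_def E_def arg_def)
  ultimately have "((\<lambda>t. E0 t x) \<longlongrightarrow> E0 s x) (at s)"
    by (simp only: Lim_transform_eventually)
  thus ?thesis by (rule Lim_at_imp_Lim_at_within)
qed

lemma powr_minus_2: "r powr (- 2) = 1 / r\<^sup>2" if "r \<ge> 0" for r :: real
  using that by (cases "r = 0") (auto simp: powr_minus_divide powr_numeral)

text \<open>One dominating function for all times up to \<open>\<tau>\<close>, as dominated
  convergence in time requires. The bound 2 on the unit ball is integrable against
  \<open>|x|^(-2)\<close> because the dimension is at least 3.\<close>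

lemma E0_majorant:
  assumes dim: "DIM('a::euclidean_space) \<ge> 3"
  obtains G :: "'a::euclidean_space \<Rightarrow> real" where "integrable lebesgue (\<lambda>x. G x / (norm x)\<^sup>2)"
    "\<And>t x. 0 \<le> t \<Longrightarrow> t \<le> \<tau> \<Longrightarrow> E0 t x \<le> G x"
proof -
  define N where "N = real DIM('a)"
  define G where "G = (\<lambda>x::'a. 2 * indicator (ball 0 1) x + exp (N\<^sup>2 * \<tau>) * (indicator (- ball 0 1) x * norm x powr (- N)))"
  have "(\<lambda>x::'a. G x / (norm x)\<^sup>2) = (\<lambda>x. 2 * (indicator (ball 0 1) x * norm x powr (- 2)) +
      exp (N\<^sup>2 * \<tau>) * (indicator (- ball 0 1) x * norm x powr (- (N + 2))))"
  proof
    fix x :: 'a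
    have "norm x powr (- (N + 2)) = norm x powr (- N) / (norm x)\<^sup>2"
    proof -
      have "- (N + 2) = - N + - 2" by simp
      hence "norm x powr (- (N + 2)) = norm x powr (- N) * norm x powr (- 2)" by (simp only: powr_add)
      thus ?thesis by (simp add: powr_minus_2)
    qed
    thus "G x / (norm x)\<^sup>2 = 2 * (indicator (ball 0 1) x * norm x powr (- 2)) +
      exp (N\<^sup>2 * \<tau>) * (indicator (- ball 0 1) x * norm x powr (- (N + 2)))"
      unfolding powr_minus_2[OF norm_ge_zero] G_def by (simp add: add_divide_distrib)
  qed
  moreover have "integrable lborel (\<lambda>x::'a. 2 * (indicator (ball 0 1) x * norm x powr (- 2)) +
      exp (N\<^sup>2 * \<tau>) * (indicator (- ball 0 1) x * norm x powr (- (N + 2))))"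
    using dim by (intro Bochner_Integration.integrable_add integrable_mult_right integrable_powr_ball integrable_powr_outside_ball)
      (auto simp: N_def)
  ultimately have "integrable lborel (\<lambda>x::'a. G x / (norm x)\<^sup>2)" by simp
  hence "integrable lebesgue (\<lambda>x::'a. G x / (norm x)\<^sup>2)"
    by (subst integrable_completion) auto
  moreover have "E0 t x \<le> G x" if "0 \<le> t" "t \<le> \<tau>" for t and x :: 'a
  proof (cases "norm x < 1")
    case True
    thus ?thesis using E0_le_2[of t x] by (simp add: G_def indicator_def)
  next
    case False
    thus ?thesis using E0_decay[OF dim that, of x] by (simp add: G_def indicator_def N_def)
  qed
  ultimately show ?thesis by (rule that)
qed

lemma E0_L12:
  assumes dim: "DIM('a::euclidean_space) \<ge> 3" and t: "t \<ge> 0"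
  shows "(E0 t :: 'a \<Rightarrow> real) \<in> L12"
proof -
  obtain G :: "'a \<Rightarrow> real" where G: "integrable lebesgue (\<lambda>x. G x / (norm x)\<^sup>2)"
    "\<And>s x. 0 \<le> s \<Longrightarrow> s \<le> t \<Longrightarrow> E0 s x \<le> G x"
    using E0_majorant[OF dim] by metis
  have "integrable lebesgue (\<lambda>x::'a. \<bar>E0 t x\<bar> / (norm x)\<^sup>2)"
  proof (rule Bochner_Integration.integrable_bound[OF G(1)])
    show "(\<lambda>x::'a. \<bar>E0 t x\<bar> / (norm x)\<^sup>2) \<in> borel_measurable lebesgue"
      by (intro borel_imp_lebesgue) measurable
    show "AE x in lebesgue. norm (\<bar>E0 t x\<bar> / (norm x)\<^sup>2) \<le> norm (G x / (norm x)\<^sup>2)"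
    proof (rule AE_I2)
      fix x :: 'a
      have "\<bar>E0 t x\<bar> \<le> \<bar>G x\<bar>" using G(2)[OF t order_refl, of x] E0_nonneg[of t x] by simp
      thus "norm (\<bar>E0 t x\<bar> / (norm x)\<^sup>2) \<le> norm (G x / (norm x)\<^sup>2)" by (simp add: divide_right_mono)
    qed
  qed
  thus ?thesis unfolding L12_def using borel_imp_lebesgue[OF E0_borel] by blast
qed

lemma E0_continuous:
  assumes dim: "DIM('a::euclidean_space) \<ge> 3"
  shows "continuous_in_L12 (E0 :: real \<Rightarrow> 'a \<Rightarrow> real)"
  unfolding continuous_in_L12_def
proof (intro conjI allI impI)
  show "E0 t \<in> (L12 :: ('a \<Rightarrow> real) set)" if "t \<ge> 0" for t using E0_L12[OF dim that] .
  fix s :: real assume s: "s \<ge> 0"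
  show "((\<lambda>t. L12_norm (\<lambda>x::'a. E0 t x - E0 s x)) \<longlongrightarrow> 0) (at s within {0..})"
    unfolding tendsto_at_iff_sequentially comp_def
  proof (intro allI impI)
    fix t :: "nat \<Rightarrow> real" assume t: "\<forall>i. t i \<in> {0..} - {s}" "t \<longlonglongrightarrow> s"
    \<comment> \<open>A convergent sequence of times is bounded, so a single majorant serves the
      whole sequence.\<close>
    have "Bseq t" using t(2) by (meson convergentI convergent_imp_Bseq)
    then obtain \<tau> where \<tau>: "\<And>n. \<bar>t n\<bar> \<le> \<tau>" unfolding Bseq_def by auto
    obtain G :: "'a \<Rightarrow> real" where G: "integrable lebesgue (\<lambda>x. G x / (norm x)\<^sup>2)"
      "\<And>r x. 0 \<le> r \<Longrightarrow> r \<le> max \<tau> s \<Longrightarrow> E0 r x \<le> G x"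
      using E0_majorant[OF dim] by metis
    have tn: "0 \<le> t n" "t n \<le> max \<tau> s" for n using t(1) \<tau>[of n] by auto
    have "(\<lambda>n. LINT x|lebesgue. \<bar>E0 (t n) (x::'a) - E0 s x\<bar> / (norm x)\<^sup>2) \<longlonglongrightarrow> (LINT x|(lebesgue :: 'a measure). 0)"
    proof (rule integral_dominated_convergence[OF _ _ G(1)])
      show "(\<lambda>x::'a. \<bar>E0 (t n) x - E0 s x\<bar> / (norm x)\<^sup>2) \<in> borel_measurable lebesgue" for n
        by (intro borel_imp_lebesgue) measurable
      have "AE x in lborel. x \<noteq> (0::'a)" by (rule AE_lborel_singleton)
      moreover have "AE x in lborel. x \<notin> sphere (0::'a) 1"
        using negligible_sphere[of "0::'a" 1] AE_not_in[of "sphere (0::'a) 1" lebesgue]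
        by (simp add: negligible_iff_null_sets AE_completion_iff)
      ultimately have "AE x in lborel. x \<noteq> (0::'a) \<and> x \<notin> sphere (0::'a) 1" by eventually_elim auto
      hence "AE x in lebesgue. x \<noteq> (0::'a) \<and> x \<notin> sphere (0::'a) 1" by (rule AE_completion)
      thus "AE x in lebesgue. (\<lambda>n. \<bar>E0 (t n) (x::'a) - E0 s x\<bar> / (norm x)\<^sup>2) \<longlonglongrightarrow> 0"
      proof eventually_elim
        case (elim x)
        have "((\<lambda>t. E0 t x) \<longlongrightarrow> E0 s x) (at s within {0..})"
          using elim s by (intro E0_tendsto) auto
        hence "(\<lambda>n. E0 (t n) x) \<longlonglongrightarrow> E0 s x"
          using t unfolding tendsto_at_iff_sequentially comp_def by blast
        hence "(\<lambda>n. \<bar>E0 (t n) x - E0 s x\<bar> / (norm x)\<^sup>2) \<longlonglongrightarrow> \<bar>E0 s x - E0 s x\<bar> / (norm x)\<^sup>2"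
          using elim by (intro tendsto_intros) auto
        thus ?case by simp
      qed
      show "AE x in lebesgue. norm (\<bar>E0 (t n) (x::'a) - E0 s x\<bar> / (norm x)\<^sup>2) \<le> G x / (norm x)\<^sup>2" for n
      proof (rule AE_I2)
        fix x :: 'a
        have "\<bar>E0 (t n) x - E0 s x\<bar> \<le> G x"
          using G(2)[OF tn, of n x] G(2)[OF s, of x] E0_nonneg[of "t n" x] E0_nonneg[of s x] by simp
        thus "norm (\<bar>E0 (t n) x - E0 s x\<bar> / (norm x)\<^sup>2) \<le> G x / (norm x)\<^sup>2" by (simp add: divide_right_mono)
      qed
    qed simp
    thus "(\<lambda>n. L12_norm (\<lambda>x::'a. E0 (t n) x - E0 s x)) \<longlonglongrightarrow> 0" by (simp add: L12_norm_def)
  qed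
qed

lemma continuous_in_L12_abs_diff:
  fixes u v :: "real \<Rightarrow> 'a::euclidean_space \<Rightarrow> real"
  assumes u: "continuous_in_L12 u" and v: "continuous_in_L12 v"
  shows "continuous_in_L12 (\<lambda>t x. \<bar>u t x - c * v t x\<bar>)"
  unfolding continuous_in_L12_def
proof (intro conjI allI impI)
  have cv: "(\<lambda>x. c * v t x) \<in> L12" if "t \<ge> 0" for t
  proof -
    have "v t \<in> L12" using v that by (simp add: continuous_in_L12_def)
    hence m: "v t \<in> borel_measurable lebesgue" and i: "integrable lebesgue (\<lambda>x. \<bar>v t x\<bar> / (norm x)\<^sup>2)"
      by (auto simp: L12_def)
    have "(\<lambda>x. \<bar>c * v t x\<bar> / (norm x)\<^sup>2) = (\<lambda>x. \<bar>c\<bar> * (\<bar>v t x\<bar> / (norm x)\<^sup>2))"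
      by (simp add: abs_mult)
    hence "integrable lebesgue (\<lambda>x. \<bar>c * v t x\<bar> / (norm x)\<^sup>2)"
      using integrable_mult_right[OF i, of "\<bar>c\<bar>"] by (simp only:)
    moreover have "(\<lambda>x. c * v t x) \<in> borel_measurable lebesgue"
      by (intro borel_measurable_times borel_measurable_const m)
    ultimately show ?thesis unfolding L12_def by blast
  qed
  have uL: "u t \<in> L12" if "t \<ge> 0" for t using u that by (simp add: continuous_in_L12_def)
  show mem: "(\<lambda>x. \<bar>u t x - c * v t x\<bar>) \<in> L12" if "t \<ge> 0" for t
    using that by (intro L12_abs L12_diff uL cv)
  fix s :: real assume s: "s \<ge> 0"
  show "((\<lambda>t. L12_norm (\<lambda>x. \<bar>u t x - c * v t x\<bar> - \<bar>u s x - c * v s x\<bar>)) \<longlongrightarrow> 0) (at s within {0..})"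
  proof (rule Lim_null_comparison)
    show "\<forall>\<^sub>F t in at s within {0..}. norm (L12_norm (\<lambda>x. \<bar>u t x - c * v t x\<bar> - \<bar>u s x - c * v s x\<bar>))
       \<le> L12_norm (\<lambda>x. u t x - u s x) + \<bar>c\<bar> * L12_norm (\<lambda>x. v t x - v s x)"
    proof (rule eventually_mono[of "\<lambda>t. t \<in> {0..}"])
      show "\<forall>\<^sub>F t in at s within {0..}. t \<in> {0..}" by (simp add: eventually_at_filter)
      fix t :: real assume "t \<in> {0..}"
      hence t: "t \<ge> 0" by simp
      have vL: "v t \<in> L12" "v s \<in> L12" using v s t by (auto simp: continuous_in_L12_def)
      have i1: "integrable lebesgue (\<lambda>x. \<bar>u t x - u s x\<bar> / (norm x)\<^sup>2)" using L12_diff[OF uL[OF t] uL[OF s]] by (simp add: L12_def)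
      have i2: "integrable lebesgue (\<lambda>x. \<bar>v t x - v s x\<bar> / (norm x)\<^sup>2)" using L12_diff[OF vL] by (simp add: L12_def)
      have i3: "integrable lebesgue (\<lambda>x. \<bar>\<bar>u t x - c * v t x\<bar> - \<bar>u s x - c * v s x\<bar>\<bar> / (norm x)\<^sup>2)"
        using L12_diff[OF mem[OF t] mem[OF s]] by (simp add: L12_def)
      have "L12_norm (\<lambda>x. \<bar>u t x - c * v t x\<bar> - \<bar>u s x - c * v s x\<bar>)
         \<le> (LINT x|lebesgue. \<bar>u t x - u s x\<bar> / (norm x)\<^sup>2 + \<bar>c\<bar> * (\<bar>v t x - v s x\<bar> / (norm x)\<^sup>2))"
        unfolding L12_norm_def
      proof (rule integral_mono[OF i3 Bochner_Integration.integrable_add[OF i1 integrable_mult_right[OF i2]]])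
        fix x
        have "\<bar>c * v t x - c * v s x\<bar> = \<bar>c\<bar> * \<bar>v t x - v s x\<bar>"
          by (simp add: right_diff_distrib[symmetric] abs_mult)
        hence "\<bar>\<bar>u t x - c * v t x\<bar> - \<bar>u s x - c * v s x\<bar>\<bar> \<le> \<bar>u t x - u s x\<bar> + \<bar>c\<bar> * \<bar>v t x - v s x\<bar>"
          by linarith
        from divide_right_mono[OF this, of "(norm x)\<^sup>2"]
        show "\<bar>\<bar>u t x - c * v t x\<bar> - \<bar>u s x - c * v s x\<bar>\<bar> / (norm x)\<^sup>2
           \<le> \<bar>u t x - u s x\<bar> / (norm x)\<^sup>2 + \<bar>c\<bar> * (\<bar>v t x - v s x\<bar> / (norm x)\<^sup>2)"
          by (simp add: add_divide_distrib)
      qed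
      also have "\<dots> = L12_norm (\<lambda>x. u t x - u s x) + \<bar>c\<bar> * L12_norm (\<lambda>x. v t x - v s x)"
        unfolding L12_norm_def
        by (simp only: Bochner_Integration.integral_add[OF i1 integrable_mult_right[OF i2]] integral_mult_right_zero)
      finally show "norm (L12_norm (\<lambda>x. \<bar>u t x - c * v t x\<bar> - \<bar>u s x - c * v s x\<bar>))
         \<le> L12_norm (\<lambda>x. u t x - u s x) + \<bar>c\<bar> * L12_norm (\<lambda>x. v t x - v s x)"
        by (simp add: L12_norm_def)
    qed
    have "((\<lambda>t. L12_norm (\<lambda>x. u t x - u s x) + \<bar>c\<bar> * L12_norm (\<lambda>x. v t x - v s x)) \<longlongrightarrow> 0 + \<bar>c\<bar> * 0) (at s within {0..})"
      using u v s unfolding continuous_in_L12_def by (intro tendsto_intros) auto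
    thus "((\<lambda>t. L12_norm (\<lambda>x. u t x - u s x) + \<bar>c\<bar> * L12_norm (\<lambda>x. v t x - v s x)) \<longlongrightarrow> 0) (at s within {0..})" by simp
  qed
qed

section \<open>From strong solutions to subsolutions\<close>

text \<open>Convolution and Fubini are carried out over \<open>lborel\<close>, while the solution
  concept provides Lebesgue measurable functions.\<close>

lemma borel_version:
  fixes h :: "'c::euclidean_space \<Rightarrow> real"
  assumes S: "S \<in> sets borel" and h: "h \<in> borel_measurable (lebesgue_on S)"
  obtains h' where "h' \<in> borel_measurable borel" "AE p in lborel. p \<in> S \<longrightarrow> h' p = h p"
proof -
  have "(\<lambda>p. if p \<in> S then h p else 0) \<in> borel_measurable lebesgue"
    using S h by (subst borel_measurable_if) auto
  then obtain g where g: "g \<in> borel_measurable lborel" "AE p in lborel. (if p \<in> S then h p else 0) = g p"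
    using completion_ex_borel_measurable_real by blast
  have "AE p in lborel. p \<in> S \<longrightarrow> g p = h p" using g(2) by eventually_elim auto
  thus ?thesis using that g(1) by simp
qed

lemma L1_loc_borel_version:
  fixes h :: "'c::euclidean_space \<Rightarrow> real"
  assumes S: "S \<in> sets borel" and h: "h \<in> L1_loc S"
  shows "\<exists>h'. h' \<in> borel_measurable borel \<and> (AE p in lborel. p \<in> S \<longrightarrow> h' p = h p) \<and>
    (\<forall>K. compact K \<longrightarrow> K \<subseteq> S \<longrightarrow> integrable lborel (\<lambda>p. indicator K p * h' p))"
proof -
  have "h \<in> borel_measurable (lebesgue_on S)" using h by (simp add: L1_loc_def)
  then obtain h' where h': "h' \<in> borel_measurable borel" "AE p in lborel. p \<in> S \<longrightarrow> h' p = h p"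
    by (rule borel_version[OF S])
  have "integrable lborel (\<lambda>p. indicator K p * h' p)" if K: "compact K" "K \<subseteq> S" for K
  proof -
    have Kb: "K \<in> sets borel" using K by (simp add: borel_compact)
    have "integrable (lebesgue_on K) h" using h K by (simp add: L1_loc_def)
    hence i: "integrable lebesgue (\<lambda>p. indicator K p *\<^sub>R h p)"
      using Kb by (subst (asm) integrable_restrict_space) auto
    have m: "(\<lambda>p. indicator K p * h' p) \<in> borel_measurable borel" using h'(1) Kb by measurable
    have "AE p in lebesgue. p \<in> S \<longrightarrow> h' p = h p" using h'(2) by (rule AE_completion)
    hence "AE p in lebesgue. indicator K p *\<^sub>R h p = indicator K p * h' p"
      by eventually_elim (use K in \<open>auto simp: indicator_def\<close>)
    hence "integrable lebesgue (\<lambda>p. indicator K p * h' p)"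
      using integrable_cong_AE[of "\<lambda>p. indicator K p *\<^sub>R h p" lebesgue "\<lambda>p. indicator K p * h' p"] i borel_imp_lebesgue[OF m]
      by auto
    thus ?thesis using m by (simp add: integrable_completion)
  qed
  thus ?thesis using h' by blast
qed

lemma dir_deriv_zero_on_open:
  assumes "open V" "p \<in> V" "\<And>q. q \<in> V \<Longrightarrow> f q = 0" shows "dir_deriv b f p = 0"
proof -
  have "(f has_derivative (\<lambda>_. 0)) (at p)"
    by (rule has_derivative_transform_within_open[of "\<lambda>_. 0" _ _ _ V]) (use assms in auto)
  thus ?thesis by (simp add: dir_deriv_eq)
qed

lemma test_function_zero:
  assumes "\<phi> \<in> test_functions S" "p \<notin> S"
  shows "\<phi> p = 0" "dir_deriv b \<phi> p = 0" "dir_deriv b' (dir_deriv b \<phi>) p = 0"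
proof -
  define V where "V = - closure {p. \<phi> p \<noteq> 0}"
  have V: "open V" "p \<in> V" using assms by (auto simp: V_def test_functions_def)
  have 0: "\<phi> q = 0" if "q \<in> V" for q
    using that closure_subset[of "{p. \<phi> p \<noteq> 0}"] by (auto simp: V_def)
  have 1: "dir_deriv b \<phi> q = 0" if "q \<in> V" for q
    using dir_deriv_zero_on_open[OF V(1) that, of \<phi>] 0 by blast
  show "\<phi> p = 0" "dir_deriv b \<phi> p = 0" using 0 1 V by auto
  show "dir_deriv b' (dir_deriv b \<phi>) p = 0"
    using dir_deriv_zero_on_open[OF V, of "dir_deriv b \<phi>"] 1 by blast
qed

lemma test_function_continuous:
  assumes "\<phi> \<in> test_functions S"
  shows "continuous_on UNIV \<phi>" "b \<in> Basis \<Longrightarrow> continuous_on UNIV (dir_deriv b \<phi>)"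
    "b \<in> Basis \<Longrightarrow> b' \<in> Basis \<Longrightarrow> continuous_on UNIV (dir_deriv b' (dir_deriv b \<phi>))"
proof -
  have C: "\<And>k. Ck k \<phi>" using assms by (simp add: test_functions_def)
  show "continuous_on UNIV \<phi>" using C[of 0] by simp
  show "b \<in> Basis \<Longrightarrow> continuous_on UNIV (dir_deriv b \<phi>)" using C[of "Suc 0"] by simp
  show "b \<in> Basis \<Longrightarrow> b' \<in> Basis \<Longrightarrow> continuous_on UNIV (dir_deriv b' (dir_deriv b \<phi>))"
    using C[of "Suc (Suc 0)"] by simp
qed

text \<open>Test functions supported inside \<open>L\<close> do not see the truncation by
  \<open>indicator L\<close>, so the distributional identities carry over to functions integrable on
  the whole space.\<close>

lemma integral_localize:
  fixes h h' \<psi> :: "'c::euclidean_space \<Rightarrow> real"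
  assumes S: "S \<in> sets borel" and L: "compact L" "L \<subseteq> S" and T: "T \<subseteq> L"
    and h: "h \<in> borel_measurable (lebesgue_on S)"
    and h': "h' \<in> borel_measurable borel" "AE p in lborel. p \<in> S \<longrightarrow> h' p = h p"
    and \<psi>: "continuous_on UNIV \<psi>" "\<And>p. p \<notin> T \<Longrightarrow> \<psi> p = 0"
  shows "(LINT p|lebesgue_on S. h p * \<psi> p) = (LINT p|lborel. (indicator L p * h' p) * \<psi> p)"
proof -
  have \<psi>m: "\<psi> \<in> borel_measurable borel" using \<psi>(1) by (rule borel_measurable_continuous_onI)
  have Lb: "L \<in> sets borel" using L by (simp add: borel_compact)
  have m: "(\<lambda>p. (indicator L p * h' p) * \<psi> p) \<in> borel_measurable borel"
    using Lb h' \<psi>m by measurable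
  have "(LINT p|lebesgue_on S. h p * \<psi> p) = (LINT p|lebesgue. indicator S p *\<^sub>R (h p * \<psi> p))"
    using S by (subst integral_restrict_space) auto
  also have "\<dots> = (LINT p|lebesgue. (indicator L p * h' p) * \<psi> p)"
  proof (rule integral_cong_AE)
    have "(\<lambda>p. (if p \<in> S then h p else 0) * \<psi> p) \<in> borel_measurable lebesgue"
      using S h borel_imp_lebesgue[OF \<psi>m] by (intro borel_measurable_times) (auto simp: borel_measurable_if)
    also have "(\<lambda>p. (if p \<in> S then h p else 0) * \<psi> p) = (\<lambda>p. indicator S p *\<^sub>R (h p * \<psi> p))"
      by (auto simp: indicator_def)
    finally show "(\<lambda>p. indicator S p *\<^sub>R (h p * \<psi> p)) \<in> borel_measurable lebesgue" .
    show "(\<lambda>p. (indicator L p * h' p) * \<psi> p) \<in> borel_measurable lebesgue" by (rule borel_imp_lebesgue[OF m])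
    have "AE p in lebesgue. p \<in> S \<longrightarrow> h' p = h p" using h'(2) by (rule AE_completion)
    thus "AE p in lebesgue. indicator S p *\<^sub>R (h p * \<psi> p) = (indicator L p * h' p) * \<psi> p"
    proof eventually_elim
      case (elim p)
      show ?case using elim \<psi>(2)[of p] L T by (cases "p \<in> T") (auto simp: indicator_def)
    qed
  qed
  also have "\<dots> = (LINT p|lborel. (indicator L p * h' p) * \<psi> p)"
    using m by (simp add: integral_completion)
  finally show ?thesis .
qed

text \<open>\<open>kato\<close> wants globally integrable functions satisfying the equation on a
  neighbourhood of the test support: the compact \<open>L\<close> carries the truncation, the open
  \<open>V\<close> inside it the equation.\<close>

lemma compact_neighbourhood_between:
  fixes K :: "'c::euclidean_space set"
  assumes "compact K" "open S" "K \<subseteq> S"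
  obtains V L where "open V" "compact L" "K \<subseteq> V" "V \<subseteq> L" "L \<subseteq> S"
proof (cases "K = {}")
  case True
  thus ?thesis using that[of "{}" "{}"] by simp
next
  case False
  obtain \<epsilon> where \<epsilon>: "\<epsilon> > 0" "(\<Union>x\<in>K. cball x \<epsilon>) \<subseteq> S"
    using compact_subset_open_imp_cball_epsilon_subset[OF assms] by blast
  define V where "V = {x. infdist x K < \<epsilon>}"
  define L where "L = {x. infdist x K \<le> \<epsilon>}"
  have "open V" unfolding V_def by (intro open_Collect_less continuous_intros)
  moreover have "compact L" unfolding L_def by (rule compact_infdist_le[OF False assms(1) \<epsilon>(1)])
  moreover have "K \<subseteq> V" using \<epsilon> by (auto simp: V_def)
  moreover have "V \<subseteq> L" by (auto simp: V_def L_def)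
  moreover have "L \<subseteq> S"
  proof
    fix x assume "x \<in> L"
    obtain y where y: "y \<in> K" "infdist x K = dist x y"
      by (rule infdist_attains_inf[OF compact_imp_closed[OF assms(1)] False])
    have "dist y x \<le> \<epsilon>" using \<open>x \<in> L\<close> y(2) dist_commute[of x y] by (simp add: L_def)
    hence "x \<in> cball y \<epsilon>" by simp
    thus "x \<in> S" using y(1) \<epsilon>(2) by blast
  qed
  ultimately show ?thesis by (rule that)
qed

lemma strong_solution_subsolution:
  fixes u :: "real \<Rightarrow> 'a::euclidean_space \<Rightarrow> real"
  assumes dim: "DIM('a) \<ge> 3" and u: "strong_solution u0 u"
  shows "\<exists>W. L12_subsolution (\<lambda>t x. \<bar>u t x - K / 2 * E0 t x\<bar>) W"
proof -
  let ?Q = "Qstar :: ('a \<times> real) set"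
  have Qb: "?Q \<in> sets borel" by (rule borel_open[OF open_Qstar])
  have weak: "weak_solution u0 u" using u by (simp add: strong_solution_def)
  obtain v w where v: "distr_time_deriv ?Q (spacetime u) v" and w: "distr_laplacian ?Q (spacetime u) w"
    and eq: "AE p in lebesgue_on ?Q. v p / (norm (fst p))\<^sup>2 = w p"
    using u by (auto simp: strong_solution_def)
  have loc: "spacetime u \<in> L1_loc ?Q" "v \<in> L1_loc ?Q" "w \<in> L1_loc ?Q"
    using v w by (auto simp: distr_time_deriv_def distr_laplacian_def)
  have um: "spacetime u \<in> borel_measurable (lebesgue_on ?Q)" and vm: "v \<in> borel_measurable (lebesgue_on ?Q)"
    and wm: "w \<in> borel_measurable (lebesgue_on ?Q)" using loc by (auto simp: L1_loc_def)
  obtain U where U: "U \<in> borel_measurable borel" "AE p in lborel. p \<in> ?Q \<longrightarrow> U p = spacetime u p"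
    "\<And>K. compact K \<Longrightarrow> K \<subseteq> ?Q \<Longrightarrow> integrable lborel (\<lambda>p. indicator K p * U p)"
    using L1_loc_borel_version[OF Qb loc(1)] by blast
  obtain V where V: "V \<in> borel_measurable borel" "AE p in lborel. p \<in> ?Q \<longrightarrow> V p = v p"
    "\<And>K. compact K \<Longrightarrow> K \<subseteq> ?Q \<Longrightarrow> integrable lborel (\<lambda>p. indicator K p * V p)"
    using L1_loc_borel_version[OF Qb loc(2)] by blast
  obtain G where G: "G \<in> borel_measurable borel" "AE p in lborel. p \<in> ?Q \<longrightarrow> G p = w p"
    "\<And>K. compact K \<Longrightarrow> K \<subseteq> ?Q \<Longrightarrow> integrable lborel (\<lambda>p. indicator K p * G p)"
    using L1_loc_borel_version[OF Qb loc(3)] by blast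
  have VG: "AE p in lborel. p \<in> ?Q \<longrightarrow> V p / (norm (fst p))\<^sup>2 = G p"
  proof -
    have "AE p in lebesgue. p \<in> ?Q \<longrightarrow> v p / (norm (fst p))\<^sup>2 = w p"
      using eq Qb by (subst (asm) AE_restrict_space_iff) auto
    hence "AE p in lborel. p \<in> ?Q \<longrightarrow> v p / (norm (fst p))\<^sup>2 = w p" by (simp add: AE_completion_iff)
    thus ?thesis using V(2) G(2) by eventually_elim auto
  qed
  define e where "e = (\<lambda>p :: 'a \<times> real. K / 2 * E (fst p) (snd p))"
  obtain ex exx et where e: "C21 ?Q e ex exx et" "\<And>p. p \<in> ?Q \<Longrightarrow> heat_op exx (\<lambda>p. - et p) p = 0"
    using E_C21[of "K / 2", where 'a='a] unfolding e_def by blast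
  have e_cont: "continuous_on ?Q e" using e(1) by (simp add: C21_def)
  have em: "(\<lambda>p. indicator ?Q p * e p) \<in> borel_measurable borel"
    using borel_measurable_continuous_on_indicator[OF Qb e_cont] by simp
  \<comment> \<open>The indicator makes the profile Borel measurable on the whole space. On
    \<open>Qstar\<close> time is positive, so \<open>E\<close> and \<open>E0\<close> agree
    there.\<close>
  define W where "W = (\<lambda>p. \<bar>U p - indicator ?Q p * e p\<bar>)"
  have "L12_subsolution (\<lambda>t x. \<bar>u t x - K / 2 * E0 t x\<bar>) W"
  proof
    show "3 \<le> DIM('a)" by (rule dim)
    show "continuous_in_L12 (\<lambda>t x. \<bar>u t x - K / 2 * E0 t x\<bar>)"
      using weak by (intro continuous_in_L12_abs_diff E0_continuous dim) (simp add: weak_solution_def)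
    show "W \<in> borel_measurable borel" unfolding W_def using U(1) em by measurable
    show "AE p in lborel. p \<in> ?Q \<longrightarrow> W p = \<bar>u (snd p) (fst p) - K / 2 * E0 (snd p) (fst p)\<bar>"
      using U(2)
    proof eventually_elim
      case (elim p)
      thus ?case by (auto simp: W_def spacetime_def e_def E0_def Qstar_eq case_prod_unfold)
    qed
    show "integrable lborel (\<lambda>p. indicator L p * W p)" if L: "compact L" "L \<subseteq> ?Q" for L
    proof -
      have "integrable lborel (\<lambda>p. \<bar>indicator L p * U p - indicator L p * e p\<bar>)"
        using U(3)[OF L] integrable_indicator_compact[OF L(1) continuous_on_subset[OF e_cont L(2)]] by auto
      moreover have "(\<lambda>p. \<bar>indicator L p * U p - indicator L p * e p\<bar>) = (\<lambda>p. indicator L p * W p)"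
        using L(2) by (auto simp: W_def indicator_def fun_eq_iff)
      ultimately show ?thesis by simp
    qed
    fix S L \<phi> \<phi>x \<phi>xx \<phi>t
    assume S: "open S" "S \<subseteq> ?Q" and L: "compact L" "L \<subseteq> S" and \<phi>: "C21 S \<phi> \<phi>x \<phi>xx \<phi>t"
      and \<phi>0: "\<And>p. p \<in> S - L \<Longrightarrow> \<phi> p = 0" "\<And>p. p \<in> L \<Longrightarrow> 0 \<le> \<phi> p"
    obtain S' M where S': "open S'" "compact M" "L \<subseteq> S'" "S' \<subseteq> M" "M \<subseteq> S"
      by (rule compact_neighbourhood_between[OF L(1) S(1) L(2)])
    have MQ: "M \<subseteq> ?Q" and S'Q: "S' \<subseteq> ?Q" and S'S: "S' \<subseteq> S" using S' S by auto
    have tf: "\<phi> \<in> test_functions ?Q" if "\<phi> \<in> test_functions S'" for \<phi>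
      using that S'Q by (auto simp: test_functions_def)
    have B: "(0, 1) \<in> (Basis :: ('a \<times> real) set)" "b \<in> Basis \<Longrightarrow> (b, 0) \<in> (Basis :: ('a \<times> real) set)" for b
      by (auto simp: Basis_prod_def)
    have "0 \<le> (LINT p|lborel. indicator L p * (\<bar>indicator M p * U p - e p\<bar> * heat_op \<phi>xx \<phi>t p))"
    proof (rule kato[OF S'(1) L(1) S'(3) _ U(3)[OF S'(2) MQ] V(3)[OF S'(2) MQ] G(3)[OF S'(2) MQ]])
      show "fst p \<noteq> 0" if "p \<in> S'" for p using that S'Q by (auto simp: Qstar_eq)
      show "AE p in lborel. p \<in> L \<longrightarrow> indicator M p * V p / (norm (fst p))\<^sup>2 = indicator M p * G p"
        using VG by eventually_elim (use MQ S' in \<open>auto simp: indicator_def\<close>)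
      show "C21 S' e ex exx et" by (rule C21_subset[OF e(1) S'Q])
      show "heat_op exx (\<lambda>p. - et p) p = 0" if "p \<in> S'" for p by (rule e(2)[OF subsetD[OF S'Q that]])
      show "C21 S' \<phi> \<phi>x \<phi>xx \<phi>t" by (rule C21_subset[OF \<phi> S'S])
      show "\<phi> p = 0" if "p \<in> S' - L" for p by (rule \<phi>0(1)) (use that S'S in blast)
      show "\<phi> p \<ge> 0" if "p \<in> L" for p using that by (rule \<phi>0(2))
      fix \<psi> :: "'a \<times> real \<Rightarrow> real" assume \<psi>: "\<psi> \<in> test_functions S'"
      note z = test_function_zero[OF \<psi>] and c = test_function_continuous[OF \<psi>]
      have tc: "continuous_on UNIV (time_deriv \<psi>)" unfolding time_deriv_def by (rule c(2)[OF B(1)])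
      have lc: "continuous_on UNIV (space_laplacian \<psi>)" unfolding space_laplacian_def
        by (intro continuous_on_sum c(3) B(2))
      have tz: "time_deriv \<psi> p = 0" and lz: "space_laplacian \<psi> p = 0" if "p \<notin> S'" for p
        using z[OF that] by (simp_all add: time_deriv_def space_laplacian_def)
      have "(LINT p|lebesgue_on ?Q. spacetime u p * time_deriv \<psi> p) = - (LINT p|lebesgue_on ?Q. v p * \<psi> p)"
        using v tf[OF \<psi>] by (simp add: distr_time_deriv_def)
      thus "(LINT p|lborel. indicator M p * U p * time_deriv \<psi> p) = - (LINT p|lborel. indicator M p * V p * \<psi> p)"
        using integral_localize[OF Qb S'(2) MQ S'(4) um U(1,2) tc tz]
          integral_localize[OF Qb S'(2) MQ S'(4) vm V(1,2) c(1) z(1)] by simp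
      have "(LINT p|lebesgue_on ?Q. spacetime u p * space_laplacian \<psi> p) = (LINT p|lebesgue_on ?Q. w p * \<psi> p)"
        using w tf[OF \<psi>] by (simp add: distr_laplacian_def)
      thus "(LINT p|lborel. indicator M p * U p * space_laplacian \<psi> p) = (LINT p|lborel. indicator M p * G p * \<psi> p)"
        using integral_localize[OF Qb S'(2) MQ S'(4) um U(1,2) lc lz]
          integral_localize[OF Qb S'(2) MQ S'(4) wm G(1,2) c(1) z(1)] by simp
    qed
    moreover have "(\<lambda>p. indicator L p * (\<bar>indicator M p * U p - e p\<bar> * heat_op \<phi>xx \<phi>t p)) =
        (\<lambda>p. indicator L p * (W p * heat_op \<phi>xx \<phi>t p))"
    proof
      fix p
      show "indicator L p * (\<bar>indicator M p * U p - e p\<bar> * heat_op \<phi>xx \<phi>t p) = indicator L p * (W p * heat_op \<phi>xx \<phi>t p)"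
      proof (cases "p \<in> L")
        case True
        hence "p \<in> M" "p \<in> ?Q" using S' MQ by auto
        thus ?thesis by (simp add: W_def)
      qed simp
    qed
    ultimately show "0 \<le> (LINT p|lborel. indicator L p * (W p * heat_op \<phi>xx \<phi>t p))" by simp
  qed simp
  thus ?thesis by blast
qed

text \<open>Near the origin the integrand is at most \<open>|x|^(\<delta> - N)\<close>, near
  infinity at most \<open>|x|^(- N - \<epsilon>)\<close>, both integrable with a strict margin. In
  between, \<open>|x|^(-N)\<close> is bounded by a multiple of \<open>|x|^(-2)\<close>, so that
  \<open>u0 \<in> L12\<close> and the bounded profile suffice.\<close>

lemma initial_deviation_integrable:
  fixes u0 :: "'a::euclidean_space \<Rightarrow> real"
  assumes dim: "DIM('a) \<ge> 3" and u0: "u0 \<in> L12" "\<And>x. u0 x \<ge> 0" and K: "K \<ge> 0"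
    and pos: "\<delta> > 0" "\<epsilon> > 0"
    and near: "\<forall>\<^sub>F x in at 0. \<bar>K - u0 x\<bar> \<le> norm x powr \<delta>"
    and far: "\<forall>\<^sub>F x in at_infinity. u0 x \<le> norm x powr (- \<epsilon>)"
  shows "integrable lebesgue (\<lambda>x. \<bar>u0 x - K / 2 * E0 0 x\<bar> * norm x powr (- real DIM('a)))"
proof -
  define N where "N = real DIM('a)"
  have N: "N \<ge> 3" using dim by (simp add: N_def)
  \<comment> \<open>A large \<open>\<delta>\<close> is reduced to keep the exponent
    \<open>N - d\<close> nonnegative, as \<open>integrable_powr_ball\<close> requires.\<close>
  define d where "d = min \<delta> 1"
  have d: "0 < d" "d \<le> 1" "d \<le> \<delta>" using pos by (auto simp: d_def)
  obtain r0 where r0: "r0 > 0" "\<And>x. x \<noteq> 0 \<Longrightarrow> norm x < r0 \<Longrightarrow> \<bar>K - u0 x\<bar> \<le> norm x powr \<delta>"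
    using near unfolding eventually_at by auto
  obtain R0 where R0: "\<And>x. norm x \<ge> R0 \<Longrightarrow> u0 x \<le> norm x powr (- \<epsilon>)"
    using far unfolding eventually_at_infinity by auto
  define r where "r = min r0 1"
  have r: "0 < r" "r \<le> 1" "r \<le> r0" using r0 by (auto simp: r_def)
  define R where "R = max R0 1"
  define M where "M = r powr (- (N - 2))"
  have M: "M \<ge> 0" by (simp add: M_def)
  define D where "D = (\<lambda>x::'a. indicator (ball 0 1) x * norm x powr (- (N - d)) + indicator (- ball 0 1) x * norm x powr (- (N + \<epsilon>))
     + M * (u0 x / (norm x)\<^sup>2) + indicator (ball 0 1) x * (K * r powr (- N)))"
  have M2: "norm x powr (- N) \<le> M / (norm x)\<^sup>2" if "norm x \<ge> r" for x :: 'a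
  proof -
    have x0: "norm x > 0" using that r by linarith
    have "- N = - (N - 2) + - 2" by simp
    hence "norm x powr (- N) = norm x powr (- (N - 2)) * norm x powr (- 2)" by (simp only: powr_add)
    also have "norm x powr (- (N - 2)) \<le> M" unfolding M_def using that r N by (intro powr_mono2') auto
    finally show ?thesis using x0 by (simp add: powr_minus_2 mult_right_mono divide_inverse)
  qed
  have "integrable lborel (\<lambda>x::'a. indicator (ball 0 1) x * norm x powr (- (N - d)))"
    using d N by (intro integrable_powr_ball) (auto simp: N_def)
  hence i1: "integrable lebesgue (\<lambda>x::'a. indicator (ball 0 1) x * norm x powr (- (N - d)))"
    by (subst integrable_completion) auto
  have "integrable lborel (\<lambda>x::'a. indicator (- ball 0 1) x * norm x powr (- (N + \<epsilon>)))"
    using pos by (intro integrable_powr_outside_ball) (auto simp: N_def)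
  hence i2: "integrable lebesgue (\<lambda>x::'a. indicator (- ball 0 1) x * norm x powr (- (N + \<epsilon>)))"
    by (subst integrable_completion) auto
  have i3: "integrable lebesgue (\<lambda>x. M * (u0 x / (norm x)\<^sup>2))"
    by (intro integrable_mult_right L12_integrable u0)
  have "integrable lborel (\<lambda>x::'a. indicator (ball 0 1) x * (K * r powr (- N)))"
    using emeasure_bounded_finite[of "ball (0::'a) 1"] by (intro integrable_mult_left integrable_real_indicator) auto
  hence i4: "integrable lebesgue (\<lambda>x::'a. indicator (ball 0 1) x * (K * r powr (- N)))"
    by (subst integrable_completion) auto
  have Di: "integrable lebesgue D"
    unfolding D_def by (intro Bochner_Integration.integrable_add i1 i2 i3 i4)
  show ?thesis
    unfolding N_def[symmetric]
  proof (rule Bochner_Integration.integrable_bound[OF Di])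
    have "u0 \<in> borel_measurable lebesgue" using u0 by (simp add: L12_def)
    moreover have "(E0 0 :: 'a \<Rightarrow> real) \<in> borel_measurable lebesgue" by (rule borel_imp_lebesgue[OF E0_borel])
    moreover have "(\<lambda>x::'a. norm x powr (- N)) \<in> borel_measurable lebesgue"
      by (intro borel_imp_lebesgue powr_real_measurable) auto
    ultimately show "(\<lambda>x. \<bar>u0 x - K / 2 * E0 0 x\<bar> * norm x powr (- N)) \<in> borel_measurable lebesgue"
      by (intro borel_measurable_times borel_measurable_abs borel_measurable_diff borel_measurable_const)
    show "AE x in lebesgue. norm (\<bar>u0 x - K / 2 * E0 0 x\<bar> * norm x powr (- N)) \<le> norm (D x)"
    proof (rule AE_I2)
      fix x :: 'a
      define A where "A = norm x powr (- N)"
      have A: "A \<ge> 0" by (simp add: A_def)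
      have terms: "0 \<le> indicator (ball 0 1) x * norm x powr (- (N - d))" "0 \<le> indicator (- ball 0 1) x * norm x powr (- (N + \<epsilon>))"
         "0 \<le> M * (u0 x / (norm x)\<^sup>2)" "0 \<le> indicator (ball 0 1) x * (K * r powr (- N))"
        using M K u0(2)[of x] by auto
      have "\<bar>u0 x - K / 2 * E0 0 x\<bar> * A \<le> D x"
      proof (cases "x = 0")
        case True
        \<comment> \<open>At the origin the weight has the value
          \<open>0 powr (- N) = 0\<close>.\<close>
        thus ?thesis using terms by (simp add: A_def D_def)
      next
        case x0: False
        consider "norm x < r" | "r \<le> norm x" "norm x < 1" | "norm x \<ge> 1" "norm x < R" | "norm x \<ge> 1" "norm x \<ge> R" by linarith
        thus ?thesis
        proof cases
          case 1
          have x1: "norm x < 1" using 1 r by linarith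
          have "\<bar>u0 x - K / 2 * E0 0 x\<bar> = \<bar>K - u0 x\<bar>" using x1 by (simp add: E0_def)
          also have "\<dots> \<le> norm x powr \<delta>" using 1 r x0 by (intro r0(2)) auto
          also have "\<dots> \<le> norm x powr d" using x1 d x0 by (intro powr_mono') auto
          finally have "\<bar>u0 x - K / 2 * E0 0 x\<bar> * A \<le> norm x powr d * A" using A by (intro mult_right_mono)
          also have "\<dots> = indicator (ball 0 1) x * norm x powr (- (N - d))"
            using x1 by (simp add: A_def powr_add[symmetric])
          finally show ?thesis using terms unfolding D_def by linarith
        next
          case 2
          have "\<bar>u0 x - K / 2 * E0 0 x\<bar> * A \<le> (u0 x + K) * A"
            using 2 u0(2)[of x] K A by (intro mult_right_mono) (auto simp: E0_def)
          also have "\<dots> = u0 x * A + K * A" by (simp add: distrib_right)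
          also have "u0 x * A \<le> u0 x * (M / (norm x)\<^sup>2)" unfolding A_def using M2[OF 2(1)] u0(2) by (intro mult_left_mono)
          also have "K * A \<le> K * r powr (- N)" unfolding A_def using 2 r N K by (intro mult_left_mono powr_mono2') auto
          finally have "\<bar>u0 x - K / 2 * E0 0 x\<bar> * A \<le> M * (u0 x / (norm x)\<^sup>2) + indicator (ball 0 1) x * (K * r powr (- N))"
            using 2 by (simp add: mult_ac)
          thus ?thesis using terms unfolding D_def by linarith
        next
          case 3
          have rx: "norm x \<ge> r" using 3 r by linarith
          have "\<bar>u0 x - K / 2 * E0 0 x\<bar> * A = u0 x * A" using 3 u0(2)[of x] by (simp add: E0_def)
          also have "\<dots> \<le> u0 x * (M / (norm x)\<^sup>2)" unfolding A_def using M2[OF rx] u0(2) by (intro mult_left_mono)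
          finally have "\<bar>u0 x - K / 2 * E0 0 x\<bar> * A \<le> M * (u0 x / (norm x)\<^sup>2)" by (simp add: mult_ac)
          thus ?thesis using terms unfolding D_def by linarith
        next
          case 4
          have "\<bar>u0 x - K / 2 * E0 0 x\<bar> * A = u0 x * A" using 4 u0(2)[of x] by (simp add: E0_def)
          also have "\<dots> \<le> norm x powr (- \<epsilon>) * A" using 4 A by (intro mult_right_mono R0) (auto simp: R_def)
          also have "\<dots> = norm x powr (- (N + \<epsilon>))"
            unfolding A_def powr_add[symmetric] by (simp add: add.commute)
          also have "\<dots> = indicator (- ball 0 1) x * norm x powr (- (N + \<epsilon>))" using 4 by simp
          finally show ?thesis using terms unfolding D_def by linarith
        qed
      qed
      thus "norm (\<bar>u0 x - K / 2 * E0 0 x\<bar> * norm x powr (- N)) \<le> norm (D x)" using A by (simp add: A_def)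
    qed
  qed
qed

theorem theorem1p2:
  fixes u :: "real \<Rightarrow> 'a::euclidean_space \<Rightarrow> real"
    and u0 :: "'a \<Rightarrow> real"
    and K \<delta> \<epsilon> :: real
  assumes "DIM('a) \<ge> 3"
    and "strong_solution u0 u"
    and "u0 \<in> L12"
    and "\<forall>x. u0 x \<ge> 0"
    and "u0 0 = K" and "K > 0"
    and "\<delta> > 0" and "\<epsilon> > 0"
    and "\<forall>\<^sub>F x in at 0. \<bar>K - u0 x\<bar> \<le> norm x powr \<delta>"
    and "\<forall>\<^sub>F x in at_infinity. u0 x \<le> norm x powr (- \<epsilon>)"
  shows "(\<forall>\<^sub>F t in at_top. Linf_norm UNIV (\<lambda>x. u t x - K / 2 * E x t) < \<infinity>) \<and>
         (\<lambda>t. real_of_ereal (Linf_norm UNIV (\<lambda>x. u t x - K / 2 * E x t)))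
           \<in> O[at_top](\<lambda>t. t powr (- 1 / 2))"
proof -
  have weak: "weak_solution u0 u" using assms(2) by (simp add: strong_solution_def)
  obtain W where W: "L12_subsolution (\<lambda>t x. \<bar>u t x - K / 2 * E0 t x\<bar>) W"
    using strong_solution_subsolution[OF assms(1,2)] by blast
  interpret L12_subsolution "\<lambda>t x. \<bar>u t x - K / 2 * E0 t x\<bar>" W by (rule W)
  have u_meas: "u t \<in> borel_measurable lebesgue" if "t \<ge> 0" for t
    using weak that by (simp add: weak_solution_def continuous_in_L12_def L12_def)
  have E0_meas: "(E0 t :: 'a \<Rightarrow> real) \<in> borel_measurable lebesgue" for t by (rule borel_imp_lebesgue[OF E0_borel])
  have "integrable lebesgue (\<lambda>x. \<bar>u 0 x - K / 2 * E0 0 x\<bar> * norm x powr (- real DIM('a)))"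
  proof (rule integrable_cong_AE_imp)
    show "integrable lebesgue (\<lambda>x. \<bar>u0 x - K / 2 * E0 0 x\<bar> * norm x powr (- real DIM('a)))"
      using assms by (intro initial_deviation_integrable) auto
    have "(\<lambda>x::'a. norm x powr (- real DIM('a))) \<in> borel_measurable lebesgue"
      by (intro borel_imp_lebesgue powr_real_measurable) auto
    thus "(\<lambda>x. \<bar>u 0 x - K / 2 * E0 0 x\<bar> * norm x powr (- real DIM('a))) \<in> borel_measurable lebesgue"
      using u_meas[of 0] E0_meas[of 0]
      by (intro borel_measurable_times borel_measurable_abs borel_measurable_diff borel_measurable_const) auto
    \<comment> \<open>The initial value is attained only almost everywhere, so integrability is
      transferred from \<open>u0\<close> to \<open>u 0\<close>.\<close>
    have "AE x in lebesgue. u 0 x = u0 x" using weak by (simp add: weak_solution_def)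
    thus "AE x in lebesgue. \<bar>u0 x - K / 2 * E0 0 x\<bar> * norm x powr (- real DIM('a)) = \<bar>u 0 x - K / 2 * E0 0 x\<bar> * norm x powr (- real DIM('a))"
      by eventually_elim simp
  qed
  from decay[OF this] obtain C where C: "\<And>t. t \<ge> 1 \<Longrightarrow> AE x in lebesgue. \<bar>u t x - K / 2 * E0 t x\<bar> \<le> C * t powr (- 1 / 2)"
    by blast
  have norm: "0 \<le> Linf_norm UNIV (\<lambda>x. u t x - K / 2 * E x t)"
    "Linf_norm UNIV (\<lambda>x. u t x - K / 2 * E x t) \<le> ereal (C * t powr (- 1 / 2))" if t: "t \<ge> 1" for t
  proof -
    have E: "E x t = E0 t x" for x :: 'a using t by (simp add: E0_def)
    have meas: "(\<lambda>x. ereal \<bar>u t x - K / 2 * E x t\<bar>) \<in> borel_measurable lebesgue"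
      unfolding E using u_meas[of t] E0_meas[of t] t
      by (intro borel_measurable_ereal borel_measurable_abs borel_measurable_diff borel_measurable_times borel_measurable_const) auto
    have eq: "Linf_norm UNIV (\<lambda>x. u t x - K / 2 * E x t) = esssup lebesgue (\<lambda>x. ereal \<bar>u t x - K / 2 * E x t\<bar>)"
      by (simp only: Linf_norm_def lebesgue_on_UNIV_eq)
    show "Linf_norm UNIV (\<lambda>x. u t x - K / 2 * E x t) \<le> ereal (C * t powr (- 1 / 2))"
      unfolding eq using C[OF t] by (intro esssup_I[OF meas]) (simp add: E)
    \<comment> \<open>Nonnegativity excludes the value minus infinity before the conversion to a
      real number.\<close>
    have "esssup lebesgue (\<lambda>x::'a. 0 :: ereal) \<le> esssup lebesgue (\<lambda>x. ereal \<bar>u t x - K / 2 * E x t\<bar>)"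
      by (rule esssup_mono[OF _]) auto
    moreover have "esssup lebesgue (\<lambda>x::'a. 0 :: ereal) = 0"
      by (rule esssup_const) simp
    ultimately show "0 \<le> Linf_norm UNIV (\<lambda>x. u t x - K / 2 * E x t)" unfolding eq by simp
  qed
  have "\<forall>\<^sub>F t in at_top. Linf_norm UNIV (\<lambda>x. u t x - K / 2 * E x t) < \<infinity>"
    using eventually_ge_at_top[of 1]
  proof eventually_elim
    case (elim t)
    thus ?case using norm(2)[OF elim] by (auto intro: le_less_trans)
  qed
  moreover have "(\<lambda>t. real_of_ereal (Linf_norm UNIV (\<lambda>x. u t x - K / 2 * E x t))) \<in> O[at_top](\<lambda>t. t powr (- 1 / 2))"
  proof (rule bigoI[of _ C])
    show "\<forall>\<^sub>F t in at_top. norm (real_of_ereal (Linf_norm UNIV (\<lambda>x. u t x - K / 2 * E x t))) \<le> C * norm (t powr (- 1 / 2))"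
      using eventually_ge_at_top[of 1]
    proof eventually_elim
      case (elim t)
      thus ?case using norm[OF elim]
        by (cases "Linf_norm UNIV (\<lambda>x. u t x - K / 2 * E x t)") auto
    qed
  qed
  ultimately show ?thesis by blast
qed

end
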